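(* Let $\{E_{2n-1},E_{2n},\gamma_n,\nu_n\}_{n=g_-,\dots,g_+}$ be candidate spectral data as defined in the context, let $\Phi(x,t,z)$ be the solution (assumed to exist) of the Riemann-Hilbert problem defined from these data in the context, which determines the potential $q(x,t)$ as in the context. Let $\Sigma$ and $\mathcal D$ be as in the context. If there exists a function $r_1(z)$ such that: (i) $r_1$ is holomorphic in $\mathbb C\setminus(\mathbb R\setminus\Sigma)$ with continuous boundary values $r_{1\pm}$ on $\mathbb R\setminus\Sigma$ from above and below; (ii) $r_1$ satisfies the jump relation $r_{1+}(z)=r_{1-}^{-1}(z)$ for $z\in\mathbb R\setminus\Sigma$; (iii) $r_1$ satisfies the asymptotic condition $r_1(z)=e^{izL_1}(1+O(1/z))$ as $z\to\infty$, for some $L_1>0$; (iv) $r_1\in\mathcal A_2(\mathcal D)$; then $q(x+L_1,t)=q(x,t)$.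
   Context: $\sigma_1=\begin{pmatrix}0&1\\1&0\end{pmatrix}$, $\sigma_3=\mathrm{diag}(1,-1)$, $U=\frac1{\sqrt2}\begin{pmatrix}1&1\\-i&i\end{pmatrix}$ (unitary), $[A,B]=AB-BA$; $\mathbb C^\pm$ are the open upper/lower half planes; $\mathcal A_2(\Omega)$ is the algebra of holomorphic $f$ on $\Omega$ such that there are $c,M>0$ with $|f(z)|\le Me^{c|z|^2}$ on $\Omega$. Candidate spectral data: a sequence $\{E_{2n-1},E_{2n},\gamma_n,\nu_n\}_{n=g_-,\dots,g_+}$ of real numbers $E_n$, $\gamma_n$ and signs $\nu_n$, with $g_-<g_+$ either finite or infinite, such that: $E_{2g_--1}<\dots<E_{n-1}<E_n<E_{n+1}<\dots<E_{2g_+}$; $\gamma_n\in[E_{2n-1},E_{2n}]$ and $\nu_n\in\{-1,0,1\}$ for all $n=g_-,\dots,g_+$; $R=\max_k|E_{2k}-E_{2k-1}|<\infty$; if $g_-$ and $g_+$ are finite, there exist $N,C$ such that $|E_n|>Cn^2$ for all $|n|>N$; if either $g_-$ or $g_+$ is infinite, there is $N>0$ such that the discs $D_n$ of radius $R$ centered at $(E_{2n}+E_{2n-1})/2$ are disjoint for $|n|\ge N$. If $g_-$ (resp. $g_+$) is finite, $E_{2g_--2}=-\infty$ (resp. $E_{2g_++1}=+\infty$). The gaps are $(E_{2n-1},E_{2n})$, and $\Sigma=\mathbb R\setminus\bigcup_n(E_{2n-1},E_{2n})$. $\mathcal D=\mathbb C\setminus(\mathbb R\cup\bigcup_n\overline{D_n})$.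 Counting function: $m\equiv0$ if no $\nu_k=0$. Otherwise let $\gamma_*$ be the $\gamma_k$ with $\nu_k=0$ closest to $0$; $m(z)=|\{\gamma_k:\gamma_*\le\gamma_k\le z,\nu_k=0\}|$ for $z\ge\gamma_*$, and $m(z)=|\{\gamma_k:z<\gamma_k<\gamma_*,\nu_k=0\}|$ for $z<\gamma_*$. Matrix $B$: $f^\pm(z)=\prod_{\nu_k=\pm1}\frac{\gamma_k-z}{\pi_k}$ and $$b^4(z)=-\prod_{\nu_k=0}\frac{(\gamma_k-z)^2}{(E_{2k}-z)(E_{2k-1}-z)}\prod_{\nu_k\ne0}\frac{\pi_k^2}{(E_{2k}-z)(E_{2k-1}-z)},$$ with $\pi_k=k\pi$ for $k\ne0$ and $\pi_0=1$ (empty products equal $1$). In $b$, the square root of the product of the factors $\gamma_k-z$ with $\nu_k=0$ has as branch cut the subset of the real axis where $m(z)$ is odd, and the fourth root of the product of the factors $(E_{2k}-z)(E_{2k-1}-z)$ has as branch cut $\bigcup_n[E_{4n-4},E_{4n-1}]$ (over the available indices). $B=i\,b\,\mathrm{diag}(f^-,f^+)$ on $\mathbb C^+$, $B=b\,\mathrm{diag}(f^+,f^-)$ on $\mathbb C^-$. Riemann-Hilbert problem: find a $2\times2$ matrix $\Phi(x,t,z)$ such that (1) $\Phi$ is holomorphic in $z$ for $z\in\mathbb C\setminus\mathbb R$; (2) the boundary values $\Phi^\pm$ from $\mathbb C^\pm$ are continuous for $z\in\mathbb R\setminus\{E_k\}$, with at worst quartic root singularities on $\{E_k\}$; (3) $\Phi^+=\Phi^-\check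 V$, with $\check V=(-1)^{n+m(z)}\mathrm{diag}(f^-/f^+,f^+/f^-)$ on $[E_{2n-2},E_{2n-1}]$ and $\check V=(-1)^{n+m(z)}i\,e^{-2izx\sigma_3-4iz^2t\sigma_3}\sigma_1$ on $[E_{2n-1},E_{2n}]$; (4) $\Phi=U(I+O(1/z))B(z)$ as $z\to\infty$ with $z\in\mathbb C$; (5) there are positive constants $c,M$ with $|\phi_{ij}(x,t,z)|\le Me^{c|z|^2}$ for all $z\in\mathcal D$. Potential: $q(x,t)$ is the $(1,2)$ entry of $Q(x,t)=\lim_{z\to\infty}iz[\sigma_3,U^{-1}\Phi(x,t,z)B(z)^{-1}]$. *)

theory Defs
  imports "HOL-Complex_Analysis.Complex_Analysis" "HOL-Library.Extended"
    "HOL-Library.Landau_Symbols"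
begin

section \<open>Two by two complex matrices\<close>

type_synonym cmat2 = "complex ^ 2 ^ 2"

definition mat2 :: "complex \<Rightarrow> complex \<Rightarrow> complex \<Rightarrow> complex \<Rightarrow> cmat2" where
  "mat2 a b c d = vector [vector [a, b], vector [c, d]]"

definition smul :: "complex \<Rightarrow> cmat2 \<Rightarrow> cmat2" where
  "smul c A = (\<chi> i j. c * A $ i $ j)"

definition sigma1 :: cmat2 where
  "sigma1 = mat2 0 1 1 0"

definition sigma3 :: cmat2 where
  "sigma3 = mat2 1 0 0 (-1)"

definition Umat :: cmat2 where
  "Umat = smul (1 / complex_of_real (sqrt 2)) (mat2 1 1 (-\<i>) \<i>)"

definition commutator :: "cmat2 \<Rightarrow> cmat2 \<Rightarrow> cmat2" where
  "commutator A B = A ** B - B ** A"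

text \<open>The matrix exponential of \<open>w \<sigma>\<^sub>3\<close>.\<close>
definition exp_sigma3 :: "complex \<Rightarrow> cmat2" where
  "exp_sigma3 w = mat2 (exp w) 0 0 (exp (- w))"

section \<open>Half planes, boundary values, growth\<close>

definition upper_half :: "complex set" where
  "upper_half = {z. Im z > 0}"

definition lower_half :: "complex set" where
  "lower_half = {z. Im z < 0}"

definition boundary_values ::
  "(complex \<Rightarrow> 'a::topological_space) \<Rightarrow> real set \<Rightarrow> (real \<Rightarrow> 'a) \<Rightarrow> (real \<Rightarrow> 'a) \<Rightarrow> bool" where
  "boundary_values F X Fp Fm \<longleftrightarrow>
     continuous_on X Fp \<and> continuous_on X Fm \<and>
     (\<forall>x\<in>X. (F \<longlongrightarrow> Fp x) (at (complex_of_real x) within upper_half) \<and>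
            (F \<longlongrightarrow> Fm x) (at (complex_of_real x) within lower_half))"

definition A2 :: "complex set \<Rightarrow> (complex \<Rightarrow> complex) set" where
  "A2 \<Omega> = {f. f holomorphic_on \<Omega> \<and>
     (\<exists>c M. c > 0 \<and> M > 0 \<and> (\<forall>z\<in>\<Omega>. cmod (f z) \<le> M * exp (c * (cmod z)\<^sup>2)))}"

section \<open>Candidate spectral data\<close>

text \<open>The data are \<open>E\<^sub>2\<^sub>n\<^sub>-\<^sub>1, E\<^sub>2\<^sub>n, \<gamma>\<^sub>n, \<nu>\<^sub>n\<close> for integers \<open>g\<^sub>- \<le> n \<le> g\<^sub>+\<close>, where
  \<open>g\<^sub>-\<close> may be \<open>-\<infinity>\<close> and \<open>g\<^sub>+\<close> may be \<open>\<infinity>\<close>. Values of the functions outside the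
  index range are irrelevant.\<close>
record spectral_data =
  gmin :: "int extended"
  gmax :: "int extended"
  edge :: "int \<Rightarrow> real"
  gam :: "int \<Rightarrow> real"
  nu :: "int \<Rightarrow> int"

definition gap_idx :: "spectral_data \<Rightarrow> int set" where
  "gap_idx S = {n. gmin S \<le> Fin n \<and> Fin n \<le> gmax S}"

definition edge_idx :: "spectral_data \<Rightarrow> int set" where
  "edge_idx S = {j. \<exists>n\<in>gap_idx S. j = 2 * n - 1 \<or> j = 2 * n}"

definition edges :: "spectral_data \<Rightarrow> real set" where
  "edges S = edge S ` edge_idx S"

text \<open>\<open>E\<^sub>j\<close> extended by \<open>-\<infinity>\<close> to the left and by \<open>\<infinity>\<close> to the right of the index range.\<close>
definition ext_edge :: "spectral_data \<Rightarrow> int \<Rightarrow> real extended" where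
  "ext_edge S j = (if j \<in> edge_idx S then Fin (edge S j)
                   else if \<forall>i\<in>edge_idx S. j < i then Minf else Pinf)"

definition radius :: "spectral_data \<Rightarrow> real" where
  "radius S = (SUP k\<in>gap_idx S. \<bar>edge S (2 * k) - edge S (2 * k - 1)\<bar>)"

definition disc :: "spectral_data \<Rightarrow> int \<Rightarrow> complex set" where
  "disc S n = ball (complex_of_real ((edge S (2 * n) + edge S (2 * n - 1)) / 2)) (radius S)"

definition candidate_spectral_data :: "spectral_data \<Rightarrow> bool" where
  "candidate_spectral_data S \<longleftrightarrow>
     gmin S < gmax S \<and>
     (\<forall>i\<in>edge_idx S. \<forall>j\<in>edge_idx S. i < j \<longrightarrow> edge S i < edge S j) \<and>
     (\<forall>n\<in>gap_idx S. gam S n \<in> {edge S (2 * n - 1)..edge S (2 * n)} \<and> nu S n \<in> {-1, 0, 1}) \<and>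
     bdd_above ((\<lambda>k. \<bar>edge S (2 * k) - edge S (2 * k - 1)\<bar>) ` gap_idx S) \<and>
     (gmin S \<noteq> Minf \<and> gmax S \<noteq> Pinf \<longrightarrow>
        (\<exists>N C. C > 0 \<and>
           (\<forall>n\<in>edge_idx S. real_of_int \<bar>n\<bar> > N \<longrightarrow> \<bar>edge S n\<bar> > C * (real_of_int n)\<^sup>2))) \<and>
     (gmin S = Minf \<or> gmax S = Pinf \<longrightarrow>
        (\<exists>N>0. disjoint_family_on (disc S) {n \<in> gap_idx S. \<bar>n\<bar> \<ge> N}))"

definition gaps :: "spectral_data \<Rightarrow> real set" where
  "gaps S = (\<Union>n\<in>gap_idx S. {edge S (2 * n - 1)<..<edge S (2 * n)})"

definition Sigma_set :: "spectral_data \<Rightarrow> real set" where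
  "Sigma_set S = UNIV - gaps S"

definition Dom :: "spectral_data \<Rightarrow> complex set" where
  "Dom S = - (\<real> \<union> (\<Union>n\<in>gap_idx S. closure (disc S n)))"

text \<open>\<open>z \<rightarrow> \<infinity>\<close> inside \<open>Dom S\<close>. For finitely many gaps this is the same as \<open>z \<rightarrow> \<infinity>\<close> in
  the complement of the real axis. For infinitely many gaps the discs have to be left out: the
  matrix \<open>B\<close> below degenerates at points of each of the gaps.\<close>
definition at_inf :: "spectral_data \<Rightarrow> complex filter" where
  "at_inf S = inf at_infinity (principal (Dom S))"

section \<open>The counting function and the matrix \<open>B\<close>\<close>

definition zero_idx :: "spectral_data \<Rightarrow> int set" where
  "zero_idx S = {k \<in> gap_idx S. nu S k = 0}"

text \<open>If two of the \<open>\<gamma>\<^sub>k\<close> are equally close to \<open>0\<close>, an arbitrary one of them is chosen.\<close>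
definition gam_star :: "spectral_data \<Rightarrow> real" where
  "gam_star S = gam S (arg_min (\<lambda>k. \<bar>gam S k\<bar>) (\<lambda>k. k \<in> zero_idx S))"

definition mcount :: "spectral_data \<Rightarrow> real \<Rightarrow> nat" where
  "mcount S z =
     (if zero_idx S = {} then 0
      else if z \<ge> gam_star S
      then card {gam S k | k. k \<in> zero_idx S \<and> gam_star S \<le> gam S k \<and> gam S k \<le> z}
      else card {gam S k | k. k \<in> zero_idx S \<and> z < gam S k \<and> gam S k < gam_star S})"

text \<open>Products over subsets of the integers, which may be infinite in both directions, are limits of
  the symmetric partial products over \<open>|k| \<le> n\<close>. Convergence is meant in the usual sense for
  infinite products, so the value is nonzero unless one of the factors vanishes.\<close>
definition sym_factor :: "int set \<Rightarrow> (int \<Rightarrow> complex) \<Rightarrow> nat \<Rightarrow> complex" where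
  "sym_factor A a n = (\<Prod>k\<in>{k \<in> A. \<bar>k\<bar> = int n}. a k)"

definition int_prod :: "int set \<Rightarrow> (int \<Rightarrow> complex) \<Rightarrow> complex" where
  "int_prod A a = prodinf (sym_factor A a)"

definition int_prod_converges :: "int set \<Rightarrow> (int \<Rightarrow> complex) \<Rightarrow> bool" where
  "int_prod_converges A a \<longleftrightarrow> convergent_prod (sym_factor A a)"

definition pi_seq :: "int \<Rightarrow> complex" where
  "pi_seq k = (if k = 0 then 1 else of_int k * of_real pi)"

definition f_factor :: "spectral_data \<Rightarrow> complex \<Rightarrow> int \<Rightarrow> complex" where
  "f_factor S z k = (of_real (gam S k) - z) / pi_seq k"

definition fpm :: "spectral_data \<Rightarrow> int \<Rightarrow> complex \<Rightarrow> complex" where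
  "fpm S s z = int_prod {k \<in> gap_idx S. nu S k = s} (f_factor S z)"

abbreviation f_plus :: "spectral_data \<Rightarrow> complex \<Rightarrow> complex" where
  "f_plus S \<equiv> fpm S 1"

abbreviation f_minus :: "spectral_data \<Rightarrow> complex \<Rightarrow> complex" where
  "f_minus S \<equiv> fpm S (-1)"

definition edge_factor :: "spectral_data \<Rightarrow> complex \<Rightarrow> int \<Rightarrow> complex" where
  "edge_factor S z k = (of_real (edge S (2 * k)) - z) * (of_real (edge S (2 * k - 1)) - z)"

definition b4_factor0 :: "spectral_data \<Rightarrow> complex \<Rightarrow> int \<Rightarrow> complex" where
  "b4_factor0 S z k = (of_real (gam S k) - z)\<^sup>2 / edge_factor S z k"

definition b4_factor1 :: "spectral_data \<Rightarrow> complex \<Rightarrow> int \<Rightarrow> complex" where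
  "b4_factor1 S z k = (pi_seq k)\<^sup>2 / edge_factor S z k"

definition b4 :: "spectral_data \<Rightarrow> complex \<Rightarrow> complex" where
  "b4 S z = - (int_prod (zero_idx S) (b4_factor0 S z)
               * int_prod (gap_idx S - zero_idx S) (b4_factor1 S z))"

definition products_converge :: "spectral_data \<Rightarrow> bool" where
  "products_converge S \<longleftrightarrow>
     (\<forall>z. \<forall>s\<in>{-1, 1}. int_prod_converges {k \<in> gap_idx S. nu S k = s} (f_factor S z)) \<and>
     (\<forall>z. z \<notin> \<real> \<longrightarrow> int_prod_converges (zero_idx S) (b4_factor0 S z) \<and>
                    int_prod_converges (gap_idx S - zero_idx S) (b4_factor1 S z))"

definition root4_cut :: "spectral_data \<Rightarrow> real set" where
  "root4_cut S = {x. \<exists>n. ext_edge S (4 * n - 4) \<le> Fin x \<and> Fin x \<le> ext_edge S (4 * n - 1)}"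

text \<open>The branch \<open>b\<close> of the fourth root of \<open>b4\<close>. For infinitely many gaps the square root of the
  product of the \<open>\<gamma>\<^sub>k - z\<close> and the fourth root of the product of the
  \<open>(E\<^sub>2\<^sub>k - z)(E\<^sub>2\<^sub>k\<^sub>-\<^sub>1 - z)\<close> need not converge separately, so the branch cuts are expressed
  through \<open>b\<close> itself: off the cut of the fourth root, \<open>b\<close> changes across the real axis by the sign
  of the square root, which is \<open>-1\<close> exactly where \<open>m\<close> is odd. As some gap lies off the cut
  of the fourth root, this determines \<open>b\<close> up to a constant factor \<open>\<i>\<^sup>k\<close>, and fixes its jumps
  on that cut.\<close>
definition b_branch :: "spectral_data \<Rightarrow> (complex \<Rightarrow> complex) \<Rightarrow> bool" where
  "b_branch S b \<longleftrightarrow>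
     b holomorphic_on (- \<real>) \<and>
     (\<forall>z. z \<notin> \<real> \<longrightarrow> b z ^ 4 = b4 S z) \<and>
     (\<forall>x. x \<notin> root4_cut S \<and> x \<notin> edges S \<and> x \<notin> gam S ` zero_idx S \<longrightarrow>
        (\<exists>l. (b \<longlongrightarrow> (-1) ^ mcount S x * l) (at (complex_of_real x) within upper_half) \<and>
             (b \<longlongrightarrow> l) (at (complex_of_real x) within lower_half)))"

definition Bmat :: "spectral_data \<Rightarrow> (complex \<Rightarrow> complex) \<Rightarrow> complex \<Rightarrow> cmat2" where
  "Bmat S b z =
     (if Im z > 0 then smul (\<i> * b z) (mat2 (f_minus S z) 0 0 (f_plus S z))
      else smul (b z) (mat2 (f_plus S z) 0 0 (f_minus S z)))"

section \<open>The Riemann-Hilbert problem and the potential\<close>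

definition V_band :: "spectral_data \<Rightarrow> int \<Rightarrow> real \<Rightarrow> cmat2" where
  "V_band S n s =
     (let z = complex_of_real s in
      smul ((-1) powi (n + int (mcount S s)))
        (mat2 (f_minus S z / f_plus S z) 0 0 (f_plus S z / f_minus S z)))"

definition V_gap :: "spectral_data \<Rightarrow> real \<Rightarrow> real \<Rightarrow> int \<Rightarrow> real \<Rightarrow> cmat2" where
  "V_gap S x t n s =
     (let z = complex_of_real s in
      smul ((-1) powi (n + int (mcount S s)) * \<i>)
        (exp_sigma3 (- 2 * \<i> * z * of_real x - 4 * \<i> * z\<^sup>2 * of_real t) ** sigma1))"

text \<open>The quartic root bound at the \<open>E\<^sub>k\<close> is imposed on \<open>\<Phi>\<close> in a full neighbourhood of
  \<open>E\<^sub>k\<close> off the real axis, and hence on the boundary values. The band with index \<open>n\<close> is empty if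
  both of its extended end points are infinite with the same sign.\<close>
definition RHP_solution ::
  "spectral_data \<Rightarrow> (complex \<Rightarrow> complex) \<Rightarrow> real \<Rightarrow> real \<Rightarrow> (complex \<Rightarrow> cmat2) \<Rightarrow> bool" where
  "RHP_solution S b x t \<Phi> \<longleftrightarrow>
     (\<forall>i j. (\<lambda>z. \<Phi> z $ i $ j) holomorphic_on (- \<real>)) \<and>
     (\<exists>\<Phi>p \<Phi>m.
        boundary_values \<Phi> (UNIV - edges S) \<Phi>p \<Phi>m \<and>
        (\<forall>n. \<forall>s. s \<notin> edges S \<and> ext_edge S (2 * n - 2) \<le> Fin s \<and> Fin s \<le> ext_edge S (2 * n - 1)
           \<longrightarrow> \<Phi>p s = \<Phi>m s ** V_band S n s) \<and>
        (\<forall>n\<in>gap_idx S. \<forall>s. s \<notin> edges S \<and> edge S (2 * n - 1) \<le> s \<and> s \<le> edge S (2 * n)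
           \<longrightarrow> \<Phi>p s = \<Phi>m s ** V_gap S x t n s)) \<and>
     (\<forall>e\<in>edges S. \<forall>i j.
        (\<lambda>z. \<Phi> z $ i $ j) \<in> O[at (complex_of_real e) within (- \<real>)](\<lambda>z. complex_of_real (cmod (z - of_real e) powr (- 1 / 4)))) \<and>
     (\<exists>Err. (\<forall>\<^sub>F z in at_inf S. \<Phi> z = Umat ** (mat 1 + Err z) ** Bmat S b z) \<and>
            (\<forall>i j. (\<lambda>z. Err z $ i $ j) \<in> O[at_inf S](\<lambda>z. 1 / z))) \<and>
     (\<exists>c M. c > 0 \<and> M > 0 \<and>
        (\<forall>z\<in>Dom S. \<forall>i j. cmod (\<Phi> z $ i $ j) \<le> M * exp (c * (cmod z)\<^sup>2)))"

definition potential_value ::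
  "spectral_data \<Rightarrow> (complex \<Rightarrow> complex) \<Rightarrow> (complex \<Rightarrow> cmat2) \<Rightarrow> complex \<Rightarrow> bool" where
  "potential_value S b \<Phi> q \<longleftrightarrow>
     (\<exists>Q. ((\<lambda>z. smul (\<i> * z)
              (commutator sigma3 (matrix_inv Umat ** \<Phi> z ** matrix_inv (Bmat S b z)))) \<longlongrightarrow> Q)
            (at_inf S) \<and>
          q = Q $ 1 $ 2)"

text \<open>The set \<open>\<real> \<setminus> \<Sigma>\<close> of open gaps is not closed. Accordingly, holomorphic in its complement
  is read as holomorphic in the interior of the complement, and continuous on all of it, that is,
  also at the end points \<open>E\<^sub>k\<close>, where functions with the required jumps have square root branch
  points and are not differentiable.\<close>
definition holomorphic_off_gaps :: "spectral_data \<Rightarrow> (complex \<Rightarrow> complex) \<Rightarrow> bool" where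
  "holomorphic_off_gaps S r \<longleftrightarrow>
     r holomorphic_on interior (- complex_of_real ` (- Sigma_set S)) \<and>
     continuous_on (- complex_of_real ` (- Sigma_set S)) r"

end

theory Submission
  imports Defs
begin

text \<open>Put \<open>\<rho> = r\<^sub>1 exp (- i z L)\<close>. The relation \<open>r\<^sub>1\<^sub>+ r\<^sub>1\<^sub>- = 1\<close> on the gaps makes
  \<open>\<Psi> = \<Phi>(x + L) diag (\<rho>, 1/\<rho>)\<close> have the jumps of \<open>\<Phi>(x)\<close>, and \<open>\<rho> = 1 + O(1/z)\<close>, so that uniqueness
  for the Riemann-Hilbert problem gives \<open>\<Psi> = \<Phi>(x)\<close> and hence the claim. Two points need care.

  First, \<open>r\<^sub>1\<close> must have no zeros. The function \<open>k(z) = r\<^sub>1(z) cnj (r\<^sub>1(cnj z))\<close> has modulus one on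
  the gaps and tends to one at infinity, so \<open>\<bar>k\<bar> \<le> 1\<close>. For finitely many gaps \<open>k = 1\<close> by the maximum
  principle at infinity. For infinitely many gaps \<open>arg k\<close> from above is monotone along a gap, as
  \<open>\<bar>k\<bar> \<le> 1\<close>, and along a gap far out, where \<open>k\<close> is close to one, it vanishes at both ends; again
  \<open>k = 1\<close>.

  Secondly, the brackets \<open>\<Psi>\<^sub>i\<^sub>1 \<Phi>\<^sub>j\<^sub>2 - \<Psi>\<^sub>i\<^sub>2 \<Phi>\<^sub>j\<^sub>1\<close> are entire because the jumps have
  determinant one, and Liouville's theorem applies once \<open>det B\<close> is bounded from above and below away
  from the discs. The asymptotics of \<open>r\<^sub>1\<close> on both sides of a gap near \<open>s\<close> force
  \<open>exp (2 i s L) = 1 + O(1/s)\<close>, so the gap has length \<open>O(1/s)\<close>, and the product for \<open>det B\<close> squared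
  is controlled by the sum of the squares of these lengths.\<close>

section \<open>Extension across the real axis\<close>

text \<open>The dressing contains \<open>1 / \<rho>\<close>, so a zero of \<open>r\<^sub>1\<close>
  would create a pole. The jump relation controls \<open>r\<^sub>1\<close> only on the gaps;
  elsewhere zeros are excluded by \<open>k = 1\<close>, which makes the Schwarz reflection of
  \<open>r\<^sub>1\<close> its reciprocal.

  The normalization at infinity is available only outside the discs. Far out the discs are disjoint,
  so the circle around one stays outside the others, and the maximum principle carries bounds into
  each disc.

  The brackets replace the entries of \<open>\<Psi>\<close> times the inverse of
  \<open>\<Phi>\<close>: being polynomial, they are available before \<open>det \<Phi>\<close> is
  known to be a nonzero constant. Outside the discs each is \<open>det B\<close> times a function
  with a limit at infinity.

  A factor of the product for \<open>(det B)^2\<close> is \<open>1 + O(l / d)\<close>, with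
  \<open>l\<close> the length of the gap and \<open>d\<close> the distance from \<open>z\<close> to
  its center. For merely bounded \<open>l\<close> the sum of \<open>l / d\<close> may diverge like
  the harmonic series. In \<open>2 l / d \<le> l^2 + 1 / d^2\<close> the decay of the lengths
  controls the first sum and the separation of the centers the second, uniformly in
  \<open>z\<close>. The decay uses \<open>L > 0\<close>: the phase \<open>2 s L\<close> stays near
  multiples of \<open>2 pi\<close> along a whole gap.\<close>

lemma upper_half_islimpt: "at (complex_of_real s) within upper_half \<noteq> bot"
proof -
  have "complex_of_real s islimpt upper_half"
    unfolding islimpt_approachable
  proof (intro allI impI)
    fix e :: real assume "e > 0"
    then show "\<exists>x'\<in>upper_half. x' \<noteq> complex_of_real s \<and> dist x' (complex_of_real s) < e"
      by (intro bexI[of _ "Complex s (e/2)"])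
         (auto simp: upper_half_def dist_norm cmod_def complex_eq_iff)
  qed
  then show ?thesis by (simp add: trivial_limit_within)
qed

lemma lower_half_islimpt: "at (complex_of_real s) within lower_half \<noteq> bot"
proof -
  have "complex_of_real s islimpt lower_half"
    unfolding islimpt_approachable
  proof (intro allI impI)
    fix e :: real assume "e > 0"
    then show "\<exists>x'\<in>lower_half. x' \<noteq> complex_of_real s \<and> dist x' (complex_of_real s) < e"
      by (intro bexI[of _ "Complex s (-e/2)"])
         (auto simp: lower_half_def dist_norm cmod_def complex_eq_iff)
  qed
  then show ?thesis by (simp add: trivial_limit_within)
qed

lemma nonreal_eq_halves: "- \<real> = upper_half \<union> lower_half"
  by (auto simp: upper_half_def lower_half_def complex_is_Real_iff)

lemma nonreal_islimpt: "at (complex_of_real s) within (- \<real>) \<noteq> bot"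
  unfolding nonreal_eq_halves at_within_union using upper_half_islimpt[of s] by simp

lemma limit_nonreal_iff:
  "(H \<longlongrightarrow> l) (at z within (- \<real>)) \<longleftrightarrow>
    (H \<longlongrightarrow> l) (at z within upper_half) \<and> (H \<longlongrightarrow> l) (at z within lower_half)"
  unfolding nonreal_eq_halves by (simp add: Lim_within_Un)

lemma eventually_within_ball:
  "w \<in> ball z d \<Longrightarrow> eventually (\<lambda>v. v \<in> ball z d) (at w within A)"
  unfolding eventually_at_topological by (intro exI[of _ "ball z d"]) auto

text \<open>Continuity is extracted from pointwise limits: \<open>h u\<close> is itself a limit of
  values of \<open>H\<close> near \<open>u\<close>, and these are already within \<open>e/2\<close>
  of \<open>h s\<close>. A continuous function that is holomorphic on both sides of a line is
  holomorphic across it.\<close>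

lemma paste_across_reals:
  fixes H :: "complex \<Rightarrow> complex" and h :: "real \<Rightarrow> complex"
  assumes T: "open T" and H: "H holomorphic_on (T - \<real>)"
    and lim: "\<And>s. complex_of_real s \<in> T \<Longrightarrow> (H \<longlongrightarrow> h s) (at (complex_of_real s) within (- \<real>))"
  shows "(\<lambda>z. if z \<in> \<real> then h (Re z) else H z) holomorphic_on T" (is "?g holomorphic_on T")
proof -
  have open_nonreal: "open (T - \<real>)"
    using T by (intro open_Diff closed_complex_Reals)
  have hol: "?g holomorphic_on (T - \<real>)"
    using H by (rule holomorphic_transform) auto
  have cont: "isCont ?g z" if z: "z \<in> T" for z
  proof (cases "z \<in> \<real>")
    case False
    then show ?thesis
      using hol open_nonreal z by (meson DiffI continuous_on_eq_continuous_at holomorphic_on_imp_continuous_on)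
  next
    case True
    then obtain s where s: "z = complex_of_real s" by (auto simp: Reals_def)
    show ?thesis unfolding continuous_at
    proof (rule tendstoI)
      fix e :: real assume e: "e > 0"
      have "eventually (\<lambda>w. dist (H w) (h s) < e/2) (at z within (- \<real>))"
        using lim[of s] z e unfolding s by (intro tendstoD) auto
      then obtain d where d: "d > 0" "\<And>w. w \<in> - \<real> \<Longrightarrow> w \<noteq> z \<Longrightarrow> dist w z < d \<Longrightarrow> dist (H w) (h s) < e/2"
        unfolding eventually_at by blast
      obtain d' where d': "d' > 0" "ball z d' \<subseteq> T" using T z openE by blast
      have "dist (?g w) (h s) < e" if w: "dist w z < min d d'" for w
      proof (cases "w \<in> \<real>")
        case False
        then show ?thesis using d(2)[of w] w e s by (cases "w = z") auto
      next
        case True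
        then obtain u where u: "w = complex_of_real u" by (auto simp: Reals_def)
        have "w \<in> T" using w d'(2) by (auto simp: dist_commute)
        then have L: "(H \<longlongrightarrow> h u) (at w within (- \<real>))" using lim[of u] u by simp
        have "eventually (\<lambda>v. v \<in> ball z d) (at w within (- \<real>))"
          using w by (intro eventually_within_ball) (auto simp: dist_commute)
        moreover have "eventually (\<lambda>v. v \<in> - \<real>) (at w within (- \<real>))"
          by (simp add: eventually_at_filter)
        ultimately have "eventually (\<lambda>v. dist (H v) (h s) \<le> e/2) (at w within (- \<real>))"
        proof eventually_elim
          case (elim v)
          then have "v \<noteq> z" using s by auto
          then show ?case using d(2)[of v] elim by (auto simp: dist_commute)
        qed
        then have "norm (h u - h s) \<le> e/2"
          using nonreal_islimpt[of u] L unfolding dist_norm u[symmetric]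
          by (intro Lim_norm_ubound[of "at w within (- \<real>)" "\<lambda>v. H v - h s"]) (auto intro!: tendsto_intros)
        then show ?thesis using e u by (simp add: dist_norm)
      qed
      then show "eventually (\<lambda>w. dist (?g w) (?g z) < e) (at z)"
        unfolding eventually_at using d(1) d'(1) s by (intro exI[of _ "min d d'"]) auto
    qed
  qed
  show ?thesis
  proof (rule holomorphic_on_paste_across_line[OF T, of \<i> ?g 0])
    show "?g holomorphic_on T \<inter> {z. \<i> \<bullet> z < 0}" "?g holomorphic_on T \<inter> {z. 0 < \<i> \<bullet> z}"
      by (rule holomorphic_on_subset[OF hol]; auto simp: inner_complex_def complex_is_Real_iff)+
    show "continuous_on T ?g" using cont by (simp add: continuous_at_imp_continuous_on)
  qed auto
qed

text \<open>The singularities in \<open>X\<close> are removable because their order is less than one.\<close>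
lemma extend_entire:
  fixes H :: "complex \<Rightarrow> complex" and X :: "real set"
  assumes H: "H holomorphic_on - \<real>"
    and X: "\<And>T. finite {s\<in>X. \<bar>s\<bar> \<le> T}"
    and lim: "\<And>s. s \<notin> X \<Longrightarrow> \<exists>l. (H \<longlongrightarrow> l) (at (complex_of_real s) within (- \<real>))"
    and growth: "\<And>e. e \<in> X \<Longrightarrow>
      H \<in> O[at (complex_of_real e) within (- \<real>)](\<lambda>z. complex_of_real (cmod (z - of_real e) powr (- 1 / 2)))"
  shows "\<exists>g. g holomorphic_on UNIV \<and> (\<forall>z\<in>- \<real>. g z = H z)"
proof -
  obtain h where h: "\<And>s. s \<notin> X \<Longrightarrow> (H \<longlongrightarrow> h s) (at (complex_of_real s) within (- \<real>))"
    using lim by metis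
  define X' where "X' = complex_of_real ` X"
  have X'mem: "complex_of_real s \<in> X' \<longleftrightarrow> s \<in> X" for s by (auto simp: X'_def)
  have fin: "finite (X' \<inter> cball 0 T)" for T
  proof -
    have "X' \<inter> cball 0 T \<subseteq> complex_of_real ` {s\<in>X. \<bar>s\<bar> \<le> T}" by (auto simp: X'_def)
    then show ?thesis using X[of T] by (meson finite_imageI finite_subset)
  qed
  \<comment> \<open>The ball of radius \<open>norm z + 1\<close> contains finitely many points of
    \<open>X'\<close>; all others have distance at least one from \<open>z\<close>, hence
    \<open>min d 1\<close>.\<close>
  have nbhd: "\<exists>d>0. \<forall>w\<in>X'. w \<noteq> z \<longrightarrow> d \<le> dist z w" for z
  proof -
    obtain d where d: "d > 0" "\<forall>w\<in>X' \<inter> cball 0 (norm z + 1). w \<noteq> z \<longrightarrow> d \<le> dist z w"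
      using finite_set_avoid[OF fin] by blast
    have "min d 1 \<le> dist z w" if "w \<in> X'" "w \<noteq> z" for w
    proof (cases "norm w \<le> norm z + 1")
      case True then show ?thesis using d(2) that by auto
    next
      case False
      then show ?thesis using norm_triangle_ineq2[of w z] by (auto simp: dist_norm norm_minus_commute)
    qed
    then show ?thesis using d(1) by (intro exI[of _ "min d 1"]) auto
  qed
  have opn: "open (- X')"
    unfolding open_dist
  proof
    fix z assume z: "z \<in> - X'"
    obtain d where "d > 0" "\<forall>w\<in>X'. w \<noteq> z \<longrightarrow> d \<le> dist z w" using nbhd by blast
    then show "\<exists>e>0. \<forall>y. dist y z < e \<longrightarrow> y \<in> - X'"
      using z by (intro exI[of _ d]) (auto simp: dist_commute)
  qed
  define G where "G = (\<lambda>z. if z \<in> \<real> then h (Re z) else H z)"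
  have G: "G holomorphic_on - X'"
    unfolding G_def using X'mem
    by (intro paste_across_reals opn holomorphic_on_subset[OF H] h) auto
  have sing: "\<exists>c. (G \<longlongrightarrow> c) (at z)" "isolated_singularity_at G z" for z
  proof -
    obtain d where d: "d > 0" "\<forall>w\<in>X'. w \<noteq> z \<longrightarrow> d \<le> dist z w" using nbhd by blast
    have sub: "ball z d - {z} \<subseteq> - X'" using d(2) by force
    have Gb: "G holomorphic_on ball z d - {z}" using G sub by (rule holomorphic_on_subset)
    then show "isolated_singularity_at G z"
      using d(1) by (auto simp: isolated_singularity_at_def analytic_on_open open_Diff)
    show "\<exists>c. (G \<longlongrightarrow> c) (at z)"
    proof (cases "z \<in> X'")
      case False
      then have "isCont G z"
        using G opn by (meson ComplI continuous_on_eq_continuous_at holomorphic_on_imp_continuous_on)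
      then show ?thesis by (auto simp: isCont_def)
    next
      case True
      then obtain e where e: "e \<in> X" "z = complex_of_real e" by (auto simp: X'_def)
      obtain C where C: "C > 0" "eventually (\<lambda>w. norm (H w) \<le> C * norm (complex_of_real (cmod (w - z) powr (- 1 / 2)))) (at z within (- \<real>))"
        using growth[OF e(1)] unfolding e(2)[symmetric] by (elim landau_o.bigE) auto
      then obtain d1 where d1: "d1 > 0"
        "\<And>w. w \<in> - \<real> \<Longrightarrow> w \<noteq> z \<Longrightarrow> dist w z < d1 \<Longrightarrow> norm (H w) \<le> C * (cmod (w - z) powr (- 1 / 2))"
        unfolding eventually_at by auto
      \<comment> \<open>The growth assumption speaks of points off the axis; at real points the
        bound is inherited by the limit \<open>h u\<close>.\<close>
      have bnd: "norm (G w) \<le> C * (cmod (w - z) powr (- 1 / 2))"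
        if w: "w \<noteq> z" "dist w z < min d d1" for w
      proof (cases "w \<in> \<real>")
        case False then show ?thesis using d1(2)[of w] w by (simp add: G_def)
      next
        case True
        then obtain u where u: "w = complex_of_real u" by (auto simp: Reals_def)
        have "w \<in> ball z d - {z}" using w by (auto simp: dist_commute)
        then have "w \<notin> X'" using sub by blast
        then have L: "(H \<longlongrightarrow> h u) (at w within (- \<real>))" using h[of u] u X'mem by simp
        have ev: "eventually (\<lambda>v. v \<in> ball z d1) (at w within (- \<real>))"
          using w by (intro eventually_within_ball) (auto simp: dist_commute)
        moreover have "eventually (\<lambda>v. v \<in> - \<real>) (at w within (- \<real>))"
          by (simp add: eventually_at_filter)
        ultimately have "eventually (\<lambda>v. norm (H v) \<le> C * (cmod (v - z) powr (- 1 / 2))) (at w within (- \<real>))"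
          proof eventually_elim
          case (elim v)
          then show ?case using d1(2)[of v] e(2) by (cases "v = z") (auto simp: dist_commute)
        qed
        moreover have "((\<lambda>v. C * (cmod (v - z) powr (- 1 / 2))) \<longlongrightarrow> C * (cmod (w - z) powr (- 1 / 2))) (at w within (- \<real>))"
          using w by (auto intro!: tendsto_intros)
        ultimately have "norm (h u) \<le> C * (cmod (w - z) powr (- 1 / 2))"
          using nonreal_islimpt[of u] L u by (intro tendsto_le[OF _ _ tendsto_norm]) auto
        then show ?thesis using u by (simp add: G_def)
      qed
      have "((\<lambda>w. (w - z) * G w) \<longlongrightarrow> 0) (at z)"
      proof (rule Lim_null_comparison)
        show "eventually (\<lambda>w. norm ((w - z) * G w) \<le> C * (cmod (w - z) powr (1 / 2))) (at z)"
          unfolding eventually_at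
        proof (intro exI[of _ "min d d1"] conjI ballI impI)
          fix w assume w: "w \<noteq> z \<and> dist w z < min d d1"
          then have "norm ((w - z) * G w) \<le> norm (w - z) * (C * (cmod (w - z) powr (- 1 / 2)))"
            unfolding norm_mult using bnd[of w] by (intro mult_left_mono) auto
          also have "\<dots> = C * (cmod (w - z) powr 1 * (cmod (w - z) powr (- 1 / 2)))" by simp
          also have "\<dots> = C * (cmod (w - z) powr (1 / 2))" unfolding powr_add[symmetric] by simp
          finally show "norm ((w - z) * G w) \<le> C * (cmod (w - z) powr (1 / 2))" .
        qed (use d d1 in auto)
        have "((\<lambda>w. cmod (w - z)) \<longlongrightarrow> 0) (at z)"
          using LIM_zero tendsto_norm_zero tendsto_ident_at by blast
        then have "((\<lambda>w. cmod (w - z) powr (1 / 2)) \<longlongrightarrow> 0 powr (1/2)) (at z)"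
          by (intro tendsto_powr') auto
        then show "((\<lambda>w. C * (cmod (w - z) powr (1 / 2))) \<longlongrightarrow> 0) (at z)"
          using tendsto_mult_right_zero by force
      qed
      then have "\<exists>g. g holomorphic_on ball z d \<and> (\<forall>w\<in>ball z d - {z}. g w = G w)"
        using holomorphic_on_extend_lim[OF Gb] d(1) by (auto simp: interior_open)
      then obtain g where g: "g holomorphic_on ball z d" "\<forall>w\<in>ball z d - {z}. g w = G w" by blast
      have "(g \<longlongrightarrow> g z) (at z)"
        using g(1) d(1) by (metis centre_in_ball continuous_on_eq_continuous_at holomorphic_on_imp_continuous_on isCont_def open_ball)
      moreover have "eventually (\<lambda>w. g w = G w) (at z)"
        using eventually_at_ball[OF d(1), of z UNIV] eventually_neq_at_within[of z z UNIV]
        by eventually_elim (use g(2) in auto)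
      ultimately show ?thesis using tendsto_cong by blast
    qed
  qed
  have "remove_sings G analytic_on {z}" for z
    using sing[of z] remove_sings_analytic_at by blast
  then have "remove_sings G holomorphic_on UNIV"
    using analytic_imp_holomorphic analytic_on_analytic_at by blast
  moreover have "remove_sings G z = H z" if "z \<in> - \<real>" for z
  proof -
    have "z \<in> - X'" using that by (auto simp: X'_def)
    then have "G analytic_on {z}" using G opn holomorphic_on_imp_analytic_at by blast
    then show ?thesis using that by (simp add: G_def)
  qed
  ultimately show ?thesis by blast
qed

section \<open>Families of gaps\<close>

text \<open>The nonnegative and the negative elements of \<open>J\<close> are each mapped
  injectively into the natural numbers by the absolute value, so \<open>2 * suminf u\<close> serves
  all finite sets at once.\<close>

lemma sum_inverse_squares_int:
  "\<exists>K. \<forall>J::int set. finite J \<longrightarrow> (\<Sum>j\<in>J. 1 / (1 + (real_of_int j)\<^sup>2)) \<le> K"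
proof -
  define u where "u = (\<lambda>n::nat. 1 / (1 + (real n)\<^sup>2))"
  have u0: "0 \<le> u n" for n by (simp add: u_def)
  have "summable (\<lambda>n. inverse ((real n)\<^sup>2))"
    using inverse_power_summable[of 2, where 'a=real] by simp
  then have sm: "summable u"
  proof (rule summable_comparison_test'[where N=1])
    fix n :: nat assume "1 \<le> n"
    then show "norm (u n) \<le> inverse ((real n)\<^sup>2)"
      unfolding u_def inverse_eq_divide by (auto intro!: divide_left_mono simp: add_pos_nonneg)
  qed
  have "(\<Sum>j\<in>J. 1 / (1 + (real_of_int j)\<^sup>2)) \<le> 2 * suminf u" if J: "finite J" for J :: "int set"
  proof -
    have eq: "1 / (1 + (real_of_int j)\<^sup>2) = u (nat \<bar>j\<bar>)" for j
      by (simp add: u_def)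
    have half: "(\<Sum>j\<in>J'. u (nat \<bar>j\<bar>)) \<le> suminf u" if "J' \<subseteq> J" "inj_on (\<lambda>j. nat \<bar>j\<bar>) J'" for J'
    proof -
      have "(\<Sum>j\<in>J'. u (nat \<bar>j\<bar>)) = sum u ((\<lambda>j. nat \<bar>j\<bar>) ` J')"
        using that(2) by (simp add: sum.reindex)
      also have "\<dots> \<le> suminf u"
        using sm u0 J that(1) by (intro sum_le_suminf) (auto intro: finite_subset)
      finally show ?thesis .
    qed
    have "(\<Sum>j\<in>J. u (nat \<bar>j\<bar>)) = (\<Sum>j\<in>{j\<in>J. 0 \<le> j} \<union> {j\<in>J. j < 0}. u (nat \<bar>j\<bar>))"
      by (rule sum.cong) auto
    also have "\<dots> = (\<Sum>j\<in>{j\<in>J. 0 \<le> j}. u (nat \<bar>j\<bar>)) + (\<Sum>j\<in>{j\<in>J. j < 0}. u (nat \<bar>j\<bar>))"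
      using J by (intro sum.union_disjoint) auto
    also have "\<dots> \<le> suminf u + suminf u"
      by (intro add_mono half) (auto simp: inj_on_def)
    finally show ?thesis unfolding eq by simp
  qed
  then show ?thesis by blast
qed

text \<open>\<open>separated\<close> expresses that the far discs of radius \<open>R\<close> are
  disjoint. Finitely many gaps fit as well, with \<open>N\<close> beyond all indices, so one setting
  covers bounded and unbounded index ranges.\<close>

locale gap_family =
  fixes I :: "int set" and \<alpha> \<beta> :: "int \<Rightarrow> real" and R :: real and N :: int
  assumes gap_nonempty: "n \<in> I \<Longrightarrow> \<alpha> n < \<beta> n"
    and gap_order: "m \<in> I \<Longrightarrow> n \<in> I \<Longrightarrow> m < n \<Longrightarrow> \<beta> m < \<alpha> n"
    and gap_length: "n \<in> I \<Longrightarrow> \<beta> n - \<alpha> n \<le> R"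
    and R_pos: "R > 0"
    and separated: "m \<in> I \<Longrightarrow> n \<in> I \<Longrightarrow> m \<noteq> n \<Longrightarrow> N \<le> \<bar>m\<bar> \<Longrightarrow> N \<le> \<bar>n\<bar> \<Longrightarrow>
      2 * R \<le> \<bar>(\<alpha> m + \<beta> m) / 2 - (\<alpha> n + \<beta> n) / 2\<bar>"
begin

definition center :: "int \<Rightarrow> real" where
  "center n = (\<alpha> n + \<beta> n) / 2"

definition gap_union :: "real set" where
  "gap_union = (\<Union>n\<in>I. {\<alpha> n<..<\<beta> n})"

definition endpoints :: "real set" where
  "endpoints = \<alpha> ` I \<union> \<beta> ` I"

definition outer_domain :: "complex set" where
  "outer_domain = {z. z \<notin> \<real> \<and> (\<forall>n\<in>I. R < cmod (z - center n))}"

section \<open>Local finiteness of the gaps and of their endpoints\<close>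

lemma finite_near: "finite {n\<in>I. \<bar>n\<bar> < N}"
  by (rule finite_subset[of _ "{-N..N}"]) auto

text \<open>Centers at distance at least \<open>2 * R\<close> fall into different cells of a grid of
  mesh \<open>2 * R\<close>. The origin \<open>x\<close> of the grid stays free so that sums over
  the gaps can be bounded uniformly in it.\<close>

lemma inj_on_floor: "inj_on (\<lambda>n. \<lfloor>(center n - x) / (2 * R)\<rfloor>) {n\<in>I. N \<le> \<bar>n\<bar>}"
proof (rule inj_onI, rule ccontr)
  fix m n assume mn: "m \<in> {n\<in>I. N \<le> \<bar>n\<bar>}" "n \<in> {n\<in>I. N \<le> \<bar>n\<bar>}" "m \<noteq> n"
    and "\<lfloor>(center m - x) / (2 * R)\<rfloor> = \<lfloor>(center n - x) / (2 * R)\<rfloor>"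
  then have "\<bar>(center m - x) / (2 * R) - (center n - x) / (2 * R)\<bar> < 1" by linarith
  then have "\<bar>(center m - center n) / (2 * R)\<bar> < 1" by (simp add: diff_divide_distrib)
  then have "\<bar>center m - center n\<bar> < 2 * R" using R_pos by (simp add: abs_divide)
  then show False using separated[of m n] mn by (auto simp: center_def)
qed

lemma finite_centers: "finite {n\<in>I. \<bar>center n\<bar> \<le> T}"
proof -
  let ?f = "\<lambda>n. \<lfloor>(center n - 0) / (2 * R)\<rfloor>"
  have "?f ` {n\<in>I. N \<le> \<bar>n\<bar> \<and> \<bar>center n\<bar> \<le> T} \<subseteq> {\<lfloor>(-T) / (2 * R)\<rfloor>..\<lfloor>T / (2 * R)\<rfloor>}"
  proof (clarsimp, intro conjI)
    fix n assume "\<bar>center n\<bar> \<le> T"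
    then have "(- T) / (2 * R) \<le> center n / (2 * R)" "center n / (2 * R) \<le> T / (2 * R)"
      using R_pos by (auto simp: field_simps)
    then show "\<lfloor>- (T / (2 * R))\<rfloor> \<le> \<lfloor>center n / (2 * R)\<rfloor>" "\<lfloor>center n / (2 * R)\<rfloor> \<le> \<lfloor>T / (2 * R)\<rfloor>"
      by (auto intro!: floor_mono)
  qed
  then have "finite (?f ` {n\<in>I. N \<le> \<bar>n\<bar> \<and> \<bar>center n\<bar> \<le> T})"
    by (rule finite_subset) simp
  then have "finite {n\<in>I. N \<le> \<bar>n\<bar> \<and> \<bar>center n\<bar> \<le> T}"
    by (rule finite_imageD) (rule inj_on_subset[OF inj_on_floor], auto)
  then have "finite ({n\<in>I. N \<le> \<bar>n\<bar> \<and> \<bar>center n\<bar> \<le> T} \<union> {n\<in>I. \<bar>n\<bar> < N})"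
    using finite_near by simp
  then show ?thesis by (rule rev_finite_subset) auto
qed

lemma finite_endpoints: "finite {s\<in>endpoints. \<bar>s\<bar> \<le> T}"
proof -
  have "{s\<in>endpoints. \<bar>s\<bar> \<le> T} \<subseteq> \<alpha> ` {n\<in>I. \<bar>center n\<bar> \<le> T + R} \<union> \<beta> ` {n\<in>I. \<bar>center n\<bar> \<le> T + R}"
  proof
    fix s assume "s \<in> {s\<in>endpoints. \<bar>s\<bar> \<le> T}"
    then obtain n where n: "n \<in> I" "s = \<alpha> n \<or> s = \<beta> n" "\<bar>s\<bar> \<le> T" by (auto simp: endpoints_def)
    have "\<bar>center n\<bar> \<le> T + R"
      using n gap_length[OF n(1)] gap_nonempty[OF n(1)] R_pos by (auto simp: center_def)
    then show "s \<in> \<alpha> ` {n\<in>I. \<bar>center n\<bar> \<le> T + R} \<union> \<beta> ` {n\<in>I. \<bar>center n\<bar> \<le> T + R}" using n by auto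
  qed
  then show ?thesis using finite_centers by (meson finite_UnI finite_imageI finite_subset)
qed

lemma endpoints_discrete: "\<exists>d>0. \<forall>e\<in>endpoints. e \<noteq> s \<longrightarrow> d \<le> \<bar>s - e\<bar>"
proof -
  obtain d where d: "d > 0" "\<forall>e\<in>{e\<in>endpoints. \<bar>e\<bar> \<le> \<bar>s\<bar> + 1}. e \<noteq> s \<longrightarrow> d \<le> dist s e"
    using finite_set_avoid[OF finite_endpoints] by blast
  have "min d 1 \<le> \<bar>s - e\<bar>" if "e \<in> endpoints" "e \<noteq> s" for e
    using d(2)[rule_format, of e] that by (cases "\<bar>e\<bar> \<le> \<bar>s\<bar> + 1") (auto simp: dist_real_def)
  then show ?thesis using d(1) by (intro exI[of _ "min d 1"]) auto
qed

lemma band_nbhd: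
  assumes "s \<notin> endpoints" "s \<notin> gap_union"
  shows "\<exists>d>0. \<forall>u\<in>gap_union. d \<le> \<bar>s - u\<bar>"
proof -
  obtain d where d: "d > 0" "\<forall>e\<in>endpoints. e \<noteq> s \<longrightarrow> d \<le> \<bar>s - e\<bar>"
    using endpoints_discrete by blast
  have "d \<le> \<bar>s - u\<bar>" if u: "u \<in> gap_union" for u
  proof -
    obtain n where n: "n \<in> I" "\<alpha> n < u" "u < \<beta> n" using u by (auto simp: gap_union_def)
    have "\<alpha> n \<in> endpoints" "\<beta> n \<in> endpoints" using n(1) by (auto simp: endpoints_def)
    moreover have "s \<le> \<alpha> n \<or> \<beta> n \<le> s" using assms(2) n(1) by (auto simp: gap_union_def not_less)
    ultimately show ?thesis using d(2) assms(1) n by force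
  qed
  then show ?thesis using d(1) by blast
qed

lemma open_gap_union: "open gap_union"
  by (auto simp: gap_union_def)

lemma endpoints_disjoint: "e \<in> endpoints \<Longrightarrow> e \<notin> gap_union"
proof
  assume e: "e \<in> endpoints" "e \<in> gap_union"
  obtain m where m: "m \<in> I" "e = \<alpha> m \<or> e = \<beta> m" using e(1) by (auto simp: endpoints_def)
  obtain n where n: "n \<in> I" "\<alpha> n < e" "e < \<beta> n" using e(2) by (auto simp: gap_union_def)
  show False
    using gap_order[OF m(1) n(1)] gap_order[OF n(1) m(1)] gap_nonempty[OF m(1)] m(2) n(2,3)
    by (cases "m = n"; cases "m < n") auto
qed

text \<open>The index set may be unbounded on either side, so the gap next to \<open>s\<close> has
  to be found through the finiteness of the centers in a bounded interval. The bands of the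
  Riemann-Hilbert problem are numbered by their neighbouring gaps, which is what these cases
  supply.\<close>

lemma band_cases:
  assumes s: "s \<notin> endpoints" "s \<notin> gap_union" and "I \<noteq> {}"
  obtains (left) m where "m \<in> I" "\<And>n. n \<in> I \<Longrightarrow> m \<le> n" "s < \<alpha> m"
  | (right) k where "k \<in> I" "\<beta> k < s" "\<And>n. n \<in> I \<Longrightarrow> k < n \<Longrightarrow> s < \<alpha> n"
proof -
  have alt: "s < \<alpha> n \<or> \<beta> n < s" if "n \<in> I" for n
    using s that by (auto simp: endpoints_def gap_union_def) (metis linorder_neqE_linordered_idom image_eqI)
  have fin: "finite {n\<in>I. \<alpha> m \<le> \<alpha> n \<and> \<beta> n \<le> T}" for m T
    by (rule finite_subset[OF _ finite_centers[of "\<bar>\<alpha> m\<bar> + \<bar>T\<bar>"]])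
       (use gap_nonempty in \<open>force simp: center_def\<close>)
  show thesis
  proof (cases "\<exists>n\<in>I. \<beta> n < s")
    case True
    then obtain n0 where n0: "n0 \<in> I" "\<beta> n0 < s" by blast
    \<comment> \<open>Infinitely many gaps may lie to the left of \<open>s\<close>; cutting off at
      \<open>n0\<close> makes the set finite without changing its maximum.\<close>
    let ?A = "{n\<in>I. \<alpha> n0 \<le> \<alpha> n \<and> \<beta> n < s}"
    have A: "finite ?A" by (rule finite_subset[OF _ fin[of n0 s]]) auto
    have n0A: "n0 \<in> ?A" using n0 by simp
    define k where "k = Max ?A"
    have kA: "k \<in> ?A" unfolding k_def using A n0A by (intro Max_in) auto
    show thesis
    proof (rule right)
      show "k \<in> I" "\<beta> k < s" using kA by auto
      fix n assume n: "n \<in> I" "k < n"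
      then have "n \<notin> ?A" using Max_ge[OF A, of n] by (auto simp: k_def)
      moreover have "\<alpha> n0 \<le> \<alpha> n"
        using gap_order[of k n] gap_nonempty[of k] kA n by force
      ultimately show "s < \<alpha> n" using alt n by auto
    qed
  next
    case False
    then have all: "s < \<alpha> n" if "n \<in> I" for n using alt that by blast
    obtain n0 where n0: "n0 \<in> I" using assms(3) by blast
    \<comment> \<open>All these gaps lie between \<open>s\<close> and \<open>\<beta> n0\<close>, so
      there are finitely many of them and a least index exists.\<close>
    let ?A = "{n\<in>I. n \<le> n0}"
    have "?A \<subseteq> {n\<in>I. \<bar>center n\<bar> \<le> \<bar>s\<bar> + \<bar>\<beta> n0\<bar>}"
    proof
      fix n assume n: "n \<in> ?A"
      have "\<beta> n \<le> \<beta> n0" using gap_order[of n n0] gap_nonempty[of n0] n n0 by (cases "n = n0") force+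
      then show "n \<in> {n\<in>I. \<bar>center n\<bar> \<le> \<bar>s\<bar> + \<bar>\<beta> n0\<bar>}"
        using n all[of n] gap_nonempty[of n] by (auto simp: center_def)
    qed
    then have A: "finite ?A" using finite_centers finite_subset by blast
    have n0A: "n0 \<in> ?A" using n0 by simp
    define m where "m = Min ?A"
    have mA: "m \<in> ?A" unfolding m_def using A n0A by (intro Min_in) auto
    show thesis
    proof (rule left)
      show "m \<in> I" "s < \<alpha> m" using mA all by auto
      fix n assume "n \<in> I"
      then show "m \<le> n" using A mA by (cases "n \<le> n0") (auto simp: m_def)
    qed
  qed
qed

text \<open>The cells of the grid with origin \<open>x\<close> turn the far part into a sum of
  \<open>1 / (1 + j^2)\<close> over distinct integers \<open>j\<close>, whatever \<open>x\<close>
  is; each near gap contributes at most \<open>1 / R^2\<close>.\<close>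

lemma sum_centers_bound:
  "\<exists>K. \<forall>F x. finite F \<longrightarrow> F \<subseteq> I \<longrightarrow> (\<Sum>n\<in>F. 1 / (R\<^sup>2 + (center n - x)\<^sup>2)) \<le> K"
proof -
  obtain K0 where K0: "\<And>J::int set. finite J \<Longrightarrow> (\<Sum>j\<in>J. 1 / (1 + (real_of_int j)\<^sup>2)) \<le> K0"
    using sum_inverse_squares_int by blast
  let ?A = "{n\<in>I. \<bar>n\<bar> < N}"
  have "(\<Sum>n\<in>F. 1 / (R\<^sup>2 + (center n - x)\<^sup>2)) \<le> card ?A * (1 / R\<^sup>2) + 3 / R\<^sup>2 * K0"
    if F: "finite F" "F \<subseteq> I" for F x
  proof -
    define j where "j = (\<lambda>n. \<lfloor>(center n - x) / (2 * R)\<rfloor>)"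
    let ?F1 = "{n\<in>F. \<bar>n\<bar> < N}" and ?F2 = "{n\<in>F. N \<le> \<bar>n\<bar>}"
    have "(\<Sum>n\<in>F. 1 / (R\<^sup>2 + (center n - x)\<^sup>2)) =
        (\<Sum>n\<in>?F1. 1 / (R\<^sup>2 + (center n - x)\<^sup>2)) + (\<Sum>n\<in>?F2. 1 / (R\<^sup>2 + (center n - x)\<^sup>2))"
      using F by (subst sum.union_disjoint[symmetric]) (auto intro!: sum.cong)
    also have "(\<Sum>n\<in>?F1. 1 / (R\<^sup>2 + (center n - x)\<^sup>2)) \<le> (\<Sum>n\<in>?F1. 1 / R\<^sup>2)"
      using R_pos by (intro sum_mono divide_left_mono) (auto simp: add_pos_nonneg)
    also have "\<dots> \<le> card ?A * (1 / R\<^sup>2)"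
    proof -
      have "card ?F1 \<le> card ?A" using F by (intro card_mono finite_near) auto
      then show ?thesis by (simp add: divide_right_mono)
    qed
    also have "(\<Sum>n\<in>?F2. 1 / (R\<^sup>2 + (center n - x)\<^sup>2)) \<le> (\<Sum>n\<in>?F2. 3 / R\<^sup>2 * (1 / (1 + (real_of_int (j n))\<^sup>2)))"
    proof (rule sum_mono)
      fix n
      define y where "y = (center n - x) / (2 * R)"
      have jy: "real_of_int (j n) \<le> y" "y < real_of_int (j n) + 1" by (auto simp: j_def y_def)
      have "\<bar>real_of_int (j n)\<bar> \<le> \<bar>y\<bar> + 1" using jy by linarith
      then have "(real_of_int (j n))\<^sup>2 \<le> (\<bar>y\<bar> + 1)\<^sup>2" using abs_le_square_iff by fastforce
      also have "\<dots> \<le> 2 * y\<^sup>2 + 2" using sum_squares_bound[of "\<bar>y\<bar>" 1] by (simp add: power2_sum)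
      \<comment> \<open>\<open>\<bar>j\<bar> \<le> \<bar>y\<bar> + 1\<close> gives
        \<open>1 + j^2 \<le> 3 + 2 * y^2\<close>, which the factor three absorbs.\<close>
      finally have le: "1 + (real_of_int (j n))\<^sup>2 \<le> 3 * (1 + 4 * y\<^sup>2)"
        by (smt (verit) zero_le_power2)
      have "center n - x = 2 * R * y" using R_pos by (simp add: y_def)
      then have eq: "R\<^sup>2 + (center n - x)\<^sup>2 = R\<^sup>2 * (1 + 4 * y\<^sup>2)"
        by (simp add: power_mult_distrib algebra_simps)
      have "1 / (1 + 4 * y\<^sup>2) \<le> 3 / (1 + (real_of_int (j n))\<^sup>2)"
        using le by (simp add: divide_simps add_pos_nonneg)
      then have "1 / R\<^sup>2 * (1 / (1 + 4 * y\<^sup>2)) \<le> 1 / R\<^sup>2 * (3 / (1 + (real_of_int (j n))\<^sup>2))"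
        by (intro mult_left_mono) auto
      then show "1 / (R\<^sup>2 + (center n - x)\<^sup>2) \<le> 3 / R\<^sup>2 * (1 / (1 + (real_of_int (j n))\<^sup>2))"
        unfolding eq by simp
    qed
    also have "\<dots> = 3 / R\<^sup>2 * (\<Sum>n\<in>?F2. 1 / (1 + (real_of_int (j n))\<^sup>2))"
      by (simp add: sum_distrib_left)
    also have "(\<Sum>n\<in>?F2. 1 / (1 + (real_of_int (j n))\<^sup>2)) = (\<Sum>i\<in>j ` ?F2. 1 / (1 + (real_of_int i)\<^sup>2))"
      using inj_on_floor[of x] F by (subst sum.reindex) (auto simp: j_def intro: inj_on_subset)
    also have "\<dots> \<le> K0" using K0 F by simp
    finally show ?thesis using R_pos by (simp add: divide_right_mono mult_left_mono)
  qed
  then show ?thesis by blast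
qed

text \<open>Moving \<open>p\<close> away from the real axis increases its distance to every center.\<close>
lemma outer_domain_bound_closure:
  fixes g :: "complex \<Rightarrow> complex" and p :: complex
  assumes g: "continuous_on UNIV g"
    and bound: "\<And>z. z \<in> outer_domain \<Longrightarrow> T \<le> norm z \<Longrightarrow> norm (g z) \<le> M"
    and near: "\<And>n. n \<in> I \<Longrightarrow> \<bar>n\<bar> < N \<Longrightarrow> \<bar>center n\<bar> + R < T"
    and p: "\<And>n. n \<in> I \<Longrightarrow> N \<le> \<bar>n\<bar> \<Longrightarrow> R \<le> cmod (p - center n)" "T \<le> norm p"
  shows "norm (g p) \<le> M"
proof -
  define v where "v = (\<lambda>k::nat. p + \<i> * complex_of_real ((if Im p < 0 then -1 else 1) / real (Suc k)))"
  have Im: "\<bar>Im (v k)\<bar> > \<bar>Im p\<bar>" for k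
    by (auto simp: v_def field_simps add_pos_nonneg abs_if)
  have Re: "Re (v k) = Re p" for k by (simp add: v_def)
  have far: "cmod (v k - complex_of_real c) > cmod (p - complex_of_real c)" for k c
    using power_strict_mono[OF Im[of k], of 2] by (auto simp: cmod_def Re intro!: real_sqrt_less_mono)
  have v: "v k \<in> outer_domain" "T \<le> norm (v k)" for k
  proof -
    show T: "T \<le> norm (v k)" using far[of 0 k] p(2) by simp
    have "v k \<notin> \<real>" using Im[of k] by (auto simp: complex_is_Real_iff)
    moreover have "R < cmod (v k - center n)" if n: "n \<in> I" for n
    proof (cases "N \<le> \<bar>n\<bar>")
      case True then show ?thesis using p(1)[OF n] far[of "center n" k] by simp
    next
      case False
      then show ?thesis using near[OF n] T norm_triangle_ineq2[of "v k" "complex_of_real (center n)"] by simp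
    qed
    ultimately show "v k \<in> outer_domain" by (simp add: outer_domain_def)
  qed
  have "(\<lambda>k. complex_of_real ((if Im p < 0 then -1 else 1) / real (Suc k))) \<longlonglongrightarrow> complex_of_real 0"
    by (rule tendsto_of_real[OF LIMSEQ_Suc[OF lim_const_over_n]])
  then have "v \<longlonglongrightarrow> p + \<i> * complex_of_real 0" unfolding v_def by (intro tendsto_add tendsto_mult tendsto_const)
  then have "(\<lambda>k. norm (g (v k))) \<longlonglongrightarrow> norm (g p)"
    using g by (intro tendsto_norm continuous_on_tendsto_compose[OF g]) auto
  then show ?thesis using bound v by (intro LIMSEQ_le_const2) blast+
qed

text \<open>Liouville's theorem needs a bound inside the discs too. The circle around a far disc
  meets no other far disc, so the bound holds on it and the maximum principle moves it inward. The
  near discs, which may overlap, lie in a compact set.\<close>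

lemma bounded_on_outer_domain_imp_constant:
  fixes g :: "complex \<Rightarrow> complex"
  assumes g: "g holomorphic_on UNIV"
    and bound: "\<And>z. z \<in> outer_domain \<Longrightarrow> T0 \<le> norm z \<Longrightarrow> norm (g z) \<le> M"
  shows "\<exists>c. \<forall>z. g z = c"
proof -
  have cont: "continuous_on A g" for A
    using g holomorphic_on_imp_continuous_on continuous_on_subset by blast
  obtain B where B: "\<And>n. n \<in> I \<Longrightarrow> \<bar>n\<bar> < N \<Longrightarrow> \<bar>center n\<bar> \<le> B"
    using finite_near[THEN finite_imageI, of "\<lambda>n. \<bar>center n\<bar>"]
    by (metis (mono_tags, lifting) bdd_above.unfold bdd_above_finite image_eqI mem_Collect_eq)
  \<comment> \<open>Beyond this radius no near disc is met.\<close>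
  define T where "T = max T0 (\<bar>B\<bar> + R + 1)"
  have near: "\<bar>center n\<bar> + R < T" if "n \<in> I" "\<bar>n\<bar> < N" for n
    using B[OF that] by (auto simp: T_def)
  have bound': "norm (g p) \<le> M"
    if "\<And>n. n \<in> I \<Longrightarrow> N \<le> \<bar>n\<bar> \<Longrightarrow> R \<le> cmod (p - center n)" "T \<le> norm p" for p :: complex
    by (rule outer_domain_bound_closure[OF cont _ near that]) (auto intro: bound simp: T_def)
  \<comment> \<open>A point of a far disc and a point of its bounding circle differ by less than
    \<open>2 * R\<close>, so the circle stays outside radius \<open>T\<close>.\<close>
  have far: "norm (g z) \<le> M" if z: "norm z \<ge> T + 2 * R" for z :: complex
  proof (cases "\<forall>n\<in>I. N \<le> \<bar>n\<bar> \<longrightarrow> R \<le> cmod (z - center n)")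
    case True then show ?thesis using bound'[of z] z R_pos by auto
  next
    case False
    then obtain n where n: "n \<in> I" "N \<le> \<bar>n\<bar>" "cmod (z - center n) < R" by auto
    have sphere: "norm (g p) \<le> M" if p: "cmod (p - center n) = R" for p :: complex
    proof (rule bound')
      fix m assume m: "m \<in> I" "N \<le> \<bar>m\<bar>"
      show "R \<le> cmod (p - center m)"
      proof (cases "m = n")
        case False
        have "2 * R \<le> \<bar>center m - center n\<bar>"
          using separated[OF m(1) n(1) False m(2) n(2)] by (simp add: center_def)
        also have "\<dots> = cmod (complex_of_real (center m - center n))" by (simp only: norm_of_real)
        also have "\<dots> \<le> cmod (p - center n) + cmod (p - center m)"
          using norm_triangle_ineq4[of "p - complex_of_real (center n)" "p - complex_of_real (center m)"] by simp
        finally show ?thesis using p by simp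
      qed (use p in simp)
    next
      have "norm z \<le> norm p + cmod (z - center n) + cmod (p - center n)"
        using norm_triangle_ineq[of p "z - p"] norm_triangle_ineq4[of "z - complex_of_real (center n)" "p - complex_of_real (center n)"] by simp
      then show "T \<le> norm p" using z n(3) p by simp
    qed
    show ?thesis
    proof (rule maximum_modulus_frontier[of g "cball (complex_of_real (center n)) R" M z])
      fix w assume "w \<in> frontier (cball (complex_of_real (center n)) R)"
      then show "norm (g w) \<le> M" using sphere[of w] R_pos by (auto simp: dist_norm norm_minus_commute)
    qed (use n(3) R_pos g cont in \<open>auto simp: dist_norm norm_minus_commute intro: holomorphic_on_subset\<close>)
  qed
  obtain M' where M': "\<And>z. z \<in> cball 0 (T + 2 * R) \<Longrightarrow> norm (g z) \<le> M'"
    using compact_continuous_image[OF cont compact_cball, THEN compact_imp_bounded]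
    by (metis bounded_iff image_eqI)
  have "norm (g z) \<le> max M M'" for z
    using far[of z] M'[of z] by (cases "norm z \<ge> T + 2 * R") auto
  then have "bounded (range g)" by (auto simp: bounded_iff)
  then show ?thesis using Liouville_theorem[OF g] by (auto simp: constant_on_def)
qed

end

section \<open>The multiplier and its reflection\<close>

lemma filterlim_cnj_upper:
  "filterlim cnj (at (complex_of_real s) within lower_half) (at (complex_of_real s) within upper_half)"
proof -
  have "(cnj \<longlongrightarrow> cnj (complex_of_real s)) (at (complex_of_real s) within upper_half)"
    by (intro tendsto_intros)
  then show ?thesis
    by (auto simp: filterlim_at eventually_at_filter upper_half_def lower_half_def
        complex_eq_iff intro!: always_eventually)
qed

lemma filterlim_cnj_lower:
  "filterlim cnj (at (complex_of_real s) within upper_half) (at (complex_of_real s) within lower_half)"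
proof -
  have "(cnj \<longlongrightarrow> cnj (complex_of_real s)) (at (complex_of_real s) within lower_half)"
    by (intro tendsto_intros)
  then show ?thesis
    by (auto simp: filterlim_at eventually_at_filter upper_half_def lower_half_def
        complex_eq_iff intro!: always_eventually)
qed

text \<open>By the Cauchy-Riemann equations the derivative of \<open>Im G\<close> along the real axis is minus the
  normal derivative of \<open>Re G\<close>.\<close>
lemma imaginary_on_reals_nondecreasing:
  fixes G :: "complex \<Rightarrow> complex"
  assumes W: "open W" "complex_of_real s \<in> W" and G: "G holomorphic_on W"
    and Gs: "Re (G (complex_of_real s)) = 0"
    and up: "\<And>z. z \<in> W \<Longrightarrow> Im z > 0 \<Longrightarrow> Re (G z) \<le> 0"
  shows "\<exists>D\<ge>0. ((\<lambda>u. Im (G (complex_of_real u))) has_real_derivative D) (at s)"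
proof -
  let ?z = "complex_of_real s"
  obtain D where D: "(G has_field_derivative D) (at ?z)"
    using G W by (metis holomorphic_derivI)
  have "((\<lambda>u. Im (G (complex_of_real u))) has_real_derivative Im D) (at s)"
  proof -
    have "((\<lambda>u. G (complex_of_real u)) has_vector_derivative (1 * D)) (at s)"
      using D by (simp add: has_vector_derivative_real_field)
    then show ?thesis
      by (simp add: has_vector_derivative_complex_iff)
  qed
  moreover have "Im D \<ge> 0"
  proof -
    \<comment> \<open>The derivative is computed along the vertical direction: division by
      \<open>\<i> / (k + 1)\<close> turns \<open>Re G \<le> 0\<close> into a nonnegative imaginary
      part.\<close>
    define v where "v = (\<lambda>k::nat. ?z + \<i> * complex_of_real (1 / real (Suc k)))"
    have lim0: "(\<lambda>k. complex_of_real (1 / real (Suc k))) \<longlonglongrightarrow> complex_of_real 0"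
      by (rule tendsto_of_real[OF LIMSEQ_Suc[OF lim_const_over_n]])
    then have "v \<longlonglongrightarrow> ?z + \<i> * complex_of_real 0"
      unfolding v_def by (intro tendsto_add tendsto_mult tendsto_const)
    then have vl: "v \<longlonglongrightarrow> ?z" by simp
    have vne: "v k \<noteq> ?z" for k by (auto simp: v_def complex_eq_iff)
    have "filterlim v (at ?z) sequentially"
      using vl vne by (auto simp: filterlim_at)
    moreover have "((\<lambda>w. (G w - G ?z) / (w - ?z)) \<longlongrightarrow> D) (at ?z)"
      using D by (simp add: has_field_derivative_iff)
    ultimately have "(\<lambda>k. (G (v k) - G ?z) / (v k - ?z)) \<longlonglongrightarrow> D"
      by (rule filterlim_compose[rotated])
    then have lim: "(\<lambda>k. Im ((G (v k) - G ?z) / (v k - ?z))) \<longlonglongrightarrow> Im D"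
      by (rule tendsto_Im)
    have "eventually (\<lambda>k. v k \<in> W) sequentially"
      using vl W by (simp add: topological_tendstoD)
    then have "eventually (\<lambda>k. 0 \<le> Im ((G (v k) - G ?z) / (v k - ?z))) sequentially"
    proof eventually_elim
      case (elim k)
      have "Re (G (v k)) \<le> 0" using up[OF elim] by (simp add: v_def)
      moreover have "(G (v k) - G ?z) / (v k - ?z) = - \<i> * (real (Suc k) * (G (v k) - G ?z))"
        by (simp add: v_def field_simps del: of_nat_Suc)
      ultimately show ?case using Gs
        by (simp add: mult_nonneg_nonpos del: of_nat_Suc)
    qed
    then show ?thesis using lim tendsto_lowerbound by (metis sequentially_bot)
  qed
  ultimately show ?thesis by blast
qed

text \<open>The asymptotics carry explicit constants \<open>C\<close> and \<open>T\<close> because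
  the lengths of the far gaps are estimated quantitatively. \<open>r_asymp\<close> also covers the
  real points of the bands.\<close>

locale multiplier = gap_family +
  fixes r :: "complex \<Rightarrow> complex" and rp rm :: "real \<Rightarrow> complex" and L C T :: real
  assumes r_cont: "continuous_on (- complex_of_real ` gap_union) r"
    and r_hol: "r holomorphic_on interior (- complex_of_real ` gap_union)"
    and r_upper: "s \<in> gap_union \<Longrightarrow> (r \<longlongrightarrow> rp s) (at (complex_of_real s) within upper_half)"
    and r_lower: "s \<in> gap_union \<Longrightarrow> (r \<longlongrightarrow> rm s) (at (complex_of_real s) within lower_half)"
    and r_jump: "s \<in> gap_union \<Longrightarrow> rp s * rm s = 1"
    and L_pos: "L > 0" and C_pos: "C > 0" and T_pos: "T > 0"
    and r_asymp: "z \<notin> complex_of_real ` gap_union \<Longrightarrow> T \<le> norm z \<Longrightarrow>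
      norm (r z / exp (\<i> * z * of_real L) - 1) \<le> C / norm z"
begin

section \<open>The slit plane and the boundary behaviour of the multiplier\<close>

definition slit :: "complex set" where
  "slit = - complex_of_real ` gap_union"

lemma of_real_slit: "complex_of_real s \<in> slit \<longleftrightarrow> s \<notin> gap_union"
  by (auto simp: slit_def)

lemma nonreal_slit: "z \<notin> \<real> \<Longrightarrow> z \<in> slit"
  by (auto simp: slit_def)

lemma cnj_slit: "z \<in> slit \<Longrightarrow> cnj z \<in> slit"
  by (auto simp: slit_def) (metis complex_cnj_cnj complex_cnj_complex_of_real image_eqI)

lemma nonreal_interior: "- \<real> \<subseteq> interior slit"
  by (rule interior_maximal) (auto intro: nonreal_slit closed_complex_Reals simp: open_Compl)

lemma band_interior:
  assumes "s \<notin> endpoints" "s \<notin> gap_union"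
  shows "complex_of_real s \<in> interior slit"
proof -
  obtain d where d: "d > 0" "\<forall>u\<in>gap_union. d \<le> \<bar>s - u\<bar>" using band_nbhd[OF assms] by blast
  have "ball (complex_of_real s) d \<subseteq> slit"
  proof
    fix z assume z: "z \<in> ball (complex_of_real s) d"
    show "z \<in> slit" unfolding slit_def
    proof
      assume "z \<in> complex_of_real ` gap_union"
      then obtain u where u: "u \<in> gap_union" "z = complex_of_real u" by auto
      have "cmod (complex_of_real (s - u)) < d" using z u by (simp add: dist_norm)
      then show False using d(2) u(1) unfolding norm_of_real by force
    qed
  qed
  then show ?thesis using d(1) by (meson centre_in_ball interior_maximal open_ball subsetD)
qed

text \<open>At endpoints \<open>r\<close> is known to be continuous but not to be holomorphic, so
  they have to be singled out; all other real points outside the gaps keep a positive distance from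
  the gaps.\<close>

lemma slit_cases:
  assumes "z \<in> slit"
  obtains "z \<in> interior slit" | e where "e \<in> endpoints" "z = complex_of_real e"
proof (cases "z \<in> \<real>")
  case False then show ?thesis using nonreal_interior that(1) by blast
next
  case True
  then obtain s where s: "z = complex_of_real s" by (auto simp: Reals_def)
  then show ?thesis using assms band_interior[of s] that of_real_slit by (cases "s \<in> endpoints") auto
qed

lemma r_tendsto: "z \<in> slit \<Longrightarrow> (r \<longlongrightarrow> r z) (at z within slit)"
  using r_cont by (simp add: slit_def continuous_on_def)

text \<open>The boundary values on the gaps are limits of nearby values of \<open>r\<close>, so
  continuity of \<open>r\<close> at \<open>s\<close> controls both. This matters at endpoints, where
  the values from above and from below merge.\<close>

lemma r_boundary_near:
  assumes s: "complex_of_real s \<in> slit" and e: "\<epsilon> > 0"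
  shows "\<exists>d>0. \<forall>u\<in>gap_union. \<bar>u - s\<bar> < d \<longrightarrow>
    norm (rp u - r (complex_of_real s)) \<le> \<epsilon> \<and> norm (rm u - r (complex_of_real s)) \<le> \<epsilon>"
proof -
  let ?z = "complex_of_real s"
  obtain d where d: "d > 0" "\<And>w. w \<in> slit \<Longrightarrow> w \<noteq> ?z \<Longrightarrow> dist w ?z < d \<Longrightarrow> dist (r w) (r ?z) < \<epsilon>"
    using tendstoD[OF r_tendsto[OF s] e] unfolding eventually_at by blast
  have "norm (l - r ?z) \<le> \<epsilon>"
    if u: "\<bar>u - s\<bar> < d" and A: "A \<inter> \<real> = {}" "at (complex_of_real u) within A \<noteq> bot"
      and l: "(r \<longlongrightarrow> l) (at (complex_of_real u) within A)" for u l A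
  proof (rule Lim_norm_ubound[OF A(2), of "\<lambda>w. r w - r ?z"])
    show "((\<lambda>w. r w - r ?z) \<longlongrightarrow> l - r ?z) (at (complex_of_real u) within A)"
      using l by (intro tendsto_intros)
    have "cmod (complex_of_real (u - s)) < d" using u unfolding norm_of_real .
    then have "complex_of_real u \<in> ball ?z d" by (simp add: dist_norm norm_minus_commute)
    then have "eventually (\<lambda>w. w \<in> ball ?z d) (at (complex_of_real u) within A)"
      by (rule eventually_within_ball)
    moreover have "eventually (\<lambda>w. w \<in> A) (at (complex_of_real u) within A)"
      by (simp add: eventually_at_filter)
    ultimately show "eventually (\<lambda>w. norm (r w - r ?z) \<le> \<epsilon>) (at (complex_of_real u) within A)"
    proof eventually_elim
      case (elim w)
      then have "w \<notin> \<real>" using A(1) by auto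
      then have "w \<in> slit" "w \<noteq> ?z" using nonreal_slit by auto
      then show ?case using d(2)[of w] elim by (auto simp: dist_norm norm_minus_commute)
    qed
  qed
  moreover have "upper_half \<inter> \<real> = {}" "lower_half \<inter> \<real> = {}"
    by (auto simp: upper_half_def lower_half_def complex_is_Real_iff)
  ultimately show ?thesis
    using r_upper r_lower upper_half_islimpt lower_half_islimpt d(1) by (intro exI[of _ d]) simp
qed

lemma r_boundary_tendsto:
  assumes s: "complex_of_real s \<in> slit"
  shows "(rp \<longlongrightarrow> r (complex_of_real s)) (at s within gap_union)"
    "(rm \<longlongrightarrow> r (complex_of_real s)) (at s within gap_union)"
proof -
  have *: "eventually (\<lambda>u. norm (rp u - r (complex_of_real s)) < e \<and> norm (rm u - r (complex_of_real s)) < e)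
      (at s within gap_union)" if e: "e > 0" for e
  proof -
    obtain d where d: "d > 0" "\<And>u. u \<in> gap_union \<Longrightarrow> \<bar>u - s\<bar> < d \<Longrightarrow>
        norm (rp u - r (complex_of_real s)) \<le> e/2 \<and> norm (rm u - r (complex_of_real s)) \<le> e/2"
      using r_boundary_near[OF s, of "e/2"] e by auto
    show ?thesis unfolding eventually_at
    proof (intro exI[of _ d] conjI ballI impI d(1))
      fix u assume "u \<in> gap_union" "u \<noteq> s \<and> dist u s < d"
      then show "norm (rp u - r (complex_of_real s)) < e" "norm (rm u - r (complex_of_real s)) < e"
        using d(2)[of u] e by (auto simp: dist_real_def)
    qed
  qed
  show "(rp \<longlongrightarrow> r (complex_of_real s)) (at s within gap_union)"
    by (rule tendstoI, drule *) (auto elim: eventually_mono simp: dist_norm)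
  show "(rm \<longlongrightarrow> r (complex_of_real s)) (at s within gap_union)"
    by (rule tendstoI, drule *) (auto elim: eventually_mono simp: dist_norm)
qed

lemma endpoint_islimpt:
  assumes "e \<in> endpoints" shows "at e within gap_union \<noteq> bot"
proof -
  obtain n where n: "n \<in> I" "e = \<alpha> n \<or> e = \<beta> n" using assms by (auto simp: endpoints_def)
  have "e \<in> closure {\<alpha> n<..<\<beta> n}" using n gap_nonempty[OF n(1)] by (auto simp: closure_greaterThanLessThan)
  moreover have "e \<notin> {\<alpha> n<..<\<beta> n}" using n by auto
  ultimately have "e islimpt {\<alpha> n<..<\<beta> n}" by (auto simp: closure_def)
  then have "e islimpt gap_union"
    by (rule islimpt_subset) (use n in \<open>auto simp: gap_union_def\<close>)
  then show ?thesis by (simp add: trivial_limit_within)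
qed

lemma endpoint_slit: "e \<in> endpoints \<Longrightarrow> complex_of_real e \<in> slit"
  using endpoints_disjoint by (auto simp: of_real_slit)

text \<open>Both boundary values tend to \<open>r e\<close>, so the relation
  \<open>rp * rm = 1\<close> becomes a square in the limit.\<close>

lemma r_endpoint:
  assumes e: "e \<in> endpoints" shows "(r (complex_of_real e))\<^sup>2 = 1"
proof -
  note lims = r_boundary_tendsto[OF endpoint_slit[OF e]]
  have "((\<lambda>u. rp u * rm u) \<longlongrightarrow> r (complex_of_real e) * r (complex_of_real e)) (at e within gap_union)"
    by (intro tendsto_mult lims)
  moreover have "((\<lambda>u. rp u * rm u) \<longlongrightarrow> 1) (at e within gap_union)"
    by (rule tendsto_eventually) (auto simp: eventually_at_filter r_jump)
  ultimately show ?thesis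
    using tendsto_unique[OF endpoint_islimpt[OF e]] by (auto simp: power2_eq_square)
qed

lemma r_endpoint_norm: "e \<in> endpoints \<Longrightarrow> norm (r (complex_of_real e)) = 1"
  using r_endpoint[of e] by (metis norm_one norm_power power2_eq_1_iff norm_minus_cancel)

text \<open>The function \<open>k\<close> of the overview, the product of \<open>r\<close> with its
  Schwarz reflection.\<close>

definition rr :: "complex \<Rightarrow> complex" where
  "rr z = r z * cnj (r (cnj z))"

lemma rr_cnj: "rr (cnj z) = cnj (rr z)"
  by (simp add: rr_def)

lemma rr_tendsto: "z \<in> slit \<Longrightarrow> (rr \<longlongrightarrow> rr z) (at z within slit)"
proof -
  assume z: "z \<in> slit"
  have "continuous_on slit (\<lambda>z. r z * cnj (r (cnj z)))"
    using r_cont cnj_slit unfolding slit_def[symmetric]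
    by (intro continuous_intros continuous_on_compose2[of slit r slit cnj]) auto
  then show ?thesis using z by (simp add: continuous_on_def rr_def[abs_def])
qed

lemma rr_hol: "rr holomorphic_on interior slit"
proof -
  have "cnj ` interior slit \<subseteq> slit"
    using cnj_slit interior_subset by blast
  moreover have "open (cnj ` interior slit)"
    unfolding image_cnj_conv_vimage_cnj by (intro open_vimage) auto
  ultimately have "cnj ` interior slit \<subseteq> interior slit" by (rule interior_maximal)
  then have "(cnj \<circ> r \<circ> cnj) holomorphic_on interior slit"
    using r_hol unfolding slit_def[symmetric]
    by (intro holomorphic_on_compose_cnj_cnj) (auto intro: holomorphic_on_subset)
  then show ?thesis
    using holomorphic_on_mult[OF r_hol[folded slit_def]] by (simp add: rr_def[abs_def] o_def)
qed

text \<open>Conjugation exchanges the half planes, so in an approach from above the reflected factor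
  sees the lower boundary value.\<close>

lemma rr_upper: "s \<in> gap_union \<Longrightarrow> (rr \<longlongrightarrow> rp s * cnj (rm s)) (at (complex_of_real s) within upper_half)"
  unfolding rr_def[abs_def]
  by (intro tendsto_mult tendsto_cnj r_upper filterlim_compose[OF r_lower] filterlim_cnj_upper)

lemma rr_lower: "s \<in> gap_union \<Longrightarrow> (rr \<longlongrightarrow> rm s * cnj (rp s)) (at (complex_of_real s) within lower_half)"
  unfolding rr_def[abs_def]
  by (intro tendsto_mult tendsto_cnj r_lower filterlim_compose[OF r_upper] filterlim_cnj_lower)

lemma rr_gap_norm: "s \<in> gap_union \<Longrightarrow> norm (rp s * cnj (rm s)) = 1"
  using r_jump[of s] by (metis complex_mod_cnj norm_mult norm_one)

text \<open>The exponential factors at \<open>z\<close> and at \<open>cnj z\<close> cancel in \<open>rr\<close>.\<close>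
lemma rr_asymp:
  assumes z: "z \<in> slit" "T \<le> norm z"
  shows "norm (rr z - 1) \<le> 2 * (C / norm z) + (C / norm z)\<^sup>2"
proof -
  define a where "a = r z / exp (\<i> * z * of_real L) - 1"
  define b where "b = r (cnj z) / exp (\<i> * cnj z * of_real L) - 1"
  have a: "norm a \<le> C / norm z" using r_asymp[of z] z by (simp add: slit_def a_def)
  have b: "norm b \<le> C / norm z"
    using r_asymp[of "cnj z"] cnj_slit[OF z(1)] z(2) by (simp add: slit_def b_def)
  have "exp (\<i> * z * of_real L) * cnj (exp (\<i> * cnj z * of_real L)) = 1"
    by (simp add: exp_cnj mult_exp_exp)
  moreover have "r z = exp (\<i> * z * of_real L) * (1 + a)" by (simp add: a_def)
  moreover have "r (cnj z) = exp (\<i> * cnj z * of_real L) * (1 + b)" by (simp add: b_def)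
  ultimately have "rr z = (1 + a) * (1 + cnj b)" by (simp add: rr_def)
  then have "rr z - 1 = a + cnj b + a * cnj b" by (simp add: algebra_simps)
  also have "norm \<dots> \<le> norm a + norm b + norm a * norm b"
    by (metis (no_types, opaque_lifting) complex_mod_cnj norm_mult norm_triangle_le norm_triangle_ineq add_right_mono)
  also have "\<dots> \<le> C / norm z + C / norm z + C / norm z * (C / norm z)"
    using a b C_pos by (intro add_mono mult_mono) auto
  finally show ?thesis by (simp add: power2_eq_square)
qed

lemma rr_asymp_eps:
  assumes e: "\<epsilon> > 0"
  shows "\<exists>T'>0. \<forall>z\<in>slit. T' \<le> norm z \<longrightarrow> norm (rr z - 1) < \<epsilon>"
proof -
  \<comment> \<open>\<open>C\<close> makes \<open>C / norm z\<close> at most one, so that its square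
    is no larger than itself; \<open>4 * C / \<epsilon>\<close> then bounds the three terms by
    \<open>3 * \<epsilon> / 4\<close>.\<close>
  define T' where "T' = Max {T, C, 4 * C / \<epsilon>}"
  have T': "T \<le> T'" "C \<le> T'" "4 * C / \<epsilon> \<le> T'" by (auto simp: T'_def)
  have "norm (rr z - 1) < \<epsilon>" if z: "z \<in> slit" "T' \<le> norm z" for z
  proof -
    have nz: "norm z > 0" using T' T_pos z by linarith
    have le1: "C / norm z \<le> 1" using T' z nz by (simp add: divide_le_eq)
    have "4 * C / \<epsilon> \<le> norm z" using T' z by simp
    then have le2: "C / norm z \<le> \<epsilon> / 4" using e nz by (simp add: field_simps)
    have "(C / norm z)\<^sup>2 \<le> C / norm z"
      unfolding power2_eq_square using le1 C_pos nz by (intro mult_left_le) auto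
    then show ?thesis using rr_asymp[of z] z T' le2 e by auto
  qed
  then show ?thesis using T' T_pos by (intro exI[of _ T']) auto
qed

text \<open>Filled in with the value one on the gaps, \<open>norm rr\<close> is continuous on the
  whole plane and tends to one at infinity. If it exceeded one, it would attain its maximum; the set
  of maximum points would be open and closed, hence the whole plane, contradicting the behaviour at
  infinity.\<close>

lemma norm_rr_le_1:
  assumes z: "z \<in> slit" shows "norm (rr z) \<le> 1"
proof (rule ccontr)
  assume gt: "\<not> norm (rr z) \<le> 1"
  define u where "u = (\<lambda>w. if w \<in> slit then norm (rr w) else 1)"
  have gap_lim: "(u \<longlongrightarrow> u w) (at w within - slit)" for w
  proof (cases "w \<in> slit")
    case False
    then show ?thesis by (intro tendsto_eventually) (auto simp: eventually_at_filter u_def)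
  next
    case True
    then show ?thesis
    proof (cases rule: slit_cases)
      case 1
      have "w \<notin> closure (- slit)" using 1 by (simp add: closure_complement)
      then have "at w within - slit = bot" by (auto simp: trivial_limit_within closure_def)
      then show ?thesis by simp
    next
      case (2 e)
      then have "u w = 1" using True by (simp add: u_def r_endpoint_norm rr_def norm_mult)
      then show ?thesis by (intro tendsto_eventually) (auto simp: eventually_at_filter u_def)
    qed
  qed
  have slit_lim: "(u \<longlongrightarrow> u w) (at w within slit)" for w
  proof (cases "w \<in> slit")
    case True
    have "((\<lambda>v. norm (rr v)) \<longlongrightarrow> norm (rr w)) (at w within slit)"
      by (intro tendsto_norm rr_tendsto True)
    moreover have "eventually (\<lambda>v. norm (rr v) = u v) (at w within slit)"
      by (auto simp: eventually_at_filter u_def)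
    ultimately show ?thesis using True tendsto_cong by (fastforce simp: u_def)
  next
    case False
    then obtain s where s: "s \<in> gap_union" "w = complex_of_real s" by (auto simp: slit_def)
    have "(u \<longlongrightarrow> 1) (at w within (- \<real>))"
      unfolding limit_nonreal_iff
    proof
      have "((\<lambda>v. norm (rr v)) \<longlongrightarrow> norm (rp s * cnj (rm s))) (at w within upper_half)"
        unfolding s(2) by (intro tendsto_norm rr_upper s)
      moreover have "eventually (\<lambda>v. norm (rr v) = u v) (at w within upper_half)"
        by (auto simp: eventually_at_filter u_def upper_half_def nonreal_slit complex_is_Real_iff)
      ultimately show "(u \<longlongrightarrow> 1) (at w within upper_half)"
        using tendsto_cong rr_gap_norm[OF s(1)] by fastforce
      have "((\<lambda>v. norm (rr v)) \<longlongrightarrow> norm (rm s * cnj (rp s))) (at w within lower_half)"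
        unfolding s(2) by (intro tendsto_norm rr_lower s)
      moreover have "eventually (\<lambda>v. norm (rr v) = u v) (at w within lower_half)"
        by (auto simp: eventually_at_filter u_def lower_half_def nonreal_slit complex_is_Real_iff)
      ultimately show "(u \<longlongrightarrow> 1) (at w within lower_half)"
        using tendsto_cong rr_gap_norm[OF s(1)] by (fastforce simp: norm_mult mult.commute)
    qed
    moreover have "eventually (\<lambda>v. v \<in> slit \<longrightarrow> v \<in> - \<real>) (nhds w)"
    proof -
      obtain d where d: "d > 0" "ball s d \<subseteq> gap_union" using open_gap_union s(1) openE by blast
      have "v \<in> - \<real>" if "dist v w < d" "v \<in> slit" for v
      proof
        assume "v \<in> \<real>"
        then obtain a where a: "v = complex_of_real a" by (auto simp: Reals_def)
        have "norm (complex_of_real (a - s)) < d" using that(1) a s(2) by (simp add: dist_norm)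
        then have "a \<in> ball s d" unfolding norm_of_real by (simp add: dist_real_def abs_minus_commute)
        then show False using d(2) that(2) a by (auto simp: of_real_slit)
      qed
      then show ?thesis unfolding eventually_nhds_metric using d(1) by blast
    qed
    ultimately have "(u \<longlongrightarrow> 1) (at w within slit)"
    proof (intro topological_tendstoI)
      fix X :: "real set" assume X: "open X" "1 \<in> X"
      assume lim: "(u \<longlongrightarrow> 1) (at w within (- \<real>))"
        and ev: "eventually (\<lambda>v. v \<in> slit \<longrightarrow> v \<in> - \<real>) (nhds w)"
      have "eventually (\<lambda>v. v \<noteq> w \<longrightarrow> v \<in> - \<real> \<longrightarrow> u v \<in> X) (nhds w)"
        using topological_tendstoD[OF lim X] by (simp add: eventually_at_filter)
      with ev show "eventually (\<lambda>v. u v \<in> X) (at w within slit)"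
        unfolding eventually_at_filter by eventually_elim auto
    qed
    then show ?thesis using False by (simp add: u_def)
  qed
  have cont: "continuous_on UNIV u"
    using Lim_Un_univ[OF slit_lim gap_lim] by (simp add: continuous_on_def)
  obtain T' where T': "T' > 0" "\<And>w. w \<in> slit \<Longrightarrow> T' \<le> norm w \<Longrightarrow> norm (rr w - 1) < norm (rr z) - 1"
    using rr_asymp_eps[of "norm (rr z) - 1"] gt by auto
  have small: "u w < norm (rr z)" if "T' \<le> norm w" for w
  proof (cases "w \<in> slit")
    case True
    have "norm (rr w) \<le> norm (rr w - 1) + 1" using norm_triangle_ineq[of "rr w - 1" 1] by simp
    then show ?thesis using T'(2)[OF True that] True by (simp add: u_def)
  next
    case False then show ?thesis using gt by (simp add: u_def)
  qed
  obtain p where p: "p \<in> cball 0 T'" "\<And>w. w \<in> cball 0 T' \<Longrightarrow> u w \<le> u p"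
    using continuous_attains_sup[of "cball 0 T'" u] T'(1) cont continuous_on_subset
    by (metis (no_types, lifting) compact_cball cball_eq_empty not_less_iff_gr_or_eq subset_UNIV)
  have uz: "u z = norm (rr z)" using z by (simp add: u_def)
  \<comment> \<open>Outside the ball all values are below the value at \<open>z\<close>, so the
    maximum over the ball is a global one.\<close>
  have zp: "norm (rr z) \<le> u p" using small[of z] p(2)[of z] uz by (cases "T' \<le> norm z") auto
  have max: "u w \<le> u p" for w using small[of w] p(2)[of w] zp by (cases "T' \<le> norm w") auto
  \<comment> \<open>\<open>A\<close> contains no gap point and no endpoint, as \<open>u\<close> is
    one there; at its remaining points \<open>rr\<close> is holomorphic and the maximum modulus
    principle gives openness.\<close>
  define A where "A = {w. u w = u p}"
  have "closed A" unfolding A_def using cont by (intro closed_Collect_eq) auto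
  moreover have "open A"
    unfolding open_dist
  proof
    fix w assume w: "w \<in> A"
    then have uw: "u w = u p" "u w > 1" using zp gt by (auto simp: A_def)
    then have ws: "w \<in> slit" by (auto simp: u_def split: if_splits)
    then have "w \<in> interior slit"
      using uw(2) by (cases rule: slit_cases) (auto simp: u_def r_endpoint_norm rr_def norm_mult split: if_splits)
    then obtain d where d: "d > 0" "ball w d \<subseteq> interior slit" using openE open_interior by blast
    then have dsl: "v \<in> slit" if "v \<in> ball w d" for v using interior_subset that by blast
    have "rr constant_on ball w d"
    proof (rule maximum_modulus_principle[of rr "ball w d" "ball w d" w])
      show "rr holomorphic_on ball w d" using rr_hol d(2) by (rule holomorphic_on_subset)
      fix v assume "v \<in> ball w d"
      then show "norm (rr v) \<le> norm (rr w)"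
        using max[of v] uw(1) dsl ws by (simp add: u_def)
    qed (use d in auto)
    then have "u v = u p" if "v \<in> ball w d" for v
      using that dsl uw(1) ws d(1) by (auto simp: constant_on_def u_def)
    then show "\<exists>e>0. \<forall>y. dist y w < e \<longrightarrow> y \<in> A"
      using d(1) by (intro exI[of _ d]) (auto simp: A_def dist_commute)
  qed
  moreover have "p \<in> A" by (simp add: A_def)
  ultimately have "A = UNIV" using clopen by blast
  then have "u (complex_of_real T') = u p" by (auto simp: A_def)
  then show False using small[of "complex_of_real T'"] T'(1) zp by auto
qed

end

section \<open>The reflected product is identically one\<close>

lemma open_upper_half: "open upper_half" and connected_upper_half: "connected upper_half"
  by (auto simp: upper_half_def open_halfspace_Im_gt convex_halfspace_Im_gt intro: convex_connected)

context multiplier begin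

lemma upper_half_slit: "upper_half \<subseteq> interior slit"
  using nonreal_interior by (auto simp: upper_half_def complex_is_Real_iff)

text \<open>Analytic continuation takes place in the upper half plane alone; the symmetry
  \<open>rr_cnj\<close> carries the identity to the lower one, and continuity to the real points
  between the gaps.\<close>

lemma rr_eq_1_if_locally:
  assumes X: "open X" "w \<in> X" "w \<in> upper_half" and eq: "\<And>z. z \<in> X \<Longrightarrow> z \<in> upper_half \<Longrightarrow> rr z = 1"
    and z: "z \<in> slit"
  shows "rr z = 1"
proof -
  have up: "rr z = 1" if "z \<in> upper_half" for z
  proof -
    have "(\<lambda>z. rr z - 1) holomorphic_on upper_half"
      using rr_hol upper_half_slit by (intro holomorphic_intros) (rule holomorphic_on_subset)
    moreover have "w islimpt (X \<inter> upper_half)"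
      using X open_upper_half by (intro open_imp_islimpt) auto
    ultimately have "rr z - 1 = 0"
      using X that eq
      by (intro analytic_continuation[of "\<lambda>z. rr z - 1" upper_half "X \<inter> upper_half" w z])
         (auto simp: open_upper_half connected_upper_half)
    then show ?thesis by simp
  qed
  have nonreal: "rr z = 1" if "z \<notin> \<real>" for z
  proof (cases "Im z > 0")
    case True then show ?thesis using up by (simp add: upper_half_def)
  next
    case False
    then have "rr (cnj z) = 1" using up[of "cnj z"] that by (auto simp: upper_half_def complex_is_Real_iff)
    then show ?thesis using rr_cnj[of z] by (metis complex_cnj_cnj complex_cnj_one)
  qed
  show ?thesis
  proof (cases "z \<in> \<real>")
    case True
    then obtain s where s: "z = complex_of_real s" by (auto simp: Reals_def)
    have "(rr \<longlongrightarrow> rr z) (at z within (- \<real>))"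
      using rr_tendsto[OF z] by (rule tendsto_within_subset) (auto intro: nonreal_slit)
    moreover have "(rr \<longlongrightarrow> 1) (at z within (- \<real>))"
      by (rule tendsto_eventually) (auto simp: eventually_at_filter nonreal)
    ultimately show ?thesis
      using tendsto_unique[OF nonreal_islimpt[of s]] s by blast
  qed (rule nonreal)
qed

text \<open>With finitely many gaps, infinity is an interior point of the slit sphere at which the
  maximum of the modulus is attained.\<close>
lemma rr_eq_1_finite:
  assumes fin: "finite I" and z: "z \<in> slit"
  shows "rr z = 1"
proof -
  obtain B where B: "\<And>n. n \<in> I \<Longrightarrow> \<bar>\<alpha> n\<bar> + \<bar>\<beta> n\<bar> \<le> B"
    using fin[THEN finite_imageI, of "\<lambda>n. \<bar>\<alpha> n\<bar> + \<bar>\<beta> n\<bar>"]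
    by (metis (mono_tags, lifting) bdd_above.unfold bdd_above_finite image_eqI)
  \<comment> \<open>All gaps lie within radius \<open>\<bar>B\<bar> + 1\<close>, so inversion maps
    the punctured disc of radius \<open>d\<close> into the slit plane.\<close>
  define d where "d = 1 / (\<bar>B\<bar> + 1)"
  have d: "d > 0" by (simp add: d_def add_nonneg_pos)
  have far: "w \<in> interior slit" if "norm w > \<bar>B\<bar> + 1" for w
  proof -
    have "{w. norm w > \<bar>B\<bar> + 1} \<subseteq> slit"
    proof (clarsimp simp: slit_def gap_union_def)
      fix n u assume u: "n \<in> I" "\<alpha> n < u" "u < \<beta> n" "\<bar>B\<bar> + 1 < \<bar>u\<bar>"
      then show False using B[of n] by linarith
    qed
    moreover have "open {w::complex. norm w > \<bar>B\<bar> + 1}" by (intro open_Collect_less continuous_intros)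
    ultimately show ?thesis using that interior_maximal by blast
  qed
  have inv: "inverse w \<in> interior slit" if w: "w \<in> ball 0 d - {0}" for w
  proof (rule far)
    have "\<bar>B\<bar> + 1 = inverse d" by (simp add: d_def)
    also have "\<dots> < inverse (norm w)" using w by (intro less_imp_inverse_less) auto
    finally show "norm (inverse w) > \<bar>B\<bar> + 1" by (simp add: norm_inverse)
  qed
  define f where "f = (\<lambda>w. rr (inverse w))"
  have f: "f holomorphic_on ball 0 d - {0}"
    unfolding f_def
  proof (rule holomorphic_on_compose_gen[OF _ rr_hol, unfolded o_def])
    show "inverse holomorphic_on ball 0 d - {0}" by (intro holomorphic_intros) auto
    show "inverse ` (ball 0 d - {0}) \<subseteq> interior slit" using inv by blast
  qed
  have "(f \<longlongrightarrow> 1) (at 0)"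
  proof (rule tendstoI)
    fix e :: real assume "e > 0"
    then obtain T' where T': "T' > 0" "\<And>w. w \<in> slit \<Longrightarrow> T' \<le> norm w \<Longrightarrow> norm (rr w - 1) < e"
      using rr_asymp_eps by blast
    have "norm (f w - 1) < e" if w: "w \<noteq> 0" "norm w < min d (1 / T')" for w
      unfolding f_def
    proof (rule T'(2))
      show "inverse w \<in> slit" using inv[of w] w interior_subset by auto
      show "T' \<le> norm (inverse w)" using w T'(1) by (simp add: norm_inverse norm_divide field_simps)
    qed
    then show "eventually (\<lambda>w. dist (f w) 1 < e) (at 0)"
      unfolding eventually_at using d T'(1) by (intro exI[of _ "min d (1/T')"]) (auto simp: dist_norm)
  qed
  from removable_singularity[OF f open_ball this]
  have g: "(\<lambda>w. if w = 0 then 1 else f w) holomorphic_on ball 0 d" (is "?g holomorphic_on _") .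
  have "?g constant_on ball 0 d"
  proof (rule maximum_modulus_principle[OF g, of "ball 0 d" 0])
    fix w :: complex assume "w \<in> ball 0 d"
    then show "norm (?g w) \<le> norm (?g 0)"
      using norm_rr_le_1[of "inverse w"] inv[of w] interior_subset by (auto simp: f_def)
  qed (use d in auto)
  then have g1: "?g w = 1" if "w \<in> ball 0 d" for w :: complex
    using that d unfolding constant_on_def by (metis centre_in_ball)
  have rr1: "rr w = 1" if "norm w > \<bar>B\<bar> + 1" for w :: complex
  proof -
    have "w \<noteq> 0" using that by auto
    have "norm (inverse w) < inverse (\<bar>B\<bar> + 1)"
      unfolding norm_inverse using that by (intro less_imp_inverse_less) auto
    then have "inverse w \<in> ball 0 d" by (simp add: d_def inverse_eq_divide)
    then show ?thesis using g1[of "inverse w"] \<open>w \<noteq> 0\<close> by (simp add: f_def)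
  qed
  show ?thesis
  proof (rule rr_eq_1_if_locally[OF _ _ _ _ z])
    show "open {w::complex. norm w > \<bar>B\<bar> + 1}" by (intro open_Collect_less continuous_intros)
    show "Complex 0 (\<bar>B\<bar> + 2) \<in> {w. norm w > \<bar>B\<bar> + 1}" by (simp add: cmod_def)
    show "Complex 0 (\<bar>B\<bar> + 2) \<in> upper_half" by (simp add: upper_half_def)
  qed (use rr1 in blast)
qed

text \<open>Across a gap far out, where \<open>rr\<close> is close to one, \<open>Ln rr\<close> in the upper half plane continues
  analytically to \<open>- Ln rr\<close> in the lower one, with imaginary values on the gap which vanish at
  both of its end points.\<close>
lemma rr_eq_1_infinite:
  assumes inf: "infinite I" and z: "z \<in> slit"
  shows "rr z = 1"
proof -
  obtain T' where T': "T' > 0" "\<And>w. w \<in> slit \<Longrightarrow> T' \<le> norm w \<Longrightarrow> norm (rr w - 1) < 1/2"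
    using rr_asymp_eps[of "1/2"] by auto
  \<comment> \<open>A margin of \<open>R\<close> around the center contains the whole gap, so all of
    it lies where \<open>rr\<close> is close to one.\<close>
  obtain n where n: "n \<in> I" "\<bar>center n\<bar> > T' + R"
    using inf finite_centers[of "T' + R"] by (metis (mono_tags, lifting) linorder_not_le mem_Collect_eq rev_finite_subset subsetI)
  define a b where "a = \<alpha> n" and "b = \<beta> n"
  have ab: "a < b" using gap_nonempty n(1) by (simp add: a_def b_def)
  have big: "T' \<le> \<bar>s\<bar>" if "a < s" "s < b" for s
    using that n gap_length[OF n(1)] ab by (auto simp: a_def b_def center_def)
  have gap: "s \<in> gap_union" if "a < s" "s < b" for s
    using that n(1) by (auto simp: gap_union_def a_def b_def)
  \<comment> \<open>The vertical strip over the gap. There \<open>\<bar>Re w\<bar>\<close> is at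
    least \<open>T'\<close>, so off the axis \<open>rr\<close> is within \<open>1/2\<close> of one,
    away from the branch cut of \<open>Ln\<close>.\<close>
  define W where "W = {z. a < Re z \<and> Re z < b}"
  have W: "open W" "connected W"
  proof -
    show "open W" unfolding W_def by (intro open_Collect_conj open_Collect_less continuous_intros)
    have "W = {z. a < Re z} \<inter> {z. Re z < b}" by (auto simp: W_def)
    then show "connected W"
      by (simp add: convex_Int convex_halfspace_Re_gt convex_halfspace_Re_lt convex_connected)
  qed
  have near: "norm (rr w - 1) < 1/2" if "w \<in> W" "w \<notin> \<real>" for w
    using that big[of "Re w"] abs_Re_le_cmod[of w] by (intro T'(2) nonreal_slit) (auto simp: W_def)
  have nonpos: "w \<notin> \<real>\<^sub>\<le>\<^sub>0" if "norm (w - 1) \<le> 1/2" for w :: complex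
  proof
    assume "w \<in> \<real>\<^sub>\<le>\<^sub>0"
    then show False using that abs_Re_le_cmod[of "w - 1"] by (auto simp: complex_nonpos_Reals_iff)
  qed
  define H where "H = (\<lambda>w. if Im w > 0 then Ln (rr w) else - Ln (rr w))"
  define k where "k = (\<lambda>s. rp s * cnj (rm s))"
  define G where "G = (\<lambda>w. if w \<in> \<real> then Ln (k (Re w)) else H w)"
  have knear: "norm (k s - 1) \<le> 1/2" if "a < s" "s < b" for s
  proof (rule Lim_norm_ubound[OF upper_half_islimpt[of s], of "\<lambda>w. rr w - 1"])
    show "((\<lambda>w. rr w - 1) \<longlongrightarrow> k s - 1) (at (complex_of_real s) within upper_half)"
      unfolding k_def by (intro tendsto_diff tendsto_const rr_upper gap that)
    have "eventually (\<lambda>w. w \<in> W) (at (complex_of_real s) within upper_half)"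
      using W(1) that unfolding eventually_at_topological by (intro exI[of _ W]) (auto simp: W_def)
    moreover have "eventually (\<lambda>w. w \<in> upper_half) (at (complex_of_real s) within upper_half)"
      by (simp add: eventually_at_filter)
    ultimately show "eventually (\<lambda>w. norm (rr w - 1) \<le> 1/2) (at (complex_of_real s) within upper_half)"
    proof eventually_elim
      case (elim w)
      then have "w \<notin> \<real>" by (auto simp: upper_half_def complex_is_Real_iff)
      then show ?case using near[of w] elim by simp
    qed
  qed
  have kLn: "Re (Ln (k s)) = 0" "- Ln (cnj (k s)) = Ln (k s)" if "a < s" "s < b" for s
  proof -
    have n1: "norm (k s) = 1" unfolding k_def by (rule rr_gap_norm[OF gap[OF that]])
    then have "k s \<noteq> 0" by auto
    then show re: "Re (Ln (k s)) = 0" using n1 by simp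
    have "Ln (cnj (k s)) = cnj (Ln (k s))" by (rule cnj_Ln[symmetric, OF nonpos[OF knear[OF that]]])
    then show "- Ln (cnj (k s)) = Ln (k s)" using re by (simp add: complex_eq_iff)
  qed
  have Ghol: "G holomorphic_on W"
    unfolding G_def
  proof (rule paste_across_reals[OF W(1)])
    have up: "H holomorphic_on W \<inter> {w. Im w > 0}"
    proof (rule holomorphic_transform)
      show "(\<lambda>w. Ln (rr w)) holomorphic_on W \<inter> {w. Im w > 0}"
      proof (intro holomorphic_intros)
        show "rr holomorphic_on W \<inter> {w. Im w > 0}"
          using rr_hol nonreal_interior by (rule_tac holomorphic_on_subset) (auto simp: complex_is_Real_iff)
        fix w assume "w \<in> W \<inter> {w. Im w > 0}"
        then show "rr w \<notin> \<real>\<^sub>\<le>\<^sub>0" using near[of w] by (intro nonpos) (auto simp: complex_is_Real_iff)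
      qed
    qed (auto simp: H_def)
    have low: "H holomorphic_on W \<inter> {w. Im w < 0}"
    proof (rule holomorphic_transform)
      show "(\<lambda>w. - Ln (rr w)) holomorphic_on W \<inter> {w. Im w < 0}"
      proof (intro holomorphic_intros)
        show "rr holomorphic_on W \<inter> {w. Im w < 0}"
          using rr_hol nonreal_interior by (rule_tac holomorphic_on_subset) (auto simp: complex_is_Real_iff)
        fix w assume "w \<in> W \<inter> {w. Im w < 0}"
        then show "rr w \<notin> \<real>\<^sub>\<le>\<^sub>0" using near[of w] by (intro nonpos) (auto simp: complex_is_Real_iff)
      qed
    qed (auto simp: H_def)
    have "open (W \<inter> {w. Im w > 0})" "open (W \<inter> {w. Im w < 0})"
      using W(1) by (auto intro!: open_Int simp: open_halfspace_Im_gt open_halfspace_Im_lt)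
    with up low have "H holomorphic_on (W \<inter> {w. Im w > 0}) \<union> (W \<inter> {w. Im w < 0})"
      by (intro holomorphic_on_Un)
    then show "H holomorphic_on W - \<real>"
      by (rule holomorphic_on_subset) (auto simp: complex_is_Real_iff)
  next
    fix s assume "complex_of_real s \<in> W"
    then have s: "a < s" "s < b" by (auto simp: W_def)
    note np = nonpos[OF knear[OF s]]
    have npc: "cnj (k s) \<notin> \<real>\<^sub>\<le>\<^sub>0" using np by (simp add: complex_nonpos_Reals_iff)
    have "((\<lambda>w. Ln (rr w)) \<longlongrightarrow> Ln (k s)) (at (complex_of_real s) within upper_half)"
      using rr_upper[OF gap[OF s]] np by (intro tendsto_Ln) (simp_all add: k_def)
    moreover have "eventually (\<lambda>w. Ln (rr w) = H w) (at (complex_of_real s) within upper_half)"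
      by (auto simp: eventually_at_filter H_def upper_half_def)
    ultimately have 1: "(H \<longlongrightarrow> Ln (k s)) (at (complex_of_real s) within upper_half)"
      using tendsto_cong by fast
    have "(rr \<longlongrightarrow> cnj (k s)) (at (complex_of_real s) within lower_half)"
      using rr_lower[OF gap[OF s]] by (simp add: k_def mult.commute)
    then have "((\<lambda>w. - Ln (rr w)) \<longlongrightarrow> - Ln (cnj (k s))) (at (complex_of_real s) within lower_half)"
      using npc by (intro tendsto_minus tendsto_Ln)
    moreover have "eventually (\<lambda>w. - Ln (rr w) = H w) (at (complex_of_real s) within lower_half)"
      by (auto simp: eventually_at_filter H_def lower_half_def)
    ultimately have 2: "(H \<longlongrightarrow> Ln (k s)) (at (complex_of_real s) within lower_half)"
      using tendsto_cong kLn(2)[OF s] by force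
    show "(H \<longlongrightarrow> Ln (k s)) (at (complex_of_real s) within (- \<real>))"
      using 1 2 by (simp add: limit_nonreal_iff)
  qed
  define \<theta> where "\<theta> = (\<lambda>s. Im (G (complex_of_real s)))"
  have Gs: "G (complex_of_real s) = Ln (k s)" for s by (simp add: G_def)
  \<comment> \<open>The sign comes from \<open>norm (rr w) \<le> 1\<close>, that is, from
    \<open>Re (Ln (rr w)) \<le> 0\<close> above the gap.\<close>
  have der: "\<exists>D\<ge>0. (\<theta> has_real_derivative D) (at s)" if "a < s" "s < b" for s
    unfolding \<theta>_def
  proof (rule imaginary_on_reals_nondecreasing[OF W(1) _ Ghol])
    show "complex_of_real s \<in> W" using that by (simp add: W_def)
    show "Re (G (complex_of_real s)) = 0" using kLn(1)[OF that] by (simp add: Gs)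
    fix w assume w: "w \<in> W" "Im w > 0"
    then have nr: "w \<notin> \<real>" by (auto simp: complex_is_Real_iff)
    then have "G w = Ln (rr w)" using w by (simp add: G_def H_def)
    moreover have "norm (rr w) \<le> 1" using norm_rr_le_1 nonreal_slit nr by blast
    moreover have "rr w \<noteq> 0" using nonpos[of "rr w"] near[OF w(1) nr] by auto
    ultimately show "Re (G w) \<le> 0" by simp
  qed
  have mono: "\<theta> s1 \<le> \<theta> s2" if "a < s1" "s1 \<le> s2" "s2 < b" for s1 s2
  proof (rule DERIV_nonneg_imp_nondecreasing[OF that(2)])
    fix x assume "s1 \<le> x" "x \<le> s2"
    then show "\<exists>y. (\<theta> has_real_derivative y) (at x) \<and> 0 \<le> y"
      using der[of x] that by auto
  qed
  have lim: "(\<theta> \<longlongrightarrow> 0) (at e within {a<..<b})" if e: "e \<in> endpoints" for e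
  proof -
    have sub: "{a<..<b} \<subseteq> gap_union" using gap by auto
    have "(k \<longlongrightarrow> r (complex_of_real e) * cnj (r (complex_of_real e))) (at e within gap_union)"
      unfolding k_def by (intro tendsto_mult tendsto_cnj r_boundary_tendsto endpoint_slit e)
    moreover have "r (complex_of_real e) * cnj (r (complex_of_real e)) = 1"
      using r_endpoint_norm[OF e] by (simp add: complex_norm_square[symmetric])
    ultimately have "(k \<longlongrightarrow> 1) (at e within {a<..<b})"
      using sub by (auto intro: tendsto_within_subset)
    then have "((\<lambda>s. Im (Ln (k s))) \<longlongrightarrow> Im (Ln 1)) (at e within {a<..<b})"
      by (intro tendsto_Im tendsto_Ln) auto
    then show ?thesis by (simp add: \<theta>_def Gs)
  qed
  have ends: "a \<in> endpoints" "b \<in> endpoints" using n(1) by (auto simp: endpoints_def a_def b_def)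
  \<comment> \<open>A nondecreasing function on an interval with limit zero at both ends is
    zero.\<close>
  have zero: "\<theta> s = 0" if s: "a < s" "s < b" for s
  proof (rule antisym)
    have lb: "at b within {a<..<b} \<noteq> bot" "at a within {a<..<b} \<noteq> bot"
      using ab islimpt_greaterThanLessThan1 islimpt_greaterThanLessThan2
      by (auto simp: trivial_limit_within)
    have "eventually (\<lambda>u. u \<in> {s<..}) (nhds b)" using s by (intro eventually_nhds_in_open) auto
    then have "eventually (\<lambda>u. \<theta> s \<le> \<theta> u) (at b within {a<..<b})"
      unfolding eventually_at_filter by eventually_elim (use s mono in auto)
    then show "\<theta> s \<le> 0" using lim[OF ends(2)] lb(1) by (intro tendsto_lowerbound)
    have "eventually (\<lambda>u. u \<in> {..<s}) (nhds a)" using s by (intro eventually_nhds_in_open) auto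
    then have "eventually (\<lambda>u. \<theta> u \<le> \<theta> s) (at a within {a<..<b})"
      unfolding eventually_at_filter by eventually_elim (use s mono in auto)
    then show "0 \<le> \<theta> s" using lim[OF ends(1)] lb(2) by (intro tendsto_upperbound)
  qed
  have G0: "G (complex_of_real s) = 0" if "a < s" "s < b" for s
    using zero[OF that] kLn(1)[OF that] by (simp add: \<theta>_def Gs complex_eq_iff)
  define m where "m = (a + b) / 2"
  have m: "a < m" "m < b" using ab by (auto simp: m_def)
  have Gz: "G w = 0" if "w \<in> W" for w
  proof (rule analytic_continuation[OF Ghol W, of "complex_of_real ` {a<..<b}" "complex_of_real m"])
    have "m islimpt {a<..<b}" using m by (intro open_imp_islimpt) auto
    then show "complex_of_real m islimpt complex_of_real ` {a<..<b}"
      unfolding islimpt_approachable by (force simp: dist_of_real)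
  qed (use that m G0 in \<open>auto simp: W_def\<close>)
  show ?thesis
  proof (rule rr_eq_1_if_locally[OF W(1), of "Complex m 1"])
    fix w assume w: "w \<in> W" "w \<in> upper_half"
    then have nr: "w \<notin> \<real>" by (auto simp: upper_half_def complex_is_Real_iff)
    have "Ln (rr w) = 0" using Gz[OF w(1)] w nr by (simp add: G_def H_def upper_half_def)
    moreover have "rr w \<noteq> 0" using nonpos[of "rr w"] near[OF w(1) nr] by auto
    ultimately show "rr w = 1" by (metis exp_Ln exp_zero)
  qed (use m z in \<open>auto simp: W_def upper_half_def\<close>)
qed

lemma r_reflection: "z \<in> slit \<Longrightarrow> r z * cnj (r (cnj z)) = 1"
  using rr_eq_1_finite rr_eq_1_infinite unfolding rr_def by blast

lemma r_boundary_asymp: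
  assumes s: "s \<in> gap_union" "T < \<bar>s\<bar>"
  shows "norm (rp s / exp (\<i> * s * of_real L) - 1) \<le> C / \<bar>s\<bar>"
    and "norm (rm s / exp (\<i> * s * of_real L) - 1) \<le> C / \<bar>s\<bar>"
proof -
  have *: "norm (l / exp (\<i> * s * of_real L) - 1) \<le> C / \<bar>s\<bar>"
    if A: "A \<inter> \<real> = {}" "at (complex_of_real s) within A \<noteq> bot"
      and l: "(r \<longlongrightarrow> l) (at (complex_of_real s) within A)" for l A
  proof (rule tendsto_le[OF A(2)])
    show "((\<lambda>z. norm (r z / exp (\<i> * z * of_real L) - 1)) \<longlongrightarrow>
        norm (l / exp (\<i> * s * of_real L) - 1)) (at (complex_of_real s) within A)"
      by (intro tendsto_intros l) auto
    show "((\<lambda>z. C / norm z) \<longlongrightarrow> C / \<bar>s\<bar>) (at (complex_of_real s) within A)"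
      using s T_pos by (auto intro!: tendsto_eq_intros)
    \<comment> \<open>The strict inequality at \<open>s\<close> is an open condition, so the
      asymptotics hold at all nearby points off the axis.\<close>
    have "eventually (\<lambda>z. z \<in> {z. T < norm z}) (nhds (complex_of_real s))"
      using s by (intro eventually_nhds_in_open open_Collect_less continuous_intros) auto
    then show "eventually (\<lambda>z. norm (r z / exp (\<i> * z * of_real L) - 1) \<le> C / norm z)
        (at (complex_of_real s) within A)"
      unfolding eventually_at_filter
    proof eventually_elim
      case (elim z)
      have "z \<notin> complex_of_real ` gap_union" if "z \<in> A" using that A(1) by auto
      then show ?case using elim r_asymp[of z] by auto
    qed
  qed
  have "upper_half \<inter> \<real> = {}" "lower_half \<inter> \<real> = {}"
    by (auto simp: upper_half_def lower_half_def complex_is_Real_iff)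
  then show "norm (rp s / exp (\<i> * s * of_real L) - 1) \<le> C / \<bar>s\<bar>"
    "norm (rm s / exp (\<i> * s * of_real L) - 1) \<le> C / \<bar>s\<bar>"
    by (auto intro!: *[OF _ upper_half_islimpt r_upper] *[OF _ lower_half_islimpt r_lower] s)
qed

end

section \<open>Lengths of the gaps and products over the gaps\<close>

text \<open>On \<open>[0, 1]\<close> the cosine is at least one half, since
  \<open>1 < pi / 3\<close>.\<close>

lemma half_le_sin:
  fixes x :: real
  assumes "0 \<le> x" "x \<le> 1" shows "x / 2 \<le> sin x"
proof -
  have "sin 0 - 0 / 2 \<le> sin x - x / 2"
  proof (rule DERIV_nonneg_imp_nondecreasing[OF assms(1)])
    fix y assume y: "0 \<le> y" "y \<le> x"
    have "cos (pi / 3) \<le> cos y"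
      using y assms pi_gt3 by (intro cos_monotone_0_pi_le) auto
    then show "\<exists>D. ((\<lambda>y. sin y - y / 2) has_real_derivative D) (at y) \<and> 0 \<le> D"
      by (intro exI[of _ "cos y - 1/2"]) (auto intro!: derivative_eq_intros simp: cos_60)
  qed
  then show ?thesis by simp
qed

text \<open>In the coordinate \<open>w\<close> centered at the gap of half length \<open>h\<close>
  the factor is \<open>X / Y\<close> with \<open>X\<close> and \<open>Y\<close> of size
  \<open>\<bar>w\<bar>^2\<close>, while the quadratic terms of \<open>X - Y\<close> cancel and leave
  at most \<open>3 * h * \<bar>w\<bar>\<close>. The constant six comes from the reciprocal, where
  only \<open>\<bar>X\<bar> \<ge> \<bar>w\<bar>^2 / 4\<close> is available.\<close>

lemma gap_factor_bound:
  fixes a b g :: real and z :: complex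
  defines "d \<equiv> cmod (z - complex_of_real ((a + b) / 2))"
  assumes g: "a \<le> g" "g \<le> b" and d: "b - a < d"
  shows "norm ((g - z)\<^sup>2 / ((b - z) * (a - z))) \<le> exp (6 * ((b - a) / d))"
    and "norm (inverse ((g - z)\<^sup>2 / ((b - z) * (a - z)))) \<le> exp (6 * ((b - a) / d))"
proof -
  define w where "w = z - complex_of_real ((a + b) / 2)"
  define h where "h = (b - a) / 2"
  define e where "e = g - (a + b) / 2"
  define X where "X = (complex_of_real e - w)\<^sup>2"
  define Y where "Y = w\<^sup>2 - (complex_of_real h)\<^sup>2"
  have dw: "d = cmod w" by (simp add: d_def w_def)
  have h: "0 \<le> h" "2 * h < cmod w" "\<bar>e\<bar> \<le> h" using g d by (auto simp: h_def e_def dw abs_le_iff field_simps)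
  have wpos: "cmod w > 0" using h by linarith
  have eq: "(g - z)\<^sup>2 / ((b - z) * (a - z)) = X / Y"
  proof -
    have "g - z = complex_of_real e - w" by (simp add: w_def e_def)
    moreover have "(b - z) * (a - z) = Y"
      unfolding Y_def w_def h_def by (simp add: power2_eq_square field_simps)
    ultimately show ?thesis by (simp add: X_def)
  qed
  have Xlow: "cmod X \<ge> (cmod w)\<^sup>2 / 4"
  proof -
    have "cmod w / 2 \<le> cmod (complex_of_real e - w)"
      using norm_triangle_ineq2[of w "complex_of_real e"] h by (simp add: norm_minus_commute)
    then have "(cmod w / 2)\<^sup>2 \<le> (cmod (complex_of_real e - w))\<^sup>2" by (intro power_mono) auto
    then show ?thesis by (simp add: X_def norm_power power_divide)
  qed
  have hw: "h\<^sup>2 \<le> h * cmod w / 2"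
    using h mult_left_mono[of "2 * h" "cmod w" h] by (simp add: power2_eq_square)
  have Ylow: "cmod Y \<ge> 3 / 4 * (cmod w)\<^sup>2"
  proof -
    have "(2 * h)\<^sup>2 \<le> (cmod w)\<^sup>2" using h by (intro power_mono) auto
    moreover have "(cmod w)\<^sup>2 - h\<^sup>2 \<le> cmod Y"
      using norm_triangle_ineq2[of "w\<^sup>2" "(complex_of_real h)\<^sup>2"] h(1) by (simp add: Y_def norm_power)
    ultimately show ?thesis by (simp add: power_mult_distrib)
  qed
  have diff: "cmod (X - Y) \<le> 3 * h * cmod w"
  proof -
    have "X - Y = complex_of_real (e\<^sup>2) + complex_of_real (h\<^sup>2) - 2 * complex_of_real e * w"
      by (simp add: X_def Y_def power2_eq_square algebra_simps)
    also have "cmod \<dots> \<le> e\<^sup>2 + h\<^sup>2 + 2 * \<bar>e\<bar> * cmod w"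
      using norm_triangle_ineq4[of "complex_of_real (e\<^sup>2) + complex_of_real (h\<^sup>2)" "2 * complex_of_real e * w"]
        norm_triangle_ineq[of "complex_of_real (e\<^sup>2)" "complex_of_real (h\<^sup>2)"]
      by (simp add: norm_mult norm_power)
    also have "e\<^sup>2 \<le> h\<^sup>2" using h by (simp add: abs_le_square_iff[symmetric])
    also have "2 * \<bar>e\<bar> * cmod w \<le> 2 * h * cmod w" using h by (intro mult_right_mono) auto
    finally show ?thesis using hw by (simp add: algebra_simps)
  qed
  have nz: "X \<noteq> 0" "Y \<noteq> 0" using Xlow Ylow wpos by auto
  have ratio: "(b - a) / d = 2 * h / cmod w"
  proof -
    have "2 * h = b - a" by (simp add: h_def)
    then show ?thesis by (simp only: dw)
  qed
  have "cmod (X / Y) = cmod (1 + (X - Y) / Y)" using nz by (simp add: field_simps)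
  also have "\<dots> \<le> 1 + cmod (X - Y) / cmod Y"
    using norm_triangle_ineq[of 1 "(X - Y) / Y"] by (simp add: norm_divide)
  also have "cmod (X - Y) / cmod Y \<le> 3 * h * cmod w / (3 / 4 * (cmod w)\<^sup>2)"
    using diff Ylow wpos h(1) by (intro frac_le) auto
  also have "\<dots> \<le> 6 * ((b - a) / d)"
    using wpos h(1) unfolding ratio by (simp add: power2_eq_square field_simps)
  finally have "cmod (X / Y) \<le> 1 + 6 * ((b - a) / d)" by simp
  also have "\<dots> \<le> exp (6 * ((b - a) / d))" by (rule exp_ge_add_one_self)
  finally show "norm ((g - z)\<^sup>2 / ((b - z) * (a - z))) \<le> exp (6 * ((b - a) / d))"
    unfolding eq .
  have "cmod (Y / X) = cmod (1 - (X - Y) / X)" using nz by (simp add: field_simps)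
  also have "\<dots> \<le> 1 + cmod (X - Y) / cmod X"
    using norm_triangle_ineq4[of 1 "(X - Y) / X"] by (simp add: norm_divide)
  also have "cmod (X - Y) / cmod X \<le> 3 * h * cmod w / ((cmod w)\<^sup>2 / 4)"
    using diff Xlow wpos h(1) by (intro frac_le) auto
  also have "\<dots> \<le> 6 * ((b - a) / d)"
    using wpos h(1) unfolding ratio by (simp add: power2_eq_square field_simps)
  finally have "cmod (Y / X) \<le> 1 + 6 * ((b - a) / d)" by simp
  also have "\<dots> \<le> exp (6 * ((b - a) / d))" by (rule exp_ge_add_one_self)
  finally show "norm (inverse ((g - z)\<^sup>2 / ((b - z) * (a - z)))) \<le> exp (6 * ((b - a) / d))"
    unfolding eq by simp
qed

context multiplier begin

text \<open>Multiplying the asymptotics from both sides eliminates \<open>r\<close>: the jump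
  relation leaves \<open>exp (- 2 * \<i> * s * L) = (1 + p) * (1 + q)\<close>, and the distance of
  the left side from one is \<open>2 * \<bar>sin (s * L)\<bar>\<close>.\<close>

lemma gap_sin_bound:
  assumes s: "s \<in> gap_union" "T < \<bar>s\<bar>" "C < \<bar>s\<bar>"
  shows "\<bar>sin (s * L)\<bar> \<le> 2 * (C / \<bar>s\<bar>)"
proof -
  define E where "E = exp (\<i> * s * of_real L)"
  define p where "p = rp s / E - 1"
  define q where "q = rm s / E - 1"
  have e: "C / \<bar>s\<bar> \<le> 1" using s C_pos by (simp add: divide_le_eq)
  have pq: "norm p \<le> C / \<bar>s\<bar>" "norm q \<le> C / \<bar>s\<bar>"
    using r_boundary_asymp[OF s(1,2)] by (auto simp: p_def q_def E_def)
  have "(1 + p) * (1 + q) = rp s * rm s / (E * E)" by (simp add: p_def q_def)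
  also have "\<dots> = inverse (E * E)" using r_jump[OF s(1)] by (simp add: inverse_eq_divide)
  also have "\<dots> = exp (\<i> * of_real (- 2 * (s * L)))"
    by (simp add: E_def exp_minus[symmetric] mult_exp_exp algebra_simps)
  finally have "exp (\<i> * of_real (- 2 * (s * L))) - 1 = p + q + p * q" by (simp add: algebra_simps)
  then have "2 * \<bar>sin (- 2 * (s * L) / 2)\<bar> = norm (p + q + p * q)"
    using dist_exp_i_1[of "- 2 * (s * L)"] by simp
  also have "\<dots> \<le> norm p + norm q + norm p * norm q"
    using norm_triangle_ineq[of "p + q" "p * q"] norm_triangle_ineq[of p q] by (simp add: norm_mult)
  also have "\<dots> \<le> C / \<bar>s\<bar> + C / \<bar>s\<bar> + 1 * (C / \<bar>s\<bar>)"
    using pq e by (intro add_mono mult_mono) auto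
  finally have "2 * \<bar>sin (s * L)\<bar> \<le> 3 * (C / \<bar>s\<bar>)" by simp
  moreover have "C / \<bar>s\<bar> \<ge> 0" using C_pos by simp
  ultimately show ?thesis by linarith
qed

text \<open>\<open>sin (s * L)\<close> is small along the whole gap. By the addition theorem so is
  \<open>sin (l * L)\<close> for the distance \<open>l\<close> of two of its points, and for
  \<open>l * L \<le> 1\<close> the sine is comparable to its argument.\<close>

lemma far_gap_length:
  assumes n: "n \<in> I" and far: "\<bar>center n\<bar> > 2 * R" "\<bar>center n\<bar> > 2 * T" "\<bar>center n\<bar> > 2 * C"
    "\<bar>center n\<bar> > 16 * C"
  shows "\<beta> n - \<alpha> n \<le> 16 * C / (L * \<bar>center n\<bar>)"
proof (rule ccontr)
  \<comment> \<open>On the gap \<open>\<bar>s\<bar> \<ge> \<bar>center n\<bar> / 2\<close>, so the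
    sine bound is at most \<open>\<eta> / 2\<close>; two such terms add up to
    \<open>\<eta>\<close>.\<close>
  define \<eta> where "\<eta> = 8 * C / \<bar>center n\<bar>"
  have c: "\<bar>center n\<bar> > 0" using far R_pos by linarith
  have eta: "0 \<le> \<eta>" "\<eta> < 1/2" using far C_pos c by (auto simp: \<eta>_def field_simps)
  have bound: "16 * C / (L * \<bar>center n\<bar>) = 2 * \<eta> / L" by (simp add: \<eta>_def)
  assume "\<not> \<beta> n - \<alpha> n \<le> 16 * C / (L * \<bar>center n\<bar>)"
  then have long: "2 * \<eta> / L < \<beta> n - \<alpha> n" by (simp add: bound)
  have sin_le: "\<bar>sin (s * L)\<bar> \<le> \<eta> / 2" if s: "\<alpha> n < s" "s < \<beta> n" for s
  proof -
    have big: "\<bar>s\<bar> \<ge> \<bar>center n\<bar> / 2"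
    proof -
      have "\<bar>s - center n\<bar> \<le> R" using s gap_length[OF n] unfolding center_def by (auto simp: abs_le_iff field_simps)
      then show ?thesis using far(1) by linarith
    qed
    have "s \<in> gap_union" using s n by (auto simp: gap_union_def)
    then have "\<bar>sin (s * L)\<bar> \<le> 2 * (C / \<bar>s\<bar>)" using far big by (intro gap_sin_bound) auto
    also have "C / \<bar>s\<bar> \<le> C / (\<bar>center n\<bar> / 2)" using big c C_pos by (intro divide_left_mono) auto
    finally show ?thesis by (simp add: \<eta>_def)
  qed
  have lt: "2 * \<eta> / L < min (\<beta> n - \<alpha> n) (1 / L)"
    using long eta L_pos by (simp add: divide_strict_right_mono)
  \<comment> \<open>The cap \<open>1 / L\<close> excludes that the phase passes through a full
    multiple of \<open>pi\<close>; it leaves room for \<open>l\<close> because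
    \<open>\<eta> < 1/2\<close>.\<close>
  then obtain l where l: "2 * \<eta> / L < l" "l < min (\<beta> n - \<alpha> n) (1 / L)" using dense by blast
  have lpos: "l > 0" using l(1) eta L_pos by (smt (verit) divide_nonneg_pos)
  define s1 where "s1 = \<alpha> n + (\<beta> n - \<alpha> n - l) / 2"
  define s2 where "s2 = s1 + l"
  have s1: "\<alpha> n < s1" "s1 < \<beta> n" using l(2) lpos gap_nonempty[OF n] by (auto simp: s1_def field_simps)
  have s2: "\<alpha> n < s2" "s2 < \<beta> n" using l(2) lpos by (auto simp: s1_def s2_def field_simps)
  have "l * L = s2 * L - s1 * L" by (simp add: s2_def algebra_simps)
  then have "sin (l * L) = sin (s2 * L) * cos (s1 * L) - cos (s2 * L) * sin (s1 * L)"
    by (simp add: sin_diff)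
  also have "\<dots> \<le> \<bar>sin (s2 * L)\<bar> * \<bar>cos (s1 * L)\<bar> + \<bar>cos (s2 * L)\<bar> * \<bar>sin (s1 * L)\<bar>"
    unfolding abs_mult[symmetric] by linarith
  also have "\<dots> \<le> \<eta> / 2 * 1 + 1 * (\<eta> / 2)"
    using sin_le[OF s1] sin_le[OF s2] eta by (intro add_mono mult_mono) auto
  finally have "sin (l * L) \<le> \<eta>" by simp
  moreover have "l * L / 2 \<le> sin (l * L)"
    using l(2) lpos L_pos by (intro half_le_sin) (auto simp: field_simps)
  moreover have "2 * \<eta> < l * L" using l(1) L_pos by (simp add: field_simps)
  ultimately show False by simp
qed

text \<open>The right side has the form summed in \<open>sum_centers_bound\<close>, so the squared
  lengths have bounded sums. \<open>K\<close> adds the contribution of the bounded range, where only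
  the length bound \<open>R\<close> is used, to that of the far gaps.\<close>

lemma gap_length_decay:
  "\<exists>K>0. \<forall>n\<in>I. (\<beta> n - \<alpha> n)\<^sup>2 \<le> K * (1 / (R\<^sup>2 + (center n)\<^sup>2))"
proof -
  define M where "M = Max {2 * R, 2 * T, 2 * C, 16 * C}"
  have M: "2 * R \<le> M" "2 * T \<le> M" "2 * C \<le> M" "16 * C \<le> M" by (auto simp: M_def)
  define K where "K = R\<^sup>2 * (R\<^sup>2 + M\<^sup>2) + 2 * (16 * C / L)\<^sup>2"
  have K: "K > 0" unfolding K_def using R_pos C_pos L_pos by (simp add: add_pos_nonneg)
  have pos: "R\<^sup>2 + (center n)\<^sup>2 > 0" for n using R_pos by (simp add: add_pos_nonneg)
  have "(\<beta> n - \<alpha> n)\<^sup>2 * (R\<^sup>2 + (center n)\<^sup>2) \<le> K" if n: "n \<in> I" for n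
  proof (cases "\<bar>center n\<bar> \<le> M")
    case True
    have "(\<beta> n - \<alpha> n)\<^sup>2 \<le> R\<^sup>2" using gap_length[OF n] gap_nonempty[OF n] by (intro power_mono) auto
    moreover have "(center n)\<^sup>2 \<le> M\<^sup>2" using True abs_le_square_iff[of "center n" M] by simp
    ultimately have "(\<beta> n - \<alpha> n)\<^sup>2 * (R\<^sup>2 + (center n)\<^sup>2) \<le> R\<^sup>2 * (R\<^sup>2 + M\<^sup>2)"
      by (intro mult_mono) auto
    then show ?thesis unfolding K_def by (simp add: add_increasing2)
  next
    case False
    have c: "\<bar>center n\<bar> > 0" using False M R_pos by linarith
    have "\<beta> n - \<alpha> n \<le> 16 * C / (L * \<bar>center n\<bar>)"
      using False M n by (intro far_gap_length) auto
    then have "(\<beta> n - \<alpha> n)\<^sup>2 \<le> (16 * C / (L * \<bar>center n\<bar>))\<^sup>2"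
      using gap_nonempty[OF n] by (intro power_mono) auto
    moreover have "R\<^sup>2 \<le> \<bar>center n\<bar>\<^sup>2" using False M R_pos by (intro power_mono) auto
    then have "R\<^sup>2 + (center n)\<^sup>2 \<le> 2 * (center n)\<^sup>2" by simp
    ultimately have "(\<beta> n - \<alpha> n)\<^sup>2 * (R\<^sup>2 + (center n)\<^sup>2) \<le>
        (16 * C / (L * \<bar>center n\<bar>))\<^sup>2 * (2 * (center n)\<^sup>2)"
      by (intro mult_mono) auto
    also have "\<dots> = 2 * (16 * C / L)\<^sup>2" using c by (simp add: power_divide power_mult_distrib)
    also have "\<dots> \<le> K" unfolding K_def by simp
    finally show ?thesis .
  qed
  then have "\<forall>n\<in>I. (\<beta> n - \<alpha> n)\<^sup>2 \<le> K * (1 / (R\<^sup>2 + (center n)\<^sup>2))"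
    using pos by (simp add: pos_le_divide_eq)
  then show ?thesis using K by blast
qed

text \<open>One constant serves all \<open>z\<close> and all finite index sets, so the bounds pass
  to limits of partial products.\<close>

lemma gap_products_bounded:
  fixes \<gamma> :: "int \<Rightarrow> real"
  assumes \<gamma>: "\<And>n. n \<in> I \<Longrightarrow> \<alpha> n \<le> \<gamma> n \<and> \<gamma> n \<le> \<beta> n"
  shows "\<exists>K>0. \<forall>z\<in>outer_domain. \<forall>F. finite F \<longrightarrow> F \<subseteq> I \<longrightarrow>
    norm (\<Prod>n\<in>F. (\<gamma> n - z)\<^sup>2 / ((\<beta> n - z) * (\<alpha> n - z))) \<le> K \<and>
    1 / K \<le> norm (\<Prod>n\<in>F. (\<gamma> n - z)\<^sup>2 / ((\<beta> n - z) * (\<alpha> n - z)))"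
proof -
  obtain K0 where K0: "\<And>F x. finite F \<Longrightarrow> F \<subseteq> I \<Longrightarrow> (\<Sum>n\<in>F. 1 / (R\<^sup>2 + (center n - x)\<^sup>2)) \<le> K0"
    using sum_centers_bound by blast
  obtain K1 where K1: "K1 > 0" "\<And>n. n \<in> I \<Longrightarrow> (\<beta> n - \<alpha> n)\<^sup>2 \<le> K1 * (1 / (R\<^sup>2 + (center n)\<^sup>2))"
    using gap_length_decay by blast
  define K where "K = exp (3 * (K1 * K0 + 2 * K0))"
  have "norm (\<Prod>n\<in>F. (\<gamma> n - z)\<^sup>2 / ((\<beta> n - z) * (\<alpha> n - z))) \<le> K"
    "norm (inverse (\<Prod>n\<in>F. (\<gamma> n - z)\<^sup>2 / ((\<beta> n - z) * (\<alpha> n - z)))) \<le> K"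
    if z: "z \<in> outer_domain" and F: "finite F" "F \<subseteq> I" for z :: complex and F
  proof -
    define d where "d = (\<lambda>n. cmod (z - complex_of_real ((\<alpha> n + \<beta> n) / 2)))"
    have d: "R < d n" if "n \<in> F" for n
      using z F(2) that by (auto simp: outer_domain_def d_def center_def)
    have small: "\<beta> n - \<alpha> n < d n" if "n \<in> F" for n
      using d[OF that] gap_length[of n] F(2) that by auto
    \<comment> \<open>The arithmetic-geometric mean inequality separates the lengths, whose squares
      are summable, from the distances, whose inverse squares are summable uniformly in
      \<open>z\<close>.\<close>
    have ratio: "6 * ((\<beta> n - \<alpha> n) / d n) \<le> 3 * ((\<beta> n - \<alpha> n)\<^sup>2 + 1 / (d n)\<^sup>2)" for n
    proof -
      have "6 * (x / y) \<le> 3 * (x\<^sup>2 + 1 / y\<^sup>2)" for x y :: real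
        using sum_squares_bound[of x "1 / y"] by (simp add: power_divide)
      then show ?thesis .
    qed
    \<comment> \<open>\<open>d n\<close> exceeds \<open>R\<close> and is at least
      \<open>\<bar>center n - Re z\<bar>\<close>, hence \<open>(d n)^2\<close> is at least the mean
      of the two squares.\<close>
    have dsq: "1 / (d n)\<^sup>2 \<le> 2 * (1 / (R\<^sup>2 + (center n - Re z)\<^sup>2))" if "n \<in> F" for n
    proof -
      have "\<bar>center n - Re z\<bar> \<le> d n"
        using abs_Re_le_cmod[of "z - complex_of_real ((\<alpha> n + \<beta> n) / 2)"]
        by (simp add: d_def center_def abs_minus_commute)
      then have "(center n - Re z)\<^sup>2 \<le> (d n)\<^sup>2" using power_mono[of "\<bar>center n - Re z\<bar>" "d n" 2] by simp
      moreover have "R\<^sup>2 \<le> (d n)\<^sup>2" using d[OF that] R_pos by (intro power_mono) auto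
      moreover have "R\<^sup>2 > 0" using R_pos by simp
      ultimately have "1 / (d n)\<^sup>2 \<le> 1 / ((R\<^sup>2 + (center n - Re z)\<^sup>2) / 2)"
        by (intro divide_left_mono) (auto intro!: mult_pos_pos add_pos_nonneg)
      then show ?thesis by simp
    qed
    have "(\<Sum>n\<in>F. 6 * ((\<beta> n - \<alpha> n) / d n)) \<le> (\<Sum>n\<in>F. 3 * ((\<beta> n - \<alpha> n)\<^sup>2 + 1 / (d n)\<^sup>2))"
      by (intro sum_mono ratio)
    also have "\<dots> = 3 * ((\<Sum>n\<in>F. (\<beta> n - \<alpha> n)\<^sup>2) + (\<Sum>n\<in>F. 1 / (d n)\<^sup>2))"
      by (simp only: sum_distrib_left[symmetric] sum.distrib)
    also have "(\<Sum>n\<in>F. (\<beta> n - \<alpha> n)\<^sup>2) \<le> (\<Sum>n\<in>F. K1 * (1 / (R\<^sup>2 + (center n)\<^sup>2)))"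
      using K1(2) F(2) by (intro sum_mono) auto
    also have "\<dots> = K1 * (\<Sum>n\<in>F. 1 / (R\<^sup>2 + (center n - 0)\<^sup>2))" by (simp add: sum_distrib_left)
    also have "\<dots> \<le> K1 * K0" using K0[OF F, of 0] K1(1) by (intro mult_left_mono) auto
    also have "(\<Sum>n\<in>F. 1 / (d n)\<^sup>2) \<le> (\<Sum>n\<in>F. 2 * (1 / (R\<^sup>2 + (center n - Re z)\<^sup>2)))"
      by (intro sum_mono dsq)
    also have "\<dots> = 2 * (\<Sum>n\<in>F. 1 / (R\<^sup>2 + (center n - Re z)\<^sup>2))" by (simp add: sum_distrib_left)
    also have "\<dots> \<le> 2 * K0" using K0[OF F, of "Re z"] by simp
    finally have "exp (\<Sum>n\<in>F. 6 * ((\<beta> n - \<alpha> n) / d n)) \<le> K" by (simp add: K_def)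
    then have expb: "(\<Prod>n\<in>F. exp (6 * ((\<beta> n - \<alpha> n) / d n))) \<le> K" using F(1) by (simp add: exp_sum)
    have factor: "norm ((\<gamma> n - z)\<^sup>2 / ((\<beta> n - z) * (\<alpha> n - z))) \<le> exp (6 * ((\<beta> n - \<alpha> n) / d n))"
      "norm (inverse ((\<gamma> n - z)\<^sup>2 / ((\<beta> n - z) * (\<alpha> n - z)))) \<le> exp (6 * ((\<beta> n - \<alpha> n) / d n))"
      if n: "n \<in> F" for n
    proof -
      have *: "\<alpha> n \<le> \<gamma> n" "\<gamma> n \<le> \<beta> n" using \<gamma> F(2) n by auto
      note sm = small[OF n, unfolded d_def]
      show "norm ((\<gamma> n - z)\<^sup>2 / ((\<beta> n - z) * (\<alpha> n - z))) \<le> exp (6 * ((\<beta> n - \<alpha> n) / d n))"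
        unfolding d_def by (rule gap_factor_bound(1)[OF * sm])
      show "norm (inverse ((\<gamma> n - z)\<^sup>2 / ((\<beta> n - z) * (\<alpha> n - z)))) \<le> exp (6 * ((\<beta> n - \<alpha> n) / d n))"
        unfolding d_def by (rule gap_factor_bound(2)[OF * sm])
    qed
    have "norm (\<Prod>n\<in>F. (\<gamma> n - z)\<^sup>2 / ((\<beta> n - z) * (\<alpha> n - z))) \<le> (\<Prod>n\<in>F. exp (6 * ((\<beta> n - \<alpha> n) / d n)))"
      unfolding prod_norm[symmetric] by (intro prod_mono conjI norm_ge_zero factor)
    with expb show "norm (\<Prod>n\<in>F. (\<gamma> n - z)\<^sup>2 / ((\<beta> n - z) * (\<alpha> n - z))) \<le> K" by simp
    have "norm (inverse (\<Prod>n\<in>F. (\<gamma> n - z)\<^sup>2 / ((\<beta> n - z) * (\<alpha> n - z)))) \<le> (\<Prod>n\<in>F. exp (6 * ((\<beta> n - \<alpha> n) / d n)))"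
      unfolding prod_inversef[symmetric] prod_norm[symmetric] o_def by (intro prod_mono conjI norm_ge_zero factor)
    with expb show "norm (inverse (\<Prod>n\<in>F. (\<gamma> n - z)\<^sup>2 / ((\<beta> n - z) * (\<alpha> n - z)))) \<le> K" by simp
  qed
  note bounds = this
  have "1 / K \<le> norm (\<Prod>n\<in>F. (\<gamma> n - z)\<^sup>2 / ((\<beta> n - z) * (\<alpha> n - z)))"
    if z: "z \<in> outer_domain" and F: "finite F" "F \<subseteq> I" for z :: complex and F
  proof -
    define P where "P = (\<Prod>n\<in>F. (\<gamma> n - z)\<^sup>2 / ((\<beta> n - z) * (\<alpha> n - z)))"
    have nr: "complex_of_real u - z \<noteq> 0" for u using z by (auto simp: outer_domain_def)
    have "P \<noteq> 0" unfolding P_def using F(1) nr by simp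
    then show ?thesis
      using bounds(2)[OF that] unfolding P_def[symmetric] norm_inverse
      by (simp add: K_def field_simps)
  qed
  then show ?thesis using bounds(1) by (intro exI[of _ K]) (simp add: K_def)
qed

end

section \<open>Spectral data and the matrix B\<close>

text \<open>With two meanings of \<open>$\<close>, the number of parse trees is exponential in the number of matrix
  entries in a formula.\<close>
no_notation fps_nth (infixl "$" 75)

section \<open>Entrywise calculus of two by two matrices\<close>

lemma mat2_nth [simp]:
  "mat2 a b c d $ 1 $ 1 = a" "mat2 a b c d $ 1 $ 2 = b"
  "mat2 a b c d $ 2 $ 1 = c" "mat2 a b c d $ 2 $ 2 = d"
  by (simp_all add: mat2_def vector_2)

lemma smul_nth [simp]: "smul c A $ i $ j = c * A $ i $ j"
  by (simp add: smul_def)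

lemma cmat2_mult_nth:
  fixes A B :: cmat2
  shows "(A ** B) $ i $ j = A $ i $ 1 * B $ 1 $ j + A $ i $ 2 * B $ 2 $ j"
  by (simp add: matrix_matrix_mult_def sum_2)

lemma cmat2_eq_iff:
  fixes A B :: cmat2
  shows "A = B \<longleftrightarrow> A $ 1 $ 1 = B $ 1 $ 1 \<and> A $ 1 $ 2 = B $ 1 $ 2 \<and> A $ 2 $ 1 = B $ 2 $ 1 \<and> A $ 2 $ 2 = B $ 2 $ 2"
  by (auto simp: vec_eq_iff forall_2)

lemma cmat2_one_nth [simp]:
  "(mat 1 :: cmat2) $ 1 $ 1 = 1" "(mat 1 :: cmat2) $ 1 $ 2 = 0"
  "(mat 1 :: cmat2) $ 2 $ 1 = 0" "(mat 1 :: cmat2) $ 2 $ 2 = 1"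
  by (simp_all add: mat_def)

lemma cmat2_tendstoI:
  fixes F :: "'a \<Rightarrow> cmat2"
  assumes "\<And>i j. ((\<lambda>z. F z $ i $ j) \<longlongrightarrow> l $ i $ j) net"
  shows "(F \<longlongrightarrow> l) net"
  using assms by (intro vec_tendstoI)

lemma cmat2_tendsto_nth: "(F \<longlongrightarrow> (l :: cmat2)) net \<Longrightarrow> ((\<lambda>z. F z $ i $ j) \<longlongrightarrow> l $ i $ j) net"
  by (intro tendsto_vec_nth)

lemma cmat2_tendsto_mult:
  fixes F G :: "'a \<Rightarrow> cmat2"
  assumes "(F \<longlongrightarrow> A) net" "(G \<longlongrightarrow> B) net"
  shows "((\<lambda>z. F z ** G z) \<longlongrightarrow> A ** B) net"
  unfolding matrix_matrix_mult_def
  by (intro vec_tendstoI) (auto intro!: tendsto_intros tendsto_vec_nth assms)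

section \<open>Products over the integers as limits of symmetric partial products\<close>

lemma prod_sym_factor: "(\<Prod>i\<le>n. sym_factor A a i) = (\<Prod>k\<in>{k \<in> A. \<bar>k\<bar> \<le> int n}. a k)"
proof (induction n)
  case 0
  then show ?case by (simp add: sym_factor_def)
next
  case (Suc n)
  have fin: "finite {k \<in> A. \<bar>k\<bar> \<le> int m}" for m
    by (rule finite_subset[of _ "{-int m..int m}"]) auto
  have "{k \<in> A. \<bar>k\<bar> \<le> int (Suc n)} = {k \<in> A. \<bar>k\<bar> \<le> int n} \<union> {k \<in> A. \<bar>k\<bar> = int (Suc n)}" by auto
  then have "(\<Prod>k\<in>{k \<in> A. \<bar>k\<bar> \<le> int (Suc n)}. a k) =
      (\<Prod>k\<in>{k \<in> A. \<bar>k\<bar> \<le> int n}. a k) * sym_factor A a (Suc n)"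
    using fin[of n] finite_subset[OF _ fin[of "Suc n"], of "{k \<in> A. \<bar>k\<bar> = int (Suc n)}"]
    by (simp add: sym_factor_def) (subst prod.union_disjoint; auto)
  then show ?case using Suc by simp
qed

lemma int_prod_LIMSEQ:
  "int_prod_converges A a \<Longrightarrow> (\<lambda>n. \<Prod>k\<in>{k \<in> A. \<bar>k\<bar> \<le> int n}. a k) \<longlonglongrightarrow> int_prod A a"
  unfolding int_prod_converges_def int_prod_def prod_sym_factor[symmetric] by (rule convergent_prod_LIMSEQ)

lemma int_prod_nonzero:
  assumes "int_prod_converges A a" "\<And>k. k \<in> A \<Longrightarrow> a k \<noteq> 0"
  shows "int_prod A a \<noteq> 0"
proof -
  have "finite {k \<in> A. \<bar>k\<bar> = int n}" for n
    by (rule finite_subset[of _ "{-int n..int n}"]) auto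
  then have "sym_factor A a n \<noteq> 0" for n using assms(2) by (auto simp: sym_factor_def)
  then show ?thesis
    using assms(1) prodinf_nonzero[of "sym_factor A a"] by (simp add: int_prod_converges_def int_prod_def)
qed

lemma pi_seq_nonzero [simp]: "pi_seq k \<noteq> 0"
  by (simp add: pi_seq_def)

section \<open>From spectral data to families of gaps\<close>

definition gap_low :: "spectral_data \<Rightarrow> int \<Rightarrow> real" where
  "gap_low S n = edge S (2 * n - 1)"

definition gap_high :: "spectral_data \<Rightarrow> int \<Rightarrow> real" where
  "gap_high S n = edge S (2 * n)"

lemma gap_idx_nonempty: "candidate_spectral_data S \<Longrightarrow> gap_idx S \<noteq> {}"
proof -
  assume "candidate_spectral_data S"
  then have lt: "gmin S < gmax S" by (simp add: candidate_spectral_data_def)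
  show ?thesis
  proof (cases "gmin S")
    case (Fin a)
    then have "a \<in> gap_idx S" using lt by (auto simp: gap_idx_def)
    then show ?thesis by blast
  next
    case Pinf
    then show ?thesis using lt by simp
  next
    case Minf
    show ?thesis
    proof (cases "gmax S")
      case (Fin b)
      then have "b \<in> gap_idx S" using Minf by (auto simp: gap_idx_def)
      then show ?thesis by blast
    next
      case Pinf
      then have "0 \<in> gap_idx S" using Minf by (auto simp: gap_idx_def)
      then show ?thesis by blast
    qed (use lt Minf in simp)
  qed
qed

lemma finite_gap_idx:
  assumes "gmin S \<noteq> Minf" "gmax S \<noteq> Pinf" shows "finite (gap_idx S)"
proof (cases "gmin S"; cases "gmax S")
  fix a b assume "gmin S = Fin a" "gmax S = Fin b"
  then have "gap_idx S \<subseteq> {a..b}" by (auto simp: gap_idx_def)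
  then show ?thesis by (rule finite_subset) simp
qed (use assms in \<open>auto simp: gap_idx_def\<close>)

text \<open>Otherwise the midpoint of the centers would lie in both balls.\<close>

lemma separation_of_disjoint_balls:
  fixes a b R :: real
  assumes "ball (complex_of_real a) R \<inter> ball (complex_of_real b) R = {}"
  shows "2 * R \<le> \<bar>a - b\<bar>"
proof (rule ccontr)
  assume "\<not> ?thesis"
  then have lt: "\<bar>a - b\<bar> / 2 < R" by simp
  have "dist (complex_of_real x) (complex_of_real y) = \<bar>x - y\<bar>" for x y
    by (simp add: dist_of_real dist_real_def)
  then have "complex_of_real ((a + b) / 2) \<in> ball (complex_of_real a) R \<inter> ball (complex_of_real b) R"
    using lt by (simp add: abs_if field_simps del: of_real_divide of_real_add split: if_splits)
  then show False using assms by blast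
qed

lemma gap_family_of_data:
  assumes data: "candidate_spectral_data S"
  shows "\<exists>N. gap_family (gap_idx S) (gap_low S) (gap_high S) (radius S) N"
proof -
  have ord: "edge S i < edge S j" if "i \<in> edge_idx S" "j \<in> edge_idx S" "i < j" for i j
    using data that by (simp add: candidate_spectral_data_def)
  have idx: "2 * n - 1 \<in> edge_idx S" "2 * n \<in> edge_idx S" if "n \<in> gap_idx S" for n
    using that by (auto simp: edge_idx_def)
  have nonempty: "gap_low S n < gap_high S n" if "n \<in> gap_idx S" for n
    unfolding gap_low_def gap_high_def using idx[OF that] by (intro ord) auto
  have len: "gap_high S n - gap_low S n \<le> radius S" if n: "n \<in> gap_idx S" for n
  proof -
    have "\<bar>edge S (2 * n) - edge S (2 * n - 1)\<bar> \<le> radius S"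
      unfolding radius_def using data n
      by (intro cSUP_upper) (auto simp: candidate_spectral_data_def)
    then show ?thesis by (simp add: gap_low_def gap_high_def)
  qed
  obtain n0 where n0: "n0 \<in> gap_idx S" using gap_idx_nonempty[OF data] by blast
  have R: "radius S > 0" using len[OF n0] nonempty[OF n0] by linarith
  have "\<exists>N. disjoint_family_on (disc S) {n \<in> gap_idx S. N \<le> \<bar>n\<bar>}"
  proof (cases "gmin S = Minf \<or> gmax S = Pinf")
    case True
    then show ?thesis using data unfolding candidate_spectral_data_def by blast
  next
    case False
    then have "finite (gap_idx S)" using finite_gap_idx by blast
    then have "finite ((\<lambda>n. \<bar>n\<bar>) ` gap_idx S)" by simp
    then obtain B where "\<forall>n\<in>gap_idx S. \<bar>n\<bar> \<le> B"
      by (metis bdd_above.unfold bdd_above_finite image_eqI)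
    \<comment> \<open>For finitely many gaps \<open>N\<close> is taken beyond all indices, and
      separation holds vacuously.\<close>
    then have "{n \<in> gap_idx S. B + 1 \<le> \<bar>n\<bar>} = {}" by force
    then show ?thesis by (metis disjoint_family_on_def empty_iff)
  qed
  then obtain N where N: "disjoint_family_on (disc S) {n \<in> gap_idx S. N \<le> \<bar>n\<bar>}" by blast
  have "gap_family (gap_idx S) (gap_low S) (gap_high S) (radius S) N"
  proof
    fix m n assume mn: "m \<in> gap_idx S" "n \<in> gap_idx S"
    show "m < n \<Longrightarrow> gap_high S m < gap_low S n"
      unfolding gap_low_def gap_high_def using idx mn by (intro ord) auto
    assume far: "m \<noteq> n" "N \<le> \<bar>m\<bar>" "N \<le> \<bar>n\<bar>"
    then have "disc S m \<inter> disc S n = {}"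
      using N mn unfolding disjoint_family_on_def by blast
    then have "2 * radius S \<le> \<bar>(edge S (2 * m) + edge S (2 * m - 1)) / 2 - (edge S (2 * n) + edge S (2 * n - 1)) / 2\<bar>"
      unfolding disc_def by (rule separation_of_disjoint_balls)
    then show "2 * radius S \<le> \<bar>(gap_low S m + gap_high S m) / 2 - (gap_low S n + gap_high S n) / 2\<bar>"
      by (simp add: gap_low_def gap_high_def add.commute)
  qed (use nonempty len R in auto)
  then show ?thesis by blast
qed

text \<open>On the bands this keeps the quotients in \<open>V_band\<close> from degenerating to
  division by zero, so that the jump has determinant one.\<close>

lemma fpm_nonzero:
  assumes products: "products_converge S"
    and s: "\<forall>n\<in>gap_idx S. z \<noteq> complex_of_real (gam S n)" and \<nu>: "\<nu> \<in> {-1, 1}"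
  shows "fpm S \<nu> z \<noteq> 0"
  unfolding fpm_def
proof (rule int_prod_nonzero)
  show "int_prod_converges {k \<in> gap_idx S. nu S k = \<nu>} (f_factor S z)"
    using products \<nu> by (auto simp: products_converge_def)
qed (use s in \<open>auto simp: f_factor_def\<close>)

definition Bdet :: "spectral_data \<Rightarrow> (complex \<Rightarrow> complex) \<Rightarrow> complex \<Rightarrow> complex" where
  "Bdet S b z = Bmat S b z $ 1 $ 1 * Bmat S b z $ 2 $ 2"

lemma Bmat_offdiag [simp]: "Bmat S b z $ 1 $ 2 = 0" "Bmat S b z $ 2 $ 1 = 0"
  by (simp_all add: Bmat_def)

text \<open>Squaring the determinant removes the branch of \<open>b\<close> and the factor
  \<open>\<i>\<close> of the upper half plane. The numbers \<open>pi_seq k\<close> cancel between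
  \<open>b4\<close> and the squares of \<open>f_plus\<close> and \<open>f_minus\<close>, so every
  index contributes the same kind of factor, whatever its sign \<open>nu S k\<close>.\<close>

lemma Bdet_LIMSEQ:
  fixes z :: complex
  assumes data: "candidate_spectral_data S" and products: "products_converge S"
    and branch: "b_branch S b" and z: "z \<notin> \<real>"
  shows "(\<lambda>n. \<Prod>k\<in>{k \<in> gap_idx S. \<bar>k\<bar> \<le> int n}.
      (gam S k - z)\<^sup>2 / ((gap_high S k - z) * (gap_low S k - z))) \<longlonglongrightarrow> - ((Bdet S b z)\<^sup>2)"
proof -
  define I where "I = (\<lambda>n::nat. {k \<in> gap_idx S. \<bar>k\<bar> \<le> int n})"
  have fin: "finite (I n)" for n
    unfolding I_def by (rule finite_subset[of _ "{-int n..int n}"]) auto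
  have nu: "nu S k \<in> {-1, 0, 1}" if "k \<in> gap_idx S" for k
    using data that by (auto simp: candidate_spectral_data_def)
  have c0: "int_prod_converges (zero_idx S) (b4_factor0 S z)"
    and c1: "int_prod_converges (gap_idx S - zero_idx S) (b4_factor1 S z)"
    and cf: "\<And>s. s \<in> {-1, 1} \<Longrightarrow> int_prod_converges {k \<in> gap_idx S. nu S k = s} (f_factor S z)"
    using products z unfolding products_converge_def by blast+
  have sets: "{k \<in> zero_idx S. \<bar>k\<bar> \<le> int n} = {k \<in> I n. nu S k = 0}"
    "{k \<in> gap_idx S - zero_idx S. \<bar>k\<bar> \<le> int n} = {k \<in> I n. nu S k \<noteq> 0}"
    "{k \<in> {k \<in> gap_idx S. nu S k = s}. \<bar>k\<bar> \<le> int n} = {k \<in> I n. nu S k = s}" for n s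
    by (auto simp: zero_idx_def I_def)
  define p0 where "p0 = (\<lambda>n. \<Prod>k\<in>{k \<in> I n. nu S k = 0}. b4_factor0 S z k)"
  define p1 where "p1 = (\<lambda>n. \<Prod>k\<in>{k \<in> I n. nu S k \<noteq> 0}. b4_factor1 S z k)"
  define pf where "pf = (\<lambda>s n. \<Prod>k\<in>{k \<in> I n. nu S k = s}. f_factor S z k)"
  have l0: "p0 \<longlonglongrightarrow> int_prod (zero_idx S) (b4_factor0 S z)"
    using int_prod_LIMSEQ[OF c0] unfolding sets p0_def .
  have l1: "p1 \<longlonglongrightarrow> int_prod (gap_idx S - zero_idx S) (b4_factor1 S z)"
    using int_prod_LIMSEQ[OF c1] unfolding sets p1_def .
  have lf: "pf s \<longlonglongrightarrow> fpm S s z" if "s \<in> {-1, 1}" for s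
    using int_prod_LIMSEQ[OF cf[OF that]] unfolding sets by (simp add: pf_def fpm_def)
  have "(\<lambda>n. p0 n * p1 n * (pf 1 n)\<^sup>2 * (pf (-1) n)\<^sup>2) \<longlonglongrightarrow>
      int_prod (zero_idx S) (b4_factor0 S z) * int_prod (gap_idx S - zero_idx S) (b4_factor1 S z)
      * (fpm S 1 z)\<^sup>2 * (fpm S (-1) z)\<^sup>2"
    by (intro tendsto_intros l0 l1 lf) auto
  moreover have "p0 n * p1 n * (pf 1 n)\<^sup>2 * (pf (-1) n)\<^sup>2 =
      (\<Prod>k\<in>I n. (gam S k - z)\<^sup>2 / ((gap_high S k - z) * (gap_low S k - z)))" for n
  proof -
    \<comment> \<open>Products over the classes of \<open>nu\<close> become products over one common
      index set by inserting ones.\<close>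
    have "p0 n * p1 n * (pf 1 n)\<^sup>2 * (pf (-1) n)\<^sup>2 =
      (\<Prod>k\<in>I n. (if nu S k = 0 then b4_factor0 S z k else 1) * (if nu S k \<noteq> 0 then b4_factor1 S z k else 1)
        * (if nu S k = 1 then f_factor S z k else 1)\<^sup>2 * (if nu S k = -1 then f_factor S z k else 1)\<^sup>2)"
      unfolding p0_def p1_def pf_def using fin[of n]
      by (simp only: prod.inter_filter prod.distrib prod_power_distrib)
    also have "\<dots> = (\<Prod>k\<in>I n. (gam S k - z)\<^sup>2 / ((gap_high S k - z) * (gap_low S k - z)))"
    proof (rule prod.cong[OF refl])
      fix k assume "k \<in> I n"
      then have "nu S k \<in> {-1, 0, 1}" using nu by (auto simp: I_def)
      then show "(if nu S k = 0 then b4_factor0 S z k else 1) * (if nu S k \<noteq> 0 then b4_factor1 S z k else 1)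
        * (if nu S k = 1 then f_factor S z k else 1)\<^sup>2 * (if nu S k = -1 then f_factor S z k else 1)\<^sup>2
        = (gam S k - z)\<^sup>2 / ((gap_high S k - z) * (gap_low S k - z))"
        by (auto simp: b4_factor0_def b4_factor1_def f_factor_def edge_factor_def gap_high_def gap_low_def power_divide)
    qed
    finally show ?thesis .
  qed
  moreover have "int_prod (zero_idx S) (b4_factor0 S z) * int_prod (gap_idx S - zero_idx S) (b4_factor1 S z)
      * (fpm S 1 z)\<^sup>2 * (fpm S (-1) z)\<^sup>2 = - ((Bdet S b z)\<^sup>2)"
  proof -
    have b4: "b4 S z = (b z)\<^sup>2 * (b z)\<^sup>2"
      using branch z unfolding b_branch_def by (metis power_add[of "b z" 2 2] numeral_Bit0)
    have "(Bdet S b z)\<^sup>2 = b4 S z * (fpm S 1 z)\<^sup>2 * (fpm S (-1) z)\<^sup>2"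
    proof -
      have i_square: "(\<i> * u) * (\<i> * v) = - (u * v)" for u v :: complex by (simp add: complex_eq_iff)
      have "Bdet S b z = (if 0 < Im z then -1 else 1) * ((b z)\<^sup>2 * (fpm S 1 z * fpm S (-1) z))"
        using i_square[of "b z * fpm S (-1) z" "b z * fpm S 1 z"]
        by (simp add: Bdet_def Bmat_def power2_eq_square mult_ac)
      then show ?thesis by (simp add: b4 power_mult_distrib power2_eq_square mult_ac)
    qed
    then show ?thesis by (simp add: b4_def)
  qed
  ultimately show ?thesis unfolding I_def by simp
qed

text \<open>A band point is located by its neighbouring gap, while the jump conditions number bands
  by extended edges; at the outermost bands the missing edge takes an infinite value.\<close>

lemma (in gap_family) band_index:
  assumes fam: "I = gap_idx S" "\<alpha> = gap_low S" "\<beta> = gap_high S" and I: "I \<noteq> {}"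
    and s: "s \<notin> endpoints" "s \<notin> gap_union"
  shows "\<exists>n. ext_edge S (2 * n - 2) \<le> Fin s \<and> Fin s \<le> ext_edge S (2 * n - 1)"
  using s I
proof (cases rule: band_cases)
  case (left m)
  have m: "2 * m - 1 \<in> edge_idx S" using left(1) by (auto simp: edge_idx_def fam)
  have below: "2 * m - 2 < i" if "i \<in> edge_idx S" for i
    using that left(2) unfolding edge_idx_def fam by force
  then have "ext_edge S (2 * m - 2) = Minf" unfolding ext_edge_def by force
  then show ?thesis
    using m left(3) by (intro exI[of _ m]) (simp add: ext_edge_def fam gap_low_def)
next
  case (right k)
  have k: "2 * k \<in> edge_idx S" using right(1) by (auto simp: edge_idx_def fam)
  have 1: "ext_edge S (2 * (k + 1) - 2) \<le> Fin s"
    using k right(2) by (simp add: ext_edge_def fam gap_high_def)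
  have 2: "Fin s \<le> ext_edge S (2 * (k + 1) - 1)"
  proof (cases "k + 1 \<in> I")
    case True
    then have "2 * (k + 1) - 1 \<in> edge_idx S"
      unfolding edge_idx_def fam by (intro CollectI bexI[of _ "k + 1"]) auto
    then show ?thesis using right(3)[OF True] by (simp add: ext_edge_def fam gap_low_def)
  next
    case False
    have "2 * (k + 1) - 1 \<notin> edge_idx S"
    proof
      assume "2 * (k + 1) - 1 \<in> edge_idx S"
      then obtain n where n: "n \<in> I" "2 * (k + 1) - 1 = 2 * n - 1 \<or> 2 * (k + 1) - 1 = 2 * n"
        by (auto simp: edge_idx_def fam)
      then have "n = k + 1" by presburger
      then show False using n(1) False by simp
    qed
    moreover have "\<not> (\<forall>i\<in>edge_idx S. 2 * (k + 1) - 1 < i)" using k by force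
    ultimately have "ext_edge S (2 * (k + 1) - 1) = Pinf" by (auto simp: ext_edge_def)
    then show ?thesis by simp
  qed
  show ?thesis using 1 2 by blast
qed

text \<open>The bracket is the determinant formed from row \<open>i\<close> of \<open>P\<close> and
  row \<open>j\<close> of \<open>Q\<close>; a common right factor \<open>V\<close> multiplies it by
  \<open>det V\<close>. At an endpoint two quartic root singularities combine to a square root one,
  which is still removable. The case \<open>P = Q\<close> with different rows gives the determinant
  of a solution.\<close>

lemma (in gap_family) bracket_constant:
  fixes P Q :: "complex \<Rightarrow> cmat2"
  assumes hol: "\<And>i j. (\<lambda>z. P z $ i $ j) holomorphic_on - \<real>" "\<And>i j. (\<lambda>z. Q z $ i $ j) holomorphic_on - \<real>"
    and jump: "\<And>s. s \<notin> endpoints \<Longrightarrow> \<exists>V A B. V $ 1 $ 1 * V $ 2 $ 2 - V $ 1 $ 2 * V $ 2 $ 1 = 1 \<and>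
      (P \<longlongrightarrow> A ** V) (at (complex_of_real s) within upper_half) \<and> (P \<longlongrightarrow> A) (at (complex_of_real s) within lower_half) \<and>
      (Q \<longlongrightarrow> B ** V) (at (complex_of_real s) within upper_half) \<and> (Q \<longlongrightarrow> B) (at (complex_of_real s) within lower_half)"
    and growth: "\<And>e i j. e \<in> endpoints \<Longrightarrow> (\<lambda>z. P z $ i $ j) \<in>
        O[at (complex_of_real e) within (- \<real>)](\<lambda>z. complex_of_real (cmod (z - of_real e) powr (- 1 / 4)))"
      "\<And>e i j. e \<in> endpoints \<Longrightarrow> (\<lambda>z. Q z $ i $ j) \<in>
        O[at (complex_of_real e) within (- \<real>)](\<lambda>z. complex_of_real (cmod (z - of_real e) powr (- 1 / 4)))"
    and bound: "\<And>z. z \<in> outer_domain \<Longrightarrow> T0 \<le> norm z \<Longrightarrow>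
      norm (P z $ i $ 1 * Q z $ j $ 2 - P z $ i $ 2 * Q z $ j $ 1) \<le> M"
  shows "\<exists>c. \<forall>z\<in>- \<real>. P z $ i $ 1 * Q z $ j $ 2 - P z $ i $ 2 * Q z $ j $ 1 = c"
proof -
  define W where "W = (\<lambda>z. P z $ i $ 1 * Q z $ j $ 2 - P z $ i $ 2 * Q z $ j $ 1)"
  have "\<exists>g. g holomorphic_on UNIV \<and> (\<forall>z\<in>- \<real>. g z = W z)"
  proof (rule extend_entire[of W endpoints])
    show "W holomorphic_on - \<real>" unfolding W_def by (intro holomorphic_intros hol)
    show "finite {s \<in> endpoints. \<bar>s\<bar> \<le> T}" for T by (rule finite_endpoints)
  next
    fix s assume "s \<notin> endpoints"
    then obtain V A B where V: "V $ 1 $ 1 * V $ 2 $ 2 - V $ 1 $ 2 * V $ 2 $ 1 = 1"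
      and lim: "(P \<longlongrightarrow> A ** V) (at (complex_of_real s) within upper_half)" "(P \<longlongrightarrow> A) (at (complex_of_real s) within lower_half)"
        "(Q \<longlongrightarrow> B ** V) (at (complex_of_real s) within upper_half)" "(Q \<longlongrightarrow> B) (at (complex_of_real s) within lower_half)"
      using jump by blast
    define l where "l = A $ i $ 1 * B $ j $ 2 - A $ i $ 2 * B $ j $ 1"
    have "(W \<longlongrightarrow> l) (at (complex_of_real s) within lower_half)"
      unfolding W_def l_def by (intro tendsto_intros cmat2_tendsto_nth lim)
    moreover have "(W \<longlongrightarrow> (A ** V) $ i $ 1 * (B ** V) $ j $ 2 - (A ** V) $ i $ 2 * (B ** V) $ j $ 1)
        (at (complex_of_real s) within upper_half)"
      unfolding W_def by (intro tendsto_diff tendsto_mult cmat2_tendsto_nth lim)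
    moreover have "(A ** V) $ i $ 1 * (B ** V) $ j $ 2 - (A ** V) $ i $ 2 * (B ** V) $ j $ 1 =
        l * (V $ 1 $ 1 * V $ 2 $ 2 - V $ 1 $ 2 * V $ 2 $ 1)"
      unfolding l_def cmat2_mult_nth by algebra
    ultimately show "\<exists>l. (W \<longlongrightarrow> l) (at (complex_of_real s) within (- \<real>))"
      using V by (auto simp: limit_nonreal_iff)
  next
    fix e assume e: "e \<in> endpoints"
    have "(\<lambda>z. P z $ i $ k * Q z $ j $ l) \<in> O[at (complex_of_real e) within (- \<real>)](\<lambda>z.
        complex_of_real (cmod (z - of_real e) powr (- 1 / 4)) * complex_of_real (cmod (z - of_real e) powr (- 1 / 4)))" for k l
      by (intro landau_o.big.mult growth e)
    moreover have "complex_of_real (cmod (z - of_real e) powr (- 1 / 4)) * complex_of_real (cmod (z - of_real e) powr (- 1 / 4))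
        = complex_of_real (cmod (z - of_real e) powr (- 1 / 2))" for z
      by (simp add: of_real_mult[symmetric] powr_add[symmetric] del: of_real_mult)
    ultimately show "W \<in> O[at (complex_of_real e) within (- \<real>)](\<lambda>z. complex_of_real (cmod (z - of_real e) powr (- 1 / 2)))"
      unfolding W_def by (intro sum_in_bigo) auto
  qed
  then obtain g where g: "g holomorphic_on UNIV" "\<forall>z\<in>- \<real>. g z = W z" by blast
  have "\<exists>c. \<forall>z. g z = c"
  proof (rule bounded_on_outer_domain_imp_constant[OF g(1)])
    fix z assume z: "z \<in> outer_domain" "T0 \<le> norm z"
    then have "z \<in> - \<real>" by (simp add: outer_domain_def)
    then show "norm (g z) \<le> M" using bound[OF z] g(2) by (simp add: W_def)
  qed
  then show ?thesis using g(2) unfolding W_def by metis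
qed

section \<open>The normalization at infinity and the pointwise jump conditions\<close>

lemma cmat2_inverse:
  fixes A :: cmat2
  assumes "det A \<noteq> 0"
  shows "A ** matrix_inv A = mat 1" "matrix_inv A ** A = mat 1"
proof -
  have "\<exists>A'. A ** A' = mat 1 \<and> A' ** A = mat 1"
    using assms by (simp add: invertible_det_nz[symmetric] invertible_def)
  then show "A ** matrix_inv A = mat 1" "matrix_inv A ** A = mat 1"
    unfolding matrix_inv_def by (rule someI2_ex; blast)+
qed

lemma Umat_nth:
  "Umat $ 1 $ 1 = 1 / complex_of_real (sqrt 2)" "Umat $ 1 $ 2 = 1 / complex_of_real (sqrt 2)"
  "Umat $ 2 $ 1 = - \<i> / complex_of_real (sqrt 2)" "Umat $ 2 $ 2 = \<i> / complex_of_real (sqrt 2)"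
  by (simp_all add: Umat_def)

lemma Umat_det: "Umat $ 1 $ 1 * Umat $ 2 $ 2 - Umat $ 1 $ 2 * Umat $ 2 $ 1 = \<i>"
proof -
  have "complex_of_real (sqrt 2) * complex_of_real (sqrt 2) = 2"
    by (simp add: of_real_mult[symmetric] del: of_real_mult)
  then show ?thesis by (simp add: Umat_nth)
qed

text \<open>The commutator with \<open>sigma3\<close> annihilates the diagonal and doubles the upper
  right entry, so the potential is read off from the error term alone.\<close>

lemma potential_entry:
  assumes "P = Umat ** (mat 1 + E) ** Bmat S b z" and B: "Bdet S b z \<noteq> 0"
  shows "smul (\<i> * z) (commutator sigma3 (matrix_inv Umat ** P ** matrix_inv (Bmat S b z))) $ 1 $ 2
    = 2 * \<i> * z * E $ 1 $ 2"
proof -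
  have "det Umat \<noteq> 0" using Umat_det by (simp add: det_2)
  moreover have "det (Bmat S b z) \<noteq> 0" using B by (simp add: det_2 Bdet_def)
  ultimately have "matrix_inv Umat ** P ** matrix_inv (Bmat S b z) = mat 1 + E"
    unfolding assms(1) by (metis cmat2_inverse matrix_mul_assoc matrix_mul_lid matrix_mul_rid)
  then show ?thesis by (simp add: commutator_def sigma3_def cmat2_mult_nth)
qed

lemma powi_minus_one_square: "((-1 :: complex) powi k) * ((-1) powi k) = 1"
  by (simp add: power_int_mult_distrib[symmetric])

lemma eventually_at_inf: "eventually P (at_inf S) \<longleftrightarrow> (\<exists>T. \<forall>z\<in>Dom S. T \<le> norm z \<longrightarrow> P z)"
  unfolding at_inf_def eventually_inf_principal eventually_at_infinity by blast

lemma bigo_inverse_at_inf_tendsto: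
  assumes "f \<in> O[at_inf S](\<lambda>z. 1 / z)" shows "(f \<longlongrightarrow> 0) (at_inf S)"
proof -
  obtain c where c: "c > 0" "eventually (\<lambda>z. norm (f z) \<le> c * norm (1 / z)) (at_inf S)"
    using assms by (elim landau_o.bigE) auto
  have "((\<lambda>z::complex. inverse z) \<longlongrightarrow> 0) (at_inf S)"
    by (rule tendsto_mono[OF _ tendsto_inverse_0]) (simp add: at_inf_def)
  then have "((\<lambda>z. c * norm (inverse z)) \<longlongrightarrow> c * 0) (at_inf S)"
    by (intro tendsto_mult tendsto_const tendsto_norm_zero)
  then have "((\<lambda>z. c * norm (1 / z)) \<longlongrightarrow> 0) (at_inf S)"
    by (simp add: inverse_eq_divide)
  with c(2) show ?thesis by (rule Lim_null_comparison)
qed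

lemma V_gap_eq:
  "V_gap S x t n s = mat2 0 ((-1) powi (n + int (mcount S s)) * \<i> * exp (- 2 * \<i> * s * x - 4 * \<i> * s\<^sup>2 * t))
     ((-1) powi (n + int (mcount S s)) * \<i> * exp (- (- 2 * \<i> * s * x - 4 * \<i> * s\<^sup>2 * t))) 0"
  by (simp add: V_gap_def Let_def exp_sigma3_def sigma1_def cmat2_eq_iff cmat2_mult_nth)

lemma RHP_band_jump:
  assumes "RHP_solution S b x t \<Phi>" "s \<notin> edges S"
    "ext_edge S (2 * n - 2) \<le> Fin s" "Fin s \<le> ext_edge S (2 * n - 1)"
  shows "\<exists>A. (\<Phi> \<longlongrightarrow> A ** V_band S n s) (at (complex_of_real s) within upper_half) \<and>
    (\<Phi> \<longlongrightarrow> A) (at (complex_of_real s) within lower_half)"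
proof -
  obtain \<Phi>p \<Phi>m where "boundary_values \<Phi> (UNIV - edges S) \<Phi>p \<Phi>m" "\<Phi>p s = \<Phi>m s ** V_band S n s"
    using assms unfolding RHP_solution_def by blast
  then show ?thesis using assms(2) unfolding boundary_values_def by (metis DiffI UNIV_I)
qed

lemma RHP_gap_jump:
  assumes "RHP_solution S b x t \<Phi>" "s \<notin> edges S" "n \<in> gap_idx S"
    "edge S (2 * n - 1) \<le> s" "s \<le> edge S (2 * n)"
  shows "\<exists>A. (\<Phi> \<longlongrightarrow> A ** V_gap S x t n s) (at (complex_of_real s) within upper_half) \<and>
    (\<Phi> \<longlongrightarrow> A) (at (complex_of_real s) within lower_half)"
proof -
  obtain \<Phi>p \<Phi>m where "boundary_values \<Phi> (UNIV - edges S) \<Phi>p \<Phi>m" "\<Phi>p s = \<Phi>m s ** V_gap S x t n s"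
    using assms unfolding RHP_solution_def by blast
  then show ?thesis using assms(2) unfolding boundary_values_def by (metis DiffI UNIV_I)
qed

section \<open>The multiplier without its exponential factor\<close>

context multiplier begin

definition \<rho> :: "complex \<Rightarrow> complex" where
  "\<rho> z = r z * exp (- (\<i> * z * of_real L))"

lemma r_nonzero: "z \<in> slit \<Longrightarrow> r z \<noteq> 0"
  using r_reflection by force

lemma rho_nonzero: "z \<in> slit \<Longrightarrow> \<rho> z \<noteq> 0"
  by (simp add: \<rho>_def r_nonzero)

lemma rho_hol: "\<rho> holomorphic_on - \<real>"
  unfolding \<rho>_def
  by (intro holomorphic_intros holomorphic_on_subset[OF r_hol] nonreal_interior[unfolded slit_def])

lemma rho_tendsto:
  assumes "complex_of_real s \<in> slit"
  shows "(\<rho> \<longlongrightarrow> \<rho> (complex_of_real s)) (at (complex_of_real s) within (- \<real>))"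
proof -
  have "(r \<longlongrightarrow> r (complex_of_real s)) (at (complex_of_real s) within (- \<real>))"
    using r_tendsto[OF assms] by (rule tendsto_within_subset) (auto intro: nonreal_slit)
  then show ?thesis unfolding \<rho>_def by (intro tendsto_intros)
qed

text \<open>The product of the boundary values is exactly the factor by which the exponential in the
  gap jump changes from \<open>x\<close> to \<open>x + L\<close>.\<close>

lemma rho_gap:
  assumes s: "s \<in> gap_union"
  obtains u l where "(\<rho> \<longlongrightarrow> u) (at (complex_of_real s) within upper_half)"
    "(\<rho> \<longlongrightarrow> l) (at (complex_of_real s) within lower_half)" "u \<noteq> 0" "l \<noteq> 0"
    "u * l = exp (- 2 * \<i> * s * L)"
proof
  let ?e = "exp (- (\<i> * s * of_real L))"
  show "(\<rho> \<longlongrightarrow> rp s * ?e) (at (complex_of_real s) within upper_half)"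
    "(\<rho> \<longlongrightarrow> rm s * ?e) (at (complex_of_real s) within lower_half)"
    unfolding \<rho>_def by (intro tendsto_intros r_upper r_lower s)+
  show "rp s * ?e \<noteq> 0" "rm s * ?e \<noteq> 0" using r_jump[OF s] by auto
  have "rp s * ?e * (rm s * ?e) = (rp s * rm s) * (?e * ?e)" by (simp add: mult_ac)
  also have "\<dots> = exp (- 2 * \<i> * s * L)" unfolding r_jump[OF s] by (simp add: mult_exp_exp mult_ac)
  finally show "rp s * ?e * (rm s * ?e) = exp (- 2 * \<i> * s * L)" .
qed

lemma rho_asymp: "z \<in> slit \<Longrightarrow> T \<le> norm z \<Longrightarrow> norm (\<rho> z - 1) \<le> C / norm z"
  using r_asymp[of z] by (simp add: slit_def \<rho>_def exp_minus divide_inverse)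

end

section \<open>Uniqueness and periodicity\<close>

text \<open>Dressing the solution at \<open>x + L\<close> by \<open>\<rho>\<close> turns its jumps into those at \<open>x\<close>.\<close>
lemma (in multiplier) dressed_jump:
  assumes fam: "I = gap_idx S" "\<alpha> = gap_low S" "\<beta> = gap_high S" "endpoints = edges S"
    and data: "candidate_spectral_data S" and products: "products_converge S"
    and F: "RHP_solution S b x t F" and G: "RHP_solution S b (x + L) t G"
    and s: "s \<notin> endpoints"
  shows "\<exists>V A A'. V $ 1 $ 1 * V $ 2 $ 2 - V $ 1 $ 2 * V $ 2 $ 1 = 1 \<and>
    ((\<lambda>z. G z ** mat2 (\<rho> z) 0 0 (inverse (\<rho> z))) \<longlongrightarrow> A ** V) (at (complex_of_real s) within upper_half) \<and>
    ((\<lambda>z. G z ** mat2 (\<rho> z) 0 0 (inverse (\<rho> z))) \<longlongrightarrow> A) (at (complex_of_real s) within lower_half) \<and>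
    (F \<longlongrightarrow> A' ** V) (at (complex_of_real s) within upper_half) \<and>
    (F \<longlongrightarrow> A') (at (complex_of_real s) within lower_half)"
proof -
  define D where "D = (\<lambda>u. mat2 u 0 0 (inverse u))"
  have D: "((\<lambda>z. D (\<rho> z)) \<longlongrightarrow> D u) net" if "(\<rho> \<longlongrightarrow> u) net" "u \<noteq> 0" for u net
    unfolding D_def
  proof (rule cmat2_tendstoI)
    fix i j :: 2
    have "i = 1 \<or> i = 2" "j = 1 \<or> j = 2" using exhaust_2 by auto
    then show "((\<lambda>z. mat2 (\<rho> z) 0 0 (inverse (\<rho> z)) $ i $ j) \<longlongrightarrow> mat2 u 0 0 (inverse u) $ i $ j) net"
      using that by (auto intro: tendsto_inverse)
  qed
  have se: "s \<notin> edges S" using s fam(4) by simp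
  show ?thesis
  proof (cases "s \<in> gap_union")
    case False
    have I: "I \<noteq> {}" using gap_idx_nonempty[OF data] fam(1) by simp
    obtain n where n: "ext_edge S (2 * n - 2) \<le> Fin s" "Fin s \<le> ext_edge S (2 * n - 1)"
      using band_index[OF fam(1-3) I s False] by blast
    define V where "V = V_band S n s"
    obtain A where A: "(G \<longlongrightarrow> A ** V) (at (complex_of_real s) within upper_half)"
      "(G \<longlongrightarrow> A) (at (complex_of_real s) within lower_half)"
      using RHP_band_jump[OF G se n] unfolding V_def by blast
    obtain A' where A': "(F \<longlongrightarrow> A' ** V) (at (complex_of_real s) within upper_half)"
      "(F \<longlongrightarrow> A') (at (complex_of_real s) within lower_half)"
      using RHP_band_jump[OF F se n] unfolding V_def by blast
    have slit: "complex_of_real s \<in> slit" using False by (simp add: of_real_slit)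
    define u where "u = \<rho> (complex_of_real s)"
    have u: "u \<noteq> 0" unfolding u_def by (rule rho_nonzero[OF slit])
    have rho: "(\<rho> \<longlongrightarrow> u) (at (complex_of_real s) within upper_half)"
      "(\<rho> \<longlongrightarrow> u) (at (complex_of_real s) within lower_half)"
      using rho_tendsto[OF slit] by (auto simp: limit_nonreal_iff u_def)
    have "complex_of_real s \<noteq> complex_of_real (gam S k)" if k: "k \<in> gap_idx S" for k
    proof -
      have "edge S (2 * k - 1) \<le> gam S k" "gam S k \<le> edge S (2 * k)"
        using data k by (auto simp: candidate_spectral_data_def)
      moreover have "k \<in> I" using k fam(1) by simp
      then have "\<not> (\<alpha> k < s \<and> s < \<beta> k)" "s \<noteq> \<alpha> k" "s \<noteq> \<beta> k"
        using False s by (auto simp: gap_union_def endpoints_def)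
      ultimately show ?thesis by (auto simp: fam gap_low_def gap_high_def)
    qed
    then have "\<forall>k\<in>gap_idx S. complex_of_real s \<noteq> complex_of_real (gam S k)" by blast
    then have "fpm S 1 (complex_of_real s) \<noteq> 0" "fpm S (-1) (complex_of_real s) \<noteq> 0"
      by (rule fpm_nonzero[OF products], simp)+
    then have det: "V $ 1 $ 1 * V $ 2 $ 2 - V $ 1 $ 2 * V $ 2 $ 1 = 1"
      using powi_minus_one_square[of "n + int (mcount S s)"]
      by (simp add: V_def V_band_def Let_def)
    \<comment> \<open>On a band the jump and the dressing are both diagonal and commute, and
      \<open>\<rho>\<close> is continuous.\<close>
    have "A ** D u ** V = A ** V ** D u"
      by (simp add: V_def V_band_def Let_def D_def cmat2_eq_iff cmat2_mult_nth)
    then have "((\<lambda>z. G z ** D (\<rho> z)) \<longlongrightarrow> A ** D u ** V) (at (complex_of_real s) within upper_half)"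
      using cmat2_tendsto_mult[OF A(1) D[OF rho(1) u]] by simp
    moreover have "((\<lambda>z. G z ** D (\<rho> z)) \<longlongrightarrow> A ** D u) (at (complex_of_real s) within lower_half)"
      by (rule cmat2_tendsto_mult[OF A(2) D[OF rho(2) u]])
    ultimately show ?thesis using det A' unfolding D_def by blast
  next
    case True
    then obtain n where "n \<in> I" "\<alpha> n < s" "s < \<beta> n" by (auto simp: gap_union_def)
    then have n: "n \<in> gap_idx S" "edge S (2 * n - 1) \<le> s" "s \<le> edge S (2 * n)"
      by (auto simp: fam gap_low_def gap_high_def)
    define V where "V = V_gap S x t n s"
    obtain A where A: "(G \<longlongrightarrow> A ** V_gap S (x + L) t n s) (at (complex_of_real s) within upper_half)"
      "(G \<longlongrightarrow> A) (at (complex_of_real s) within lower_half)"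
      using RHP_gap_jump[OF G se n] by blast
    obtain A' where A': "(F \<longlongrightarrow> A' ** V) (at (complex_of_real s) within upper_half)"
      "(F \<longlongrightarrow> A') (at (complex_of_real s) within lower_half)"
      using RHP_gap_jump[OF F se n] unfolding V_def by blast
    obtain u l where ul: "(\<rho> \<longlongrightarrow> u) (at (complex_of_real s) within upper_half)"
      "(\<rho> \<longlongrightarrow> l) (at (complex_of_real s) within lower_half)" "u \<noteq> 0" "l \<noteq> 0"
      "u * l = exp (- 2 * \<i> * s * L)"
      using rho_gap[OF True] by blast
    define c where "c = ((-1) powi (n + int (mcount S s)) * \<i> :: complex)"
    have c: "c * c = -1"
      using powi_minus_one_square[of "n + int (mcount S s)"] by (simp add: c_def mult_ac)
    define w where "w = - 2 * \<i> * s * x - 4 * \<i> * s\<^sup>2 * t"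
    have Vx: "V = mat2 0 (c * exp w) (c * exp (- w)) 0"
      by (simp add: V_def V_gap_eq c_def w_def)
    have w: "exp (- 2 * \<i> * s * (x + L) - 4 * \<i> * s\<^sup>2 * t) = exp w * (u * l)"
      unfolding ul(5) w_def by (simp add: mult_exp_exp algebra_simps)
    have VL: "V_gap S (x + L) t n s = mat2 0 (c * (exp w * (u * l))) (c * inverse (exp w * (u * l))) 0"
      unfolding V_gap_eq w[symmetric] exp_minus[symmetric] c_def by simp
    have det: "V $ 1 $ 1 * V $ 2 $ 2 - V $ 1 $ 2 * V $ 2 $ 1 = 1"
    proof -
      have "c * exp w * (c * exp (- w)) = c * c * (exp w * exp (- w))" by (simp only: mult_ac)
      then show ?thesis by (simp add: Vx c mult_exp_exp)
    qed
    \<comment> \<open>An antidiagonal jump exchanges the two entries of the dressing when it is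
      moved past, so the upper value \<open>u\<close> and the lower value \<open>l\<close> meet in
      the product \<open>u * l\<close>.\<close>
    have "A ** D l ** V = A ** V_gap S (x + L) t n s ** D u"
      unfolding VL Vx D_def using ul(3,4)
      by (simp add: cmat2_eq_iff cmat2_mult_nth exp_minus field_simps)
    then have "((\<lambda>z. G z ** D (\<rho> z)) \<longlongrightarrow> A ** D l ** V) (at (complex_of_real s) within upper_half)"
      using cmat2_tendsto_mult[OF A(1) D[OF ul(1,3)]] by simp
    moreover have "((\<lambda>z. G z ** D (\<rho> z)) \<longlongrightarrow> A ** D l) (at (complex_of_real s) within lower_half)"
      by (rule cmat2_tendsto_mult[OF A(2) D[OF ul(2,4)]])
    ultimately show ?thesis using det A' unfolding D_def by blast
  qed
qed

text \<open>Points with imaginary part above \<open>R\<close> lie outside every disc. This gives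
  uniqueness of limits along \<open>at_inf S\<close>.\<close>

lemma (in gap_family) at_inf_nontrivial:
  assumes "outer_domain = Dom S" shows "at_inf S \<noteq> bot"
proof
  assume "at_inf S = bot"
  then have "eventually (\<lambda>_. False) (at_inf S)" by simp
  then obtain T where T: "\<And>z. z \<in> Dom S \<Longrightarrow> \<not> T \<le> norm z" unfolding eventually_at_inf by blast
  define z where "z = Complex 0 (\<bar>T\<bar> + R + 1)"
  have Im: "Im z > R" "Im z > 0" "Im z \<ge> T" using R_pos by (auto simp: z_def)
  have "R < cmod (z - complex_of_real u)" for u
    using abs_Im_le_cmod[of "z - complex_of_real u"] Im by simp
  then have "z \<in> outer_domain" using Im by (auto simp: outer_domain_def complex_is_Real_iff)
  moreover have "T \<le> norm z" using abs_Im_le_cmod[of z] Im by simp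
  ultimately show False using T assms by simp
qed

lemma (in multiplier) rho_at_inf:
  assumes outer: "outer_domain = Dom S"
  shows "(\<rho> \<longlongrightarrow> 1) (at_inf S)"
proof -
  have "((\<lambda>z. \<rho> z - 1) \<longlongrightarrow> 0) (at_inf S)"
  proof (rule bigo_inverse_at_inf_tendsto, rule landau_o.bigI[OF C_pos])
    show "eventually (\<lambda>z. norm (\<rho> z - 1) \<le> C * norm (1 / z)) (at_inf S)"
      unfolding eventually_at_inf
      using rho_asymp nonreal_slit outer
      by (intro exI[of _ T]) (auto simp: norm_divide outer_domain_def)
  qed
  then show ?thesis by (simp add: LIM_zero_iff)
qed

lemma (in multiplier) Bdet_bounds:
  assumes fam: "I = gap_idx S" "\<alpha> = gap_low S" "\<beta> = gap_high S" "outer_domain = Dom S"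
    and data: "candidate_spectral_data S" and products: "products_converge S" and branch: "b_branch S b"
  shows "\<exists>K. \<forall>z\<in>Dom S. norm (Bdet S b z) \<le> K \<and> Bdet S b z \<noteq> 0"
proof -
  have "\<alpha> n \<le> gam S n \<and> gam S n \<le> \<beta> n" if "n \<in> I" for n
    using data that unfolding fam gap_low_def gap_high_def by (auto simp: candidate_spectral_data_def)
  from gap_products_bounded[OF this] obtain K where K: "K > 0 \<and> (\<forall>z\<in>outer_domain. \<forall>F. finite F \<longrightarrow> F \<subseteq> I \<longrightarrow>
      norm (\<Prod>n\<in>F. (gam S n - z)\<^sup>2 / ((\<beta> n - z) * (\<alpha> n - z))) \<le> K \<and>
      1 / K \<le> norm (\<Prod>n\<in>F. (gam S n - z)\<^sup>2 / ((\<beta> n - z) * (\<alpha> n - z))))" ..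
  note K = conjunct1[OF K] conjunct2[OF K]
  have "norm (Bdet S b z) \<le> K + 1 \<and> Bdet S b z \<noteq> 0" if z: "z \<in> Dom S" for z
  proof -
    have zo: "z \<in> outer_domain" "z \<notin> \<real>" using z fam(4) by (auto simp: outer_domain_def)
    define p where "p = (\<lambda>n::nat. \<Prod>k\<in>{k \<in> gap_idx S. \<bar>k\<bar> \<le> int n}.
      (gam S k - z)\<^sup>2 / ((gap_high S k - z) * (gap_low S k - z)))"
    have lim: "(\<lambda>n. norm (p n)) \<longlonglongrightarrow> norm (- ((Bdet S b z)\<^sup>2))"
      unfolding p_def by (rule tendsto_norm[OF Bdet_LIMSEQ[OF data products branch zo(2)]])
    have p: "norm (p n) \<le> K" "1 / K \<le> norm (p n)" for n
    proof -
      have fin: "finite {k \<in> gap_idx S. \<bar>k\<bar> \<le> int n}"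
        by (rule finite_subset[of _ "{-int n..int n}"]) auto
      show "norm (p n) \<le> K" "1 / K \<le> norm (p n)"
        using K(2)[rule_format, OF zo(1) fin] unfolding p_def fam by auto
    qed
    have up: "norm (- ((Bdet S b z)\<^sup>2)) \<le> K" using lim p(1) by (intro LIMSEQ_le_const2) auto
    have low: "1 / K \<le> norm (- ((Bdet S b z)\<^sup>2))" using lim p(2) by (intro LIMSEQ_le_const) auto
    have "(norm (Bdet S b z))\<^sup>2 \<le> K" using up by (simp add: norm_power)
    \<comment> \<open>From \<open>2 * y \<le> y^2 + 1\<close>, which avoids a square root in the
      constant.\<close>
    then have "norm (Bdet S b z) \<le> K + 1"
      using sum_squares_bound[of "norm (Bdet S b z)" 1] K(1) by simp
    moreover have "Bdet S b z \<noteq> 0" using low K(1) by auto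
    ultimately show ?thesis by blast
  qed
  then show ?thesis by blast
qed

text \<open>The brackets of \<open>P\<close> with \<open>F\<close> are constants, determined by
  comparison with \<open>det F\<close> at infinity, where \<open>P\<close> and \<open>F\<close> have
  the same normalization. Once they are known, \<open>P\<close> follows from \<open>F\<close> by
  linear algebra; the second column suffices for the upper right entry that defines the
  potential.\<close>

lemma (in multiplier) dressed_solution_unique:
  assumes fam: "I = gap_idx S" "\<alpha> = gap_low S" "\<beta> = gap_high S" "endpoints = edges S" "outer_domain = Dom S"
    and data: "candidate_spectral_data S" and products: "products_converge S" and branch: "b_branch S b"
    and F: "RHP_solution S b x t F" and G: "RHP_solution S b (x + L) t G"
    and z: "z \<notin> \<real>"
  shows "G z $ 1 $ 2 * inverse (\<rho> z) = F z $ 1 $ 2" "G z $ 2 $ 2 * inverse (\<rho> z) = F z $ 2 $ 2"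
proof -
  define P where "P = (\<lambda>z. G z ** mat2 (\<rho> z) 0 0 (inverse (\<rho> z)))"
  have P_nth: "P z $ i $ 1 = G z $ i $ 1 * \<rho> z" "P z $ i $ 2 = G z $ i $ 2 * inverse (\<rho> z)" for z i
    by (simp_all add: P_def cmat2_mult_nth)
  have two: "k = 1 \<or> k = 2" for k :: 2 using exhaust_2 by auto
  have Fhol: "(\<lambda>z. F z $ i $ j) holomorphic_on - \<real>" and Ghol: "(\<lambda>z. G z $ i $ j) holomorphic_on - \<real>" for i j
    using F G by (auto simp: RHP_solution_def)
  have Phol: "(\<lambda>z. P z $ i $ j) holomorphic_on - \<real>" for i j
    using two[of j] rho_nonzero nonreal_slit
    by (auto simp: P_nth intro!: holomorphic_intros Ghol rho_hol)
  have jump: "\<exists>V A A'. V $ 1 $ 1 * V $ 2 $ 2 - V $ 1 $ 2 * V $ 2 $ 1 = 1 \<and>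
      (P \<longlongrightarrow> A ** V) (at (complex_of_real s) within upper_half) \<and> (P \<longlongrightarrow> A) (at (complex_of_real s) within lower_half) \<and>
      (F \<longlongrightarrow> A' ** V) (at (complex_of_real s) within upper_half) \<and> (F \<longlongrightarrow> A') (at (complex_of_real s) within lower_half)"
    if "s \<notin> endpoints" for s
    unfolding P_def by (rule dressed_jump[OF fam(1-4) data products F G that])
  have jumpF: "\<exists>V A A'. V $ 1 $ 1 * V $ 2 $ 2 - V $ 1 $ 2 * V $ 2 $ 1 = 1 \<and>
      (F \<longlongrightarrow> A ** V) (at (complex_of_real s) within upper_half) \<and> (F \<longlongrightarrow> A) (at (complex_of_real s) within lower_half) \<and>
      (F \<longlongrightarrow> A' ** V) (at (complex_of_real s) within upper_half) \<and> (F \<longlongrightarrow> A') (at (complex_of_real s) within lower_half)"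
    if "s \<notin> endpoints" for s
    using jump[OF that] by blast
  let ?q = "\<lambda>e z. complex_of_real (cmod (z - complex_of_real e) powr (- 1 / 4))"
  have Fgr: "(\<lambda>z. F z $ i $ j) \<in> O[at (complex_of_real e) within (- \<real>)](?q e)"
    and Ggr: "(\<lambda>z. G z $ i $ j) \<in> O[at (complex_of_real e) within (- \<real>)](?q e)" if "e \<in> endpoints" for e i j
    using F G that fam(4) by (auto simp: RHP_solution_def)
  have Pgr: "(\<lambda>z. P z $ i $ j) \<in> O[at (complex_of_real e) within (- \<real>)](?q e)" if e: "e \<in> endpoints" for e i j
  proof -
    note sl = endpoint_slit[OF e]
    have 1: "\<rho> \<in> O[at (complex_of_real e) within (- \<real>)](\<lambda>_. 1)"
      using rho_tendsto[OF sl] by (intro bigoI_tendsto[where c = "\<rho> (complex_of_real e)"]) auto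
    have 2: "(\<lambda>z. inverse (\<rho> z)) \<in> O[at (complex_of_real e) within (- \<real>)](\<lambda>_. 1)"
      using tendsto_inverse[OF rho_tendsto[OF sl] rho_nonzero[OF sl]]
      by (intro bigoI_tendsto[where c = "inverse (\<rho> (complex_of_real e))"]) auto
    show ?thesis
      using two[of j] landau_o.big.mult[OF Ggr[OF e, of i j] 1] landau_o.big.mult[OF Ggr[OF e, of i j] 2]
      by (auto simp: P_nth)
  qed
  obtain E1 where E1: "eventually (\<lambda>z. F z = Umat ** (mat 1 + E1 z) ** Bmat S b z) (at_inf S)"
    "\<And>i j. (\<lambda>z. E1 z $ i $ j) \<in> O[at_inf S](\<lambda>z. 1 / z)"
    using F unfolding RHP_solution_def by blast
  obtain E2 where E2: "eventually (\<lambda>z. G z = Umat ** (mat 1 + E2 z) ** Bmat S b z) (at_inf S)"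
    "\<And>i j. (\<lambda>z. E2 z $ i $ j) \<in> O[at_inf S](\<lambda>z. 1 / z)"
    using G unfolding RHP_solution_def by blast
  have lim: "((\<lambda>z. (Umat ** (mat 1 + E z)) $ i $ j) \<longlongrightarrow> Umat $ i $ j) (at_inf S)"
    if "\<And>i j. (\<lambda>z. E z $ i $ j) \<in> O[at_inf S](\<lambda>z. 1 / z)" for E i j
  proof -
    have "((\<lambda>z. mat 1 + E z) \<longlongrightarrow> mat 1 + (0 :: cmat2)) (at_inf S)"
      by (intro tendsto_add tendsto_const cmat2_tendstoI) (auto intro!: bigo_inverse_at_inf_tendsto that)
    then have "((\<lambda>z. Umat ** (mat 1 + E z)) \<longlongrightarrow> Umat) (at_inf S)"
      using cmat2_tendsto_mult[OF tendsto_const] by fastforce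
    then show ?thesis by (rule cmat2_tendsto_nth)
  qed
  define Y where "Y = (\<lambda>z. Umat ** (mat 1 + E1 z))"
  define X where "X = (\<lambda>z. Umat ** (mat 1 + E2 z))"
  have Ylim: "((\<lambda>z. Y z $ i $ j) \<longlongrightarrow> Umat $ i $ j) (at_inf S)" for i j
    unfolding Y_def by (rule lim[OF E1(2)])
  have Xlim: "((\<lambda>z. X z $ i $ j) \<longlongrightarrow> Umat $ i $ j) (at_inf S)" for i j
    unfolding X_def by (rule lim[OF E2(2)])
  note rholim = rho_at_inf[OF fam(5)]
  obtain K where K: "\<And>z. z \<in> Dom S \<Longrightarrow> norm (Bdet S b z) \<le> K" "\<And>z. z \<in> Dom S \<Longrightarrow> Bdet S b z \<noteq> 0"
    using Bdet_bounds[OF fam(1-3,5) data products branch] by blast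
  define u where "u = (\<lambda>i j. Umat $ i $ 1 * Umat $ j $ 2 - Umat $ i $ 2 * Umat $ j $ 1)"
  define wP where "wP = (\<lambda>i j z. X z $ i $ 1 * \<rho> z * Y z $ j $ 2 - X z $ i $ 2 * inverse (\<rho> z) * Y z $ j $ 1)"
  define wF where "wF = (\<lambda>i j z. Y z $ i $ 1 * Y z $ j $ 2 - Y z $ i $ 2 * Y z $ j $ 1)"
  have wPlim: "((\<lambda>z. wP i j z) \<longlongrightarrow> u i j) (at_inf S)" for i j
  proof -
    have "((\<lambda>z. wP i j z) \<longlongrightarrow> Umat $ i $ 1 * 1 * Umat $ j $ 2 - Umat $ i $ 2 * inverse 1 * Umat $ j $ 1) (at_inf S)"
      unfolding wP_def by (intro tendsto_diff tendsto_mult tendsto_inverse Xlim Ylim rholim) auto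
    then show ?thesis by (simp add: u_def)
  qed
  have wFlim: "((\<lambda>z. wF i j z) \<longlongrightarrow> u i j) (at_inf S)" for i j
    unfolding wF_def u_def by (intro tendsto_diff tendsto_mult Ylim)
  have Pfar: "eventually (\<lambda>z. P z $ i $ 1 * F z $ j $ 2 - P z $ i $ 2 * F z $ j $ 1 = Bdet S b z * wP i j z) (at_inf S)" for i j
    using E1(1) E2(1)
  proof eventually_elim
    case (elim z)
    then have FG: "F z = Y z ** Bmat S b z" "G z = X z ** Bmat S b z" by (simp_all add: X_def Y_def)
    show ?case unfolding P_nth FG by (simp add: cmat2_mult_nth Bdet_def wP_def algebra_simps)
  qed
  have Ffar: "eventually (\<lambda>z. F z $ i $ 1 * F z $ j $ 2 - F z $ i $ 2 * F z $ j $ 1 = Bdet S b z * wF i j z) (at_inf S)" for i j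
    using E1(1)
  proof eventually_elim
    case (elim z)
    then have "F z = Y z ** Bmat S b z" by (simp add: Y_def)
    then show ?case by (simp add: cmat2_mult_nth Bdet_def wF_def algebra_simps)
  qed
  have evDom: "eventually (\<lambda>z. z \<in> Dom S) (at_inf S)"
    by (simp add: eventually_at_inf)
  have bounded: "\<exists>T0 M. \<forall>z\<in>outer_domain. T0 \<le> norm z \<longrightarrow> norm (H z) \<le> M"
    if H: "eventually (\<lambda>z. H z = Bdet S b z * w z) (at_inf S)" and w: "(w \<longlongrightarrow> v) (at_inf S)"
    for H w :: "complex \<Rightarrow> complex" and v
  proof -
    have "eventually (\<lambda>z. norm (w z) < norm v + 1) (at_inf S)"
      using order_tendstoD(2)[OF tendsto_norm[OF w]] by simp
    with H evDom have "eventually (\<lambda>z. norm (H z) \<le> K * (norm v + 1)) (at_inf S)"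
    proof eventually_elim
      case (elim z)
      have "0 \<le> K" using K(1)[OF elim(2)] norm_ge_zero order_trans by blast
      then show ?case unfolding elim(1) norm_mult using elim K(1)[OF elim(2)] by (intro mult_mono) auto
    qed
    then show ?thesis unfolding eventually_at_inf fam(5) by blast
  qed
  have "\<exists>c. \<forall>z\<in>- \<real>. P z $ i $ 1 * F z $ j $ 2 - P z $ i $ 2 * F z $ j $ 1 = c" for i j
  proof -
    obtain T0 M where "\<forall>z\<in>outer_domain. T0 \<le> norm z \<longrightarrow> norm (P z $ i $ 1 * F z $ j $ 2 - P z $ i $ 2 * F z $ j $ 1) \<le> M"
      using bounded[OF Pfar wPlim] by blast
    then show ?thesis
      by (intro bracket_constant[OF Phol Fhol jump Pgr Fgr]) auto
  qed
  then obtain c where c: "\<And>i j z. z \<notin> \<real> \<Longrightarrow> P z $ i $ 1 * F z $ j $ 2 - P z $ i $ 2 * F z $ j $ 1 = c i j"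
    by (metis ComplI)
  have "\<exists>c. \<forall>z\<in>- \<real>. F z $ 1 $ 1 * F z $ 2 $ 2 - F z $ 1 $ 2 * F z $ 2 $ 1 = c"
  proof -
    obtain T0 M where "\<forall>z\<in>outer_domain. T0 \<le> norm z \<longrightarrow> norm (F z $ 1 $ 1 * F z $ 2 $ 2 - F z $ 1 $ 2 * F z $ 2 $ 1) \<le> M"
      using bounded[OF Ffar wFlim] by blast
    then show ?thesis
      by (intro bracket_constant[OF Fhol Fhol jumpF Fgr Fgr]) auto
  qed
  then obtain d where d: "\<And>z. z \<notin> \<real> \<Longrightarrow> F z $ 1 $ 1 * F z $ 2 $ 2 - F z $ 1 $ 2 * F z $ 2 $ 1 = d"
    by (metis ComplI)
  note nontriv = at_inf_nontrivial[OF fam(5)]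
  have u12: "u 1 2 = \<i>" using Umat_det by (simp add: u_def)
  \<comment> \<open>Only bounds on \<open>Bdet\<close> are available at infinity, not a limit; cross
    multiplication of two bracket identities eliminates it.\<close>
  have cd: "c i j * u 1 2 = d * u i j" for i j
  proof (rule tendsto_unique[OF nontriv])
    show "((\<lambda>z. c i j * wF 1 2 z) \<longlongrightarrow> c i j * u 1 2) (at_inf S)" by (intro tendsto_mult tendsto_const wFlim)
    have "eventually (\<lambda>z. d * wP i j z = c i j * wF 1 2 z) (at_inf S)"
      using Pfar[of i j] Ffar[of 1 2] evDom
    proof eventually_elim
      case (elim z)
      have "z \<notin> \<real>" using elim(3) fam(5) by (auto simp: outer_domain_def)
      then have "c i j = Bdet S b z * wP i j z" "d = Bdet S b z * wF 1 2 z"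
        using elim(1,2) c d by metis+
      then show ?case by simp
    qed
    moreover have "((\<lambda>z. d * wP i j z) \<longlongrightarrow> d * u i j) (at_inf S)" by (intro tendsto_mult tendsto_const wPlim)
    ultimately show "((\<lambda>z. c i j * wF 1 2 z) \<longlongrightarrow> d * u i j) (at_inf S)" using tendsto_cong by fast
  qed
  have d0: "d \<noteq> 0"
  proof
    assume "d = 0"
    have "eventually (\<lambda>z. wF 1 2 z \<noteq> 0) (at_inf S)"
      using wFlim[of 1 2] u12 by (intro tendsto_imp_eventually_ne) auto
    with Ffar[of 1 2] evDom have "eventually (\<lambda>z. False) (at_inf S)"
    proof eventually_elim
      case (elim z)
      have "z \<notin> \<real>" using elim(2) fam(5) by (auto simp: outer_domain_def)
      then show ?case using d[of z] elim K(2)[of z] \<open>d = 0\<close> by simp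
    qed
    then show False using nontriv by simp
  qed
  have c11: "c 1 1 = 0" "c 2 2 = 0" "c 1 2 = d" "c 2 1 = - d"
  proof -
    have "u 1 1 = 0" "u 2 2 = 0" "u 2 1 = - u 1 2" by (simp_all add: u_def)
    then have "c 1 1 * \<i> = 0" "c 2 2 * \<i> = 0" "c 1 2 * \<i> = d * \<i>" "c 2 1 * \<i> = (- d) * \<i>"
      using cd[of 1 1] cd[of 2 2] cd[of 1 2] cd[of 2 1] unfolding u12 by simp_all
    then show "c 1 1 = 0" "c 2 2 = 0" "c 1 2 = d" "c 2 1 = - d"
      unfolding mult_cancel_right by simp_all
  qed
  \<comment> \<open>Cramer's rule: the two brackets are a linear system for the first row of
    \<open>P\<close> with determinant \<open>d\<close>.\<close>
  have "P z $ 1 $ 2 * d = F z $ 1 $ 2 * d"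
    using c[OF z, of 1 1] c[OF z, of 1 2] d[OF z] unfolding c11 by algebra
  then show "G z $ 1 $ 2 * inverse (\<rho> z) = F z $ 1 $ 2" using d0 by (simp add: P_nth)
  have "P z $ 2 $ 2 * d = F z $ 2 $ 2 * d"
    using c[OF z, of 2 1] c[OF z, of 2 2] d[OF z] unfolding c11 by algebra
  then show "G z $ 2 $ 2 * inverse (\<rho> z) = F z $ 2 $ 2" using d0 by (simp add: P_nth)
qed

text \<open>\<open>Bmat\<close> is diagonal with nonzero lower entry, which cancels in the second
  column. The combination of the first row with \<open>\<i>\<close> times the second is, up to a
  constant, a row of the inverse of \<open>Umat\<close>, so it isolates the upper right error
  entry.\<close>

lemma (in multiplier) dressed_error_entry:
  assumes fam: "I = gap_idx S" "\<alpha> = gap_low S" "\<beta> = gap_high S" "endpoints = edges S" "outer_domain = Dom S"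
    and data: "candidate_spectral_data S" and products: "products_converge S" and branch: "b_branch S b"
    and F: "RHP_solution S b x t F" and G: "RHP_solution S b (x + L) t G"
    and z: "z \<notin> \<real>" and B: "Bdet S b z \<noteq> 0"
    and Fz: "F z = Umat ** (mat 1 + E1) ** Bmat S b z" and Gz: "G z = Umat ** (mat 1 + E2) ** Bmat S b z"
  shows "E1 $ 1 $ 2 = E2 $ 1 $ 2 * inverse (\<rho> z)"
proof -
  have b2: "Bmat S b z $ 2 $ 2 \<noteq> 0" using B by (simp add: Bdet_def)
  note eqs = dressed_solution_unique[OF fam data products branch F G z]
  define X where "X = Umat ** (mat 1 + E2)"
  define Y where "Y = Umat ** (mat 1 + E1)"
  have "Y $ 1 $ 2 = X $ 1 $ 2 * inverse (\<rho> z)" "Y $ 2 $ 2 = X $ 2 $ 2 * inverse (\<rho> z)"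
    using eqs b2 unfolding Fz Gz X_def[symmetric] Y_def[symmetric] by (simp_all add: cmat2_mult_nth)
  then have "Y $ 1 $ 2 + \<i> * Y $ 2 $ 2 = (X $ 1 $ 2 + \<i> * X $ 2 $ 2) * inverse (\<rho> z)"
    by (simp add: algebra_simps)
  moreover have "(Umat ** (mat 1 + E)) $ 1 $ 2 + \<i> * (Umat ** (mat 1 + E)) $ 2 $ 2
      = 2 / complex_of_real (sqrt 2) * E $ 1 $ 2" for E
    by (simp add: cmat2_mult_nth Umat_nth algebra_simps)
  then have "X $ 1 $ 2 + \<i> * X $ 2 $ 2 = 2 / complex_of_real (sqrt 2) * E2 $ 1 $ 2"
    "Y $ 1 $ 2 + \<i> * Y $ 2 $ 2 = 2 / complex_of_real (sqrt 2) * E1 $ 1 $ 2"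
    by (simp_all add: X_def Y_def)
  ultimately have "2 / complex_of_real (sqrt 2) * E1 $ 1 $ 2 =
      2 / complex_of_real (sqrt 2) * (E2 $ 1 $ 2 * inverse (\<rho> z))"
    by (simp only: mult.assoc)
  then show ?thesis by simp
qed

theorem theorem6p1:
  fixes S :: spectral_data
    and b :: "complex \<Rightarrow> complex"
    and \<Phi> :: "real \<Rightarrow> real \<Rightarrow> complex \<Rightarrow> complex ^ 2 ^ 2"
    and q :: "real \<Rightarrow> real \<Rightarrow> complex"
    and r1 :: "complex \<Rightarrow> complex"
    and r1p r1m :: "real \<Rightarrow> complex"
    and L1 :: real
    and x t :: real
  assumes data: "candidate_spectral_data S"
    and products: "products_converge S"
    and branch: "b_branch S b"
    and solution: "\<And>x t. RHP_solution S b x t (\<Phi> x t)"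
    and potential: "\<And>x t. potential_value S b (\<Phi> x t) (q x t)"
    and r1_holomorphic: "holomorphic_off_gaps S r1"
    and r1_boundary: "boundary_values r1 (- Sigma_set S) r1p r1m"
    and r1_jump: "\<And>s. s \<in> - Sigma_set S \<Longrightarrow> r1m s \<noteq> 0 \<and> r1p s = inverse (r1m s)"
    and L1_pos: "L1 > 0"
    and r1_asymptotics:
      "(\<lambda>z. r1 z / exp (\<i> * z * of_real L1) - 1)
         \<in> O[inf at_infinity (principal (- complex_of_real ` (- Sigma_set S)))](\<lambda>z. 1 / z)"
    and r1_growth: "r1 \<in> A2 (Dom S)"
  shows "q (x + L1) t = q x t"
proof -
  obtain N where "gap_family (gap_idx S) (gap_low S) (gap_high S) (radius S) N"
    using gap_family_of_data[OF data] by blast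
  then interpret gap_family "gap_idx S" "gap_low S" "gap_high S" "radius S" N .
  have gaps: "- Sigma_set S = gap_union"
    by (simp add: Sigma_set_def gaps_def gap_union_def gap_low_def gap_high_def Compl_eq_Diff_UNIV double_diff)
  have ends: "endpoints = edges S"
    unfolding endpoints_def edges_def edge_idx_def gap_low_def gap_high_def by auto
  have outer: "outer_domain = Dom S"
  proof -
    have "closure (disc S n) = cball (complex_of_real (center n)) (radius S)" for n
      using R_pos by (simp add: disc_def center_def gap_low_def gap_high_def closure_ball add.commute)
    then show ?thesis
      by (auto simp: outer_domain_def Dom_def dist_norm norm_minus_commute not_le)
  qed
  obtain C where C: "C > 0" "eventually (\<lambda>z. norm (r1 z / exp (\<i> * z * of_real L1) - 1) \<le> C * norm (1 / z))
      (inf at_infinity (principal (- complex_of_real ` gap_union)))"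
    using r1_asymptotics unfolding gaps by (elim landau_o.bigE) auto
  obtain T0 where T0: "\<And>z. T0 \<le> norm z \<Longrightarrow> z \<in> - complex_of_real ` gap_union \<Longrightarrow>
      norm (r1 z / exp (\<i> * z * of_real L1) - 1) \<le> C * norm (1 / z)"
    using C(2) unfolding eventually_inf_principal eventually_at_infinity by blast
  \<comment> \<open>The radius is raised to at least one to make it positive.\<close>
  interpret multiplier "gap_idx S" "gap_low S" "gap_high S" "radius S" N r1 r1p r1m L1 C "max T0 1"
  proof
    show "continuous_on (- complex_of_real ` gap_union) r1"
      "r1 holomorphic_on interior (- complex_of_real ` gap_union)"
      using r1_holomorphic unfolding holomorphic_off_gaps_def gaps by auto
    fix s assume s: "s \<in> gap_union"
    show "(r1 \<longlongrightarrow> r1p s) (at (complex_of_real s) within upper_half)"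
      "(r1 \<longlongrightarrow> r1m s) (at (complex_of_real s) within lower_half)"
      using r1_boundary s unfolding boundary_values_def gaps by auto
    show "r1p s * r1m s = 1" using r1_jump[of s] s unfolding gaps by simp
  next
    fix z assume "z \<notin> complex_of_real ` gap_union" "max T0 1 \<le> norm z"
    then show "norm (r1 z / exp (\<i> * z * of_real L1) - 1) \<le> C / norm z"
      using T0[of z] by (simp add: norm_divide)
  qed (use L1_pos C(1) in auto)
  note fam = refl refl refl ends outer
  define h where "h = (\<lambda>y z. smul (\<i> * z) (commutator sigma3
    (matrix_inv Umat ** \<Phi> y t z ** matrix_inv (Bmat S b z))) $ 1 $ 2)"
  have h: "(h y \<longlongrightarrow> q y t) (at_inf S)" for y
  proof -
    obtain Q where Q: "((\<lambda>z. smul (\<i> * z) (commutator sigma3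
        (matrix_inv Umat ** \<Phi> y t z ** matrix_inv (Bmat S b z)))) \<longlongrightarrow> Q) (at_inf S)" "q y t = Q $ 1 $ 2"
      using potential[of y t] unfolding potential_value_def by blast
    show ?thesis unfolding h_def Q(2) by (rule cmat2_tendsto_nth[OF Q(1)])
  qed
  obtain E1 where E1: "eventually (\<lambda>z. \<Phi> x t z = Umat ** (mat 1 + E1 z) ** Bmat S b z) (at_inf S)"
    using solution[of x t] unfolding RHP_solution_def by blast
  obtain E2 where E2: "eventually (\<lambda>z. \<Phi> (x + L1) t z = Umat ** (mat 1 + E2 z) ** Bmat S b z) (at_inf S)"
    using solution[of "x + L1" t] unfolding RHP_solution_def by blast
  have dom: "eventually (\<lambda>z. z \<in> Dom S) (at_inf S)" by (simp add: eventually_at_inf)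
  \<comment> \<open>The expressions whose limits define the two potentials differ by the factor
    \<open>\<rho>\<close> only, which tends to one.\<close>
  have "eventually (\<lambda>z. h (x + L1) z = h x z * \<rho> z) (at_inf S)"
    using E1 E2 dom
  proof eventually_elim
    case (elim z)
    have z: "z \<notin> \<real>" using elim(3) outer by (auto simp: outer_domain_def)
    have B: "Bdet S b z \<noteq> 0"
      using Bdet_bounds[OF refl refl refl outer data products branch] elim(3) by blast
    have "E1 z $ 1 $ 2 = E2 z $ 1 $ 2 * inverse (\<rho> z)"
      by (rule dressed_error_entry[OF fam data products branch solution solution z B elim(1,2)])
    moreover have "\<rho> z \<noteq> 0" using rho_nonzero nonreal_slit z by blast
    moreover have "h x z = 2 * \<i> * z * E1 z $ 1 $ 2" "h (x + L1) z = 2 * \<i> * z * E2 z $ 1 $ 2"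
      unfolding h_def using elim(1,2) B by (intro potential_entry; simp)+
    ultimately show ?case by simp
  qed
  moreover have "((\<lambda>z. h x z * \<rho> z) \<longlongrightarrow> q x t * 1) (at_inf S)"
    by (intro tendsto_mult h rho_at_inf outer)
  ultimately have "(h (x + L1) \<longlongrightarrow> q x t) (at_inf S)" using tendsto_cong by fastforce
  then show ?thesis using tendsto_unique[OF at_inf_nontrivial[OF outer] h] by blast
qed

end
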